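(* Let $\mathbb{K}$ be a field of characteristic zero, let $k\leq n$ be positive integers, let $\lambda\vdash n$, $\mu\vdash k$ be partitions with $\mu\subset\lambda$ (i.e. $\mu_i\leq\lambda_i$ for all $i$), let $T$ be a Young tableau of shape $\lambda$ with entries $1,\dots,n$, and let $S$ be the Young subtableau of $T$ of shape $\mu$. Let $L(T;S)\subset\mathfrak{S}_n$ be the set of permutations $\sigma$ such that for every entry $s$ of $S$, either $\sigma(s)=s$ or $\sigma(s)$ lies in a column of $T$ strictly to the left of the column of $T$ containing $s$, and such that moreover, if $\sigma(s)=s$ for all entries $s$ of $S$, then $\sigma=\mathbf{1}$ is the identity. Then there exist rational numbers $m_\sigma$, $\sigma\in L(T;S)$, with $m_{\mathbf{1}}=\alpha_\mu$, $m_\sigma\geq 0$ whenever $\sigma$ is even and $m_\sigma\leq 0$ whenever $\sigma$ is odd, such that in $\mathbb{K}[\mathfrak{S}_n]$ \[\mathfrak{c}_{\lambda}(T)\cdot\mathfrak{c}_{\mu}(S)=\mathfrak{c}_{\lambda}(T)\cdot\Big(\sum_{\sigma\in L(T;S)}m_\sigma\cdot\sigma\Big).\]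
   Context: Permutations are multiplied by composition, $(\sigma\tau)(x)=\sigma(\tau(x))$, and $\mathfrak{S}_X$ denotes the symmetric group of a finite set $X$, viewed as a subgroup of $\mathfrak{S}_n$ when $X\subseteq\{1,\dots,n\}$. The Young diagram of $\lambda$ is $D_\lambda=\{(i,j):1\leq j\leq\lambda_i\}$; a Young tableau of shape $\lambda$ with entries in a set $A$ is a bijection $T:D_\lambda\to A$, drawn as left-justified rows of boxes; $R_i(T)$ and $C_j(T)$ are the sets of entries in its $i$-th row and $j$-th column. The Young subtableau of shape $\mu\subset\lambda$ is the restriction $T|_{D_\mu}$ (the first $\mu_i$ entries of each row $i$). For $X$ a set, $\mathfrak{a}(X)=\sum_{\sigma\in\mathfrak{S}_X}\sigma$ and $\mathfrak{b}(X)=\sum_{\tau\in\mathfrak{S}_X}\mathrm{sgn}(\tau)\tau$. The Young symmetrizer is $\mathfrak{c}_\lambda(T)=\mathfrak{a}_\lambda(T)\mathfrak{b}_\lambda(T)$ where $\mathfrak{a}_\lambda(T)=\prod_i\mathfrak{a}(R_i(T))$ and $\mathfrak{b}_\lambda(T)=\prod_j\mathfrak{b}(C_j(T))$. The hook of $\mu$ centered at $(x,y)\in D_\mu$ is $\{(x,j)\in D_\mu:j\geq y\}\cup\{(i,y)\in D_\mu:i\geq x\}$, and $\alpha_\mu$ is the product over all $(x,y)\in D_\mu$ of the sizes of these hooks. *)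

theory Defs
  imports Complex_Main "HOL-Algebra.Sym_Groups"
begin

text \<open>
  An element of the group algebra \<open>\<bbbK>[\<SS>\<^sub>n]\<close> is represented by its coefficient function on
  \<open>carrier (sym_group n) = {p. p permutes {1..n}}\<close>, extended by \<open>0\<close>.
\<close>

definition lin_comb :: "(nat \<Rightarrow> nat) set \<Rightarrow> ((nat \<Rightarrow> nat) \<Rightarrow> 'k) \<Rightarrow> (nat \<Rightarrow> nat) \<Rightarrow> 'k::field" where
  \<comment> \<open>the formal sum of all \<open>m \<sigma> \<cdot> \<sigma>\<close> with \<open>\<sigma> \<in> A\<close>\<close>
  "lin_comb A m = (\<lambda>\<sigma>. if \<sigma> \<in> A then m \<sigma> else 0)"

definition alg_mult ::
  "nat \<Rightarrow> ((nat \<Rightarrow> nat) \<Rightarrow> 'k) \<Rightarrow> ((nat \<Rightarrow> nat) \<Rightarrow> 'k) \<Rightarrow> (nat \<Rightarrow> nat) \<Rightarrow> 'k::field" where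
  "alg_mult n f g = (\<lambda>\<pi>.
     \<Sum>(\<sigma>, \<tau>) \<in> {(\<sigma>, \<tau>). \<sigma> \<in> carrier (sym_group n) \<and> \<tau> \<in> carrier (sym_group n)
                       \<and> \<sigma> \<otimes>\<^bsub>sym_group n\<^esub> \<tau> = \<pi>}. f \<sigma> * g \<tau>)"

definition alg_one :: "(nat \<Rightarrow> nat) \<Rightarrow> 'k::field" where
  "alg_one = lin_comb {id} (\<lambda>_. 1)"

definition alg_prod :: "nat \<Rightarrow> ((nat \<Rightarrow> nat) \<Rightarrow> 'k) list \<Rightarrow> (nat \<Rightarrow> nat) \<Rightarrow> 'k::field" where
  "alg_prod n fs = foldr (alg_mult n) fs alg_one"

definition sym_sum :: "nat set \<Rightarrow> (nat \<Rightarrow> nat) \<Rightarrow> 'k::field" where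
  "sym_sum X = lin_comb {\<sigma>. \<sigma> permutes X} (\<lambda>_. 1)"

definition alt_sum :: "nat set \<Rightarrow> (nat \<Rightarrow> nat) \<Rightarrow> 'k::field" where
  "alt_sum X = lin_comb {\<sigma>. \<sigma> permutes X} (\<lambda>\<sigma>. of_int (sign \<sigma>))"

definition is_partition :: "nat list \<Rightarrow> nat \<Rightarrow> bool" where
  "is_partition lam n \<longleftrightarrow> sorted_wrt (\<ge>) lam \<and> 0 \<notin> set lam \<and> sum_list lam = n"

definition part :: "nat list \<Rightarrow> nat \<Rightarrow> nat" where
  \<comment> \<open>the \<open>i\<close>-th part, counted from \<open>1\<close> and \<open>0\<close> beyond the last part\<close>
  "part lam i = (if 1 \<le> i \<and> i \<le> length lam then lam ! (i - 1) else 0)"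

definition partition_le :: "nat list \<Rightarrow> nat list \<Rightarrow> bool" where
  "partition_le mu lam \<longleftrightarrow> (\<forall>i \<ge> 1. part mu i \<le> part lam i)"

definition young_diagram :: "nat list \<Rightarrow> (nat \<times> nat) set" where
  "young_diagram lam = {(i, j). 1 \<le> i \<and> 1 \<le> j \<and> j \<le> part lam i}"

definition young_tableau :: "nat list \<Rightarrow> nat set \<Rightarrow> (nat \<times> nat \<Rightarrow> nat) \<Rightarrow> bool" where
  "young_tableau lam A T \<longleftrightarrow> bij_betw T (young_diagram lam) A"

definition subtableau :: "nat list \<Rightarrow> (nat \<times> nat \<Rightarrow> nat) \<Rightarrow> nat \<times> nat \<Rightarrow> nat" where
  "subtableau mu T = restrict T (young_diagram mu)"

definition tab_entries :: "nat list \<Rightarrow> (nat \<times> nat \<Rightarrow> nat) \<Rightarrow> nat set" where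
  "tab_entries lam T = T ` young_diagram lam"

definition tab_row :: "nat list \<Rightarrow> (nat \<times> nat \<Rightarrow> nat) \<Rightarrow> nat \<Rightarrow> nat set" where
  "tab_row lam T i = {T (i, j) |j. (i, j) \<in> young_diagram lam}"

definition tab_column :: "nat list \<Rightarrow> (nat \<times> nat \<Rightarrow> nat) \<Rightarrow> nat \<Rightarrow> nat set" where
  "tab_column lam T j = {T (i, j) |i. (i, j) \<in> young_diagram lam}"

text \<open>
  The factors of each of the two products below are supported on permutations of pairwise
  disjoint sets, hence commute; they are multiplied in increasing order of the index.  The
  nonempty rows are numbered \<open>1, \<dots>, length lam\<close>, the nonempty columns \<open>1, \<dots>, part lam 1\<close>.
  The parameter \<open>n\<close> says in which \<open>\<SS>\<^sub>n\<close> the products are taken.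
\<close>

definition row_symmetrizer ::
  "nat \<Rightarrow> nat list \<Rightarrow> (nat \<times> nat \<Rightarrow> nat) \<Rightarrow> (nat \<Rightarrow> nat) \<Rightarrow> 'k::field" where
  "row_symmetrizer n lam T = alg_prod n (map (\<lambda>i. sym_sum (tab_row lam T i)) [1..<length lam + 1])"

definition column_antisymmetrizer ::
  "nat \<Rightarrow> nat list \<Rightarrow> (nat \<times> nat \<Rightarrow> nat) \<Rightarrow> (nat \<Rightarrow> nat) \<Rightarrow> 'k::field" where
  "column_antisymmetrizer n lam T =
     alg_prod n (map (\<lambda>j. alt_sum (tab_column lam T j)) [1..<part lam 1 + 1])"

definition young_symmetrizer ::
  "nat \<Rightarrow> nat list \<Rightarrow> (nat \<times> nat \<Rightarrow> nat) \<Rightarrow> (nat \<Rightarrow> nat) \<Rightarrow> 'k::field" where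
  "young_symmetrizer n lam T =
     alg_mult n (row_symmetrizer n lam T) (column_antisymmetrizer n lam T)"

definition hook :: "nat list \<Rightarrow> nat \<Rightarrow> nat \<Rightarrow> (nat \<times> nat) set" where
  "hook mu x y = {(x, j) |j. (x, j) \<in> young_diagram mu \<and> j \<ge> y}
               \<union> {(i, y) |i. (i, y) \<in> young_diagram mu \<and> i \<ge> x}"

definition hook_product :: "nat list \<Rightarrow> nat" where
  "hook_product mu = (\<Prod>(x, y) \<in> young_diagram mu. card (hook mu x y))"

definition left_perms ::
  "nat \<Rightarrow> nat list \<Rightarrow> (nat \<times> nat \<Rightarrow> nat) \<Rightarrow> nat list \<Rightarrow> (nat \<times> nat \<Rightarrow> nat) \<Rightarrow> (nat \<Rightarrow> nat) set" where
  \<comment> \<open>the set \<open>L(T;S)\<close>, for \<open>T\<close> of shape \<open>lam\<close> and \<open>S\<close> of shape \<open>mu\<close>\<close>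
  "left_perms n lam T mu S = {\<sigma> \<in> carrier (sym_group n).
     (\<forall>s \<in> tab_entries mu S. \<sigma> s = s \<or>
        (\<exists>j j'. s \<in> tab_column lam T j \<and> \<sigma> s \<in> tab_column lam T j' \<and> j' < j)) \<and>
     ((\<forall>s \<in> tab_entries mu S. \<sigma> s = s) \<longrightarrow> \<sigma> = id)}"

end

theory Submission
  imports Defs
begin

text \<open>
  A word is a map from the entries of \<open>T\<close> to column numbers; \<open>\<sigma>\<close> gives the word \<open>col \<circ> \<sigma>\<close>.  Up to
  sign, \<open>\<cc>\<^sub>\<lambda>(T) \<cdot> \<sigma>\<close> depends only on this word, and as a function of the word it is killed by the
  operators \<open>lower i j\<close> that replace one letter \<open>i\<close> by a larger letter \<open>j\<close> in all possible ways
  (the Garnir relations).  After this sign twist all coefficients have to be nonnegative.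

  Let \<open>Z\<close> be the sum of the transpositions of entries of \<open>S\<close>.  By the Casimir identity, \<open>Z\<close> is a scalar
  depending on the word, plus terms factoring through the operators \<open>lower\<close> on \<open>S\<close>; modulo the Garnir
  relations such a term swaps an entry of \<open>S\<close> with a smaller letter outside \<open>S\<close>, with a negative
  sign.  Solving the eigenvector equation for \<open>Z\<close> along sequences of such swaps therefore yields
  \<open>\<Psi> = col + (words smaller on S)\<close> with nonnegative coefficients and the eigenvalue of \<open>col\<close>.
  The other Casimir eigenvalues being strictly larger, \<open>\<Psi>\<close> is annihilated by the lowering operators of
  \<open>S\<close>, and a Capelli type computation, row by row and column by column, shows that \<open>\<cc>\<^sub>\<mu>(S)\<close> multiplies
  \<open>\<Psi>\<close> by the product of the hook lengths.  On the other hand \<open>\<cc>\<^sub>\<mu>(S)\<close> kills every smaller word,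
  because such a word repeats a letter in a row of \<open>S\<close>; so \<open>\<Psi> \<cdot> \<cc>\<^sub>\<mu>(S) = col \<cdot> \<cc>\<^sub>\<mu>(S)\<close>.
\<close>

section \<open>Lowering operators and the Casimir operator\<close>

text \<open>The obstacle is sign control: substituting Garnir relations one after another mixes
  signs. Modulo these relations the Casimir operator is a diagonal part minus swaps, and every swap
  leads to a word with a strictly larger diagonal entry than that of \<open>col\<close>. Solving the
  eigenvector equation is therefore a terminating sum of products of positive reciprocals. The gaps
  are positive because the eigenvalue is a convex function of the letter counts whose linear part at
  \<open>col\<close> grows along swaps.

  The background is Schur-Weyl duality: words are basis tensors, \<open>lower\<close> comes from
  matrix units of the general linear Lie algebra, and place permutations commute with them, so that
  a highest weight argument turns the eigenvector equation into annihilation by lowering operators.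
  Combinations of words are never built as objects; they are tested against functions \<phi> on
  words, with coefficients chosen before \<phi>. The Capelli computation yields hook lengths divided
  by leg lengths; these denominators multiply to the order of the column group of \<open>S\<close>,
  which the symmetrization over columns contributes once more and so cancels.\<close>

definition lower ::
  "nat set \<Rightarrow> nat \<Rightarrow> nat \<Rightarrow> ((nat \<Rightarrow> nat) \<Rightarrow> 'k::field_char_0) \<Rightarrow> (nat \<Rightarrow> nat) \<Rightarrow> 'k" where
  "lower A i j \<psi> f = (\<Sum>s | s \<in> A \<and> f s = i. \<psi> (f(s := j)))"

text \<open>In terms of the sum \<open>Z\<close> of transpositions this is \<open>|A| + 2 Z\<close>:
  ordered pairs count each transposition twice and the pairs with \<open>s = t\<close> contribute
  identities. Hence the factors 2 below.\<close>

definition casimir ::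
  "nat set \<Rightarrow> ((nat \<Rightarrow> nat) \<Rightarrow> 'k::field_char_0) \<Rightarrow> (nat \<Rightarrow> nat) \<Rightarrow> 'k" where
  "casimir A \<psi> f = (\<Sum>s\<in>A. \<Sum>t\<in>A. \<psi> (f \<circ> transpose s t))"

text \<open>If the letter \<open>l\<close> occurs \<open>n_l\<close> times in \<open>A\<close>, this
  is the sum of \<open>n_l^2 - 2 (l - 1) n_l\<close>. For decreasing counts it equals
  \<open>|A|\<close> plus twice the content sum of the diagram with row lengths \<open>n_l\<close>,
  the classical eigenvalue of \<open>casimir\<close>.\<close>

definition casimir_eigenvalue :: "nat set \<Rightarrow> (nat \<Rightarrow> nat) \<Rightarrow> int" where
  "casimir_eigenvalue A f =
     (\<Sum>s\<in>A. \<Sum>t\<in>A. if f t = f s then 1 else 0) - 2 * (\<Sum>s\<in>A. int (f s) - 1)"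

lemma fun_upd_transpose:
  assumes "f t = i" "s \<noteq> t"
  shows "(f(s := i))(t := f s) = f \<circ> transpose s t"
  using assms by (auto simp: fun_eq_iff transpose_def)

text \<open>Once \<open>s\<close> carries \<open>i\<close>, the places with letter \<open>i\<close>
  are \<open>s\<close> itself, whose change restores \<open>f\<close>, and the old ones, whose
  change completes an exchange of letters with \<open>s\<close>. This is how transpositions arise
  from letter replacements.\<close>

lemma lower_upd:
  assumes "finite A" "s \<in> A" "i \<noteq> f s"
  shows "lower A i (f s) \<psi> (f(s := i)) =
    \<psi> f + (\<Sum>t | t \<in> A \<and> f t = i. \<psi> (f \<circ> transpose s t))"
proof -
  have "{t. t \<in> A \<and> (f(s := i)) t = i} = insert s {t. t \<in> A \<and> f t = i}"
    using assms by auto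
  moreover have "s \<notin> {t. t \<in> A \<and> f t = i}"
    using assms by auto
  moreover have "(\<Sum>t | t \<in> A \<and> f t = i. \<psi> ((f(s := i))(t := f s))) =
      (\<Sum>t | t \<in> A \<and> f t = i. \<psi> (f \<circ> transpose s t))"
    using assms by (intro sum.cong refl arg_cong[of _ _ \<psi>] fun_upd_transpose) auto
  ultimately show ?thesis
    using assms by (simp add: lower_def)
qed

lemma sum_by_value:
  fixes g :: "nat \<Rightarrow> 'k::field_char_0"
  assumes "finite A" "finite I"
  shows "(\<Sum>i\<in>I. \<Sum>t | t \<in> A \<and> f t = i. g t) = (\<Sum>t | t \<in> A \<and> f t \<in> I. g t)"
proof -
  have "(\<Sum>t | t \<in> A \<and> f t \<in> I. g t) = (\<Sum>i\<in>I. \<Sum>t | t \<in> {t \<in> A. f t \<in> I} \<and> f t = i. g t)"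
    using assms by (subst sum.group[of "{t \<in> A. f t \<in> I}" I f g]) auto
  also have "\<dots> = (\<Sum>i\<in>I. \<Sum>t | t \<in> A \<and> f t = i. g t)"
    by (intro sum.cong refl) auto
  finally show ?thesis by simp
qed

text \<open>Split the ordered pairs by comparing letters. Equal letters leave the word unchanged,
  and the two strict cases agree because transpositions are symmetric. By \<open>lower_upd\<close> a
  strict case is a double replacement minus \<open>f s - 1\<close> copies of
  \<open>\<psi> f\<close>, one for each positive letter below \<open>f s\<close>; these copies are
  the linear part of the eigenvalue. The remaining operators only turn a letter into a larger one,
  so they vanish on highest weight vectors.\<close>

lemma casimir_decomp:
  fixes \<psi> :: "(nat \<Rightarrow> nat) \<Rightarrow> 'k::field_char_0"
  assumes "finite A" and pos: "\<And>s. s \<in> A \<Longrightarrow> 1 \<le> f s"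
  shows "casimir A \<psi> f = of_int (casimir_eigenvalue A f) * \<psi> f
    + 2 * (\<Sum>s\<in>A. \<Sum>i\<in>{1..<f s}. lower A i (f s) \<psi> (f(s := i)))"
proof -
  define g where "g s t = \<psi> (f \<circ> transpose s t)" for s t
  define Lt where "Lt = (\<Sum>s\<in>A. \<Sum>t\<in>A. if f t < f s then g s t else 0)"
  have eqv: "g s t = \<psi> f" if "f t = f s" for s t
    using that by (auto simp: g_def fun_eq_iff transpose_def intro!: arg_cong[of _ _ \<psi>])
  have sym: "g s t = g t s" for s t
    by (simp add: g_def transpose_commute)
  have low: "(\<Sum>s\<in>A. \<Sum>i\<in>{1..<f s}. lower A i (f s) \<psi> (f(s := i))) =
      (\<Sum>s\<in>A. of_int (int (f s) - 1)) * \<psi> f + Lt"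
  proof -
    have "(\<Sum>i\<in>{1..<f s}. lower A i (f s) \<psi> (f(s := i))) =
        of_int (int (f s) - 1) * \<psi> f + (\<Sum>t\<in>A. if f t < f s then g s t else 0)"
      if s: "s \<in> A" for s
    proof -
      have "(\<Sum>i\<in>{1..<f s}. lower A i (f s) \<psi> (f(s := i))) =
          (\<Sum>i\<in>{1..<f s}. \<psi> f + (\<Sum>t | t \<in> A \<and> f t = i. g s t))"
        unfolding g_def using assms s by (intro sum.cong refl lower_upd) auto
      also have "\<dots> = of_nat (f s - 1) * \<psi> f + (\<Sum>t | t \<in> A \<and> f t \<in> {1..<f s}. g s t)"
        using assms by (simp add: sum.distrib sum_by_value)
      also have "{t. t \<in> A \<and> f t \<in> {1..<f s}} = {t \<in> A. f t < f s}"
        using pos by auto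
      also have "(\<Sum>t | t \<in> A \<and> f t < f s. g s t) = (\<Sum>t\<in>A. if f t < f s then g s t else 0)"
        using assms by (intro sum.inter_filter) auto
      also have "(of_nat (f s - 1) :: 'k) = of_int (int (f s) - 1)"
        using pos[OF s] by (simp add: of_nat_diff)
      finally show ?thesis .
    qed
    then have "(\<Sum>s\<in>A. \<Sum>i\<in>{1..<f s}. lower A i (f s) \<psi> (f(s := i))) =
        (\<Sum>s\<in>A. of_int (int (f s) - 1) * \<psi> f + (\<Sum>t\<in>A. if f t < f s then g s t else 0))"
      by (intro sum.cong refl) auto
    then show ?thesis
      by (simp only: sum.distrib Lt_def sum_distrib_right)
  qed
  have "casimir A \<psi> f = (\<Sum>s\<in>A. \<Sum>t\<in>A.
      (if f t = f s then 1 else 0) * \<psi> f + ((if f t < f s then g s t else 0) + (if f s < f t then g t s else 0)))"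
    unfolding casimir_def g_def[symmetric]
    by (intro sum.cong refl) (use eqv sym in auto)
  also have "\<dots> = (\<Sum>s\<in>A. \<Sum>t\<in>A. if f t = f s then 1 else 0) * \<psi> f
      + (Lt + (\<Sum>s\<in>A. \<Sum>t\<in>A. if f s < f t then g t s else 0))"
    by (simp only: sum.distrib Lt_def sum_distrib_right)
  also have "(\<Sum>s\<in>A. \<Sum>t\<in>A. if f s < f t then g t s else 0) = Lt"
    unfolding Lt_def by (rule sum.swap)
  also have "(\<Sum>s\<in>A. \<Sum>t\<in>A. if f t = f s then 1 else 0 :: 'k) =
      of_int (\<Sum>s\<in>A. \<Sum>t\<in>A. if f t = f s then 1 else 0)"
    by (simp add: if_distrib cong: if_cong)
  finally show ?thesis
    unfolding low casimir_eigenvalue_def by (simp add: algebra_simps)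
qed

lemma lower_compose:
  assumes \<sigma>: "\<sigma> permutes A"
  shows "lower A i j (\<lambda>f. \<psi> (f \<circ> \<sigma>)) f = lower A i j \<psi> (f \<circ> \<sigma>)"
  unfolding lower_def
proof (rule sum.reindex_bij_witness[where i = \<sigma> and j = "inv' \<sigma>"])
  fix s assume "s \<in> {s \<in> A. f s = i}"
  then show "\<sigma> (inv' \<sigma> s) = s" "inv' \<sigma> s \<in> {s \<in> A. (f \<circ> \<sigma>) s = i}"
    using \<sigma> by (auto simp: permutes_inverses permutes_in_image[OF permutes_inv[OF \<sigma>]])
  show "\<psi> ((f \<circ> \<sigma>)(inv' \<sigma> s := j)) = \<psi> (f(s := j) \<circ> \<sigma>)"
    using permutes_inverses[OF \<sigma>] by (auto simp: fun_eq_iff intro!: arg_cong[of _ _ \<psi>])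
next
  fix s assume "s \<in> {s \<in> A. (f \<circ> \<sigma>) s = i}"
  then show "inv' \<sigma> (\<sigma> s) = s" "\<sigma> s \<in> {s \<in> A. f s = i}"
    using \<sigma> by (auto simp: permutes_inverses permutes_in_image)
qed

lemma lower_sum:
  "lower A i j (\<lambda>f. \<Sum>x\<in>I. c x * \<psi> x f) f = (\<Sum>x\<in>I. c x * lower A i j (\<psi> x) f)"
  unfolding lower_def sum_distrib_left by (rule sum.swap)

text \<open>Letters and places do not interact: permuting places inside \<open>A\<close> commutes
  with replacing a letter throughout \<open>A\<close>.\<close>

lemma casimir_lower:
  "casimir A (lower A i j \<psi>) f = lower A i j (casimir A \<psi>) f"
proof -
  have "casimir A (lower A i j \<psi>) f =
      (\<Sum>s\<in>A. \<Sum>t\<in>A. lower A i j (\<lambda>f. \<psi> (f \<circ> transpose s t)) f)"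
    unfolding casimir_def
    by (intro sum.cong refl lower_compose[symmetric] permutes_swap_id) auto
  also have "\<dots> = lower A i j (casimir A \<psi>) f"
    using lower_sum[of A i j "\<lambda>_. 1" "\<lambda>s f. \<Sum>t\<in>A. \<psi> (f \<circ> transpose s t)" A f]
      lower_sum[of A i j "\<lambda>_. 1" "\<lambda>t f. \<psi> (f \<circ> transpose _ t)" A f]
    by (simp add: casimir_def[abs_def])
  finally show ?thesis .
qed

text \<open>A highest weight argument by induction on a bound for the letter sums in the support.
  For \<open>i < j\<close> the function \<open>lower A i j \<psi>\<close> is again an eigenvector,
  and its support arises from that of \<psi> by decreasing one letter, which is why \<open>P\<close>
  must be closed under this; so it vanishes by induction. Then \<open>casimir_decomp\<close> leaves
  only the diagonal term, and its scalar is not \<open>e\<close> on the support.\<close>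

lemma casimir_eigenvector_zero:
  fixes \<psi> :: "(nat \<Rightarrow> nat) \<Rightarrow> 'k::field_char_0"
  assumes "finite A"
    and pos: "\<And>f s. P f \<Longrightarrow> s \<in> A \<Longrightarrow> 1 \<le> f s"
    and eig: "\<And>f. P f \<Longrightarrow> casimir_eigenvalue A f \<noteq> e"
    and closed: "\<And>f s i. P f \<Longrightarrow> s \<in> A \<Longrightarrow> 1 \<le> i \<Longrightarrow> i < f s \<Longrightarrow> P (f(s := i))"
    and "\<And>f. casimir A \<psi> f = of_int e * \<psi> f"
    and "\<And>f. \<psi> f \<noteq> 0 \<Longrightarrow> P f"
    and "\<And>f. \<psi> f \<noteq> 0 \<Longrightarrow> sum f A < N"
  shows "\<psi> f = 0"
  using assms(5-7)
proof (induction N arbitrary: \<psi> f)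
  case 0
  then show ?case by auto
next
  case (Suc N)
  have low: "lower A i j \<psi> g = 0" if ij: "1 \<le> i" "i < j" for i j g
  proof (rule Suc.IH[of "lower A i j \<psi>"])
    fix g
    show "casimir A (lower A i j \<psi>) g = of_int e * lower A i j \<psi> g"
      unfolding casimir_lower by (simp only: lower_def Suc.prems(1) sum_distrib_left)
    assume "lower A i j \<psi> g \<noteq> 0"
    then obtain s where s: "s \<in> A" "g s = i" "\<psi> (g(s := j)) \<noteq> 0"
      unfolding lower_def by (auto dest: sum.not_neutral_contains_not_neutral)
    have "P ((g(s := j))(s := i))"
      by (rule closed[OF Suc.prems(2)[OF s(3)] s(1)]) (use s ij in auto)
    then show "P g"
      using s by (metis fun_upd_triv fun_upd_upd)
    have "sum g A < sum (g(s := j)) A"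
      using \<open>finite A\<close> s ij by (intro sum_strict_mono_ex1) auto
    then show "sum g A < N"
      using Suc.prems(3)[OF s(3)] by simp
  qed
  show ?case
  proof (rule ccontr)
    assume nz: "\<psi> f \<noteq> 0"
    then have "P f" by (rule Suc.prems)
    have "casimir A \<psi> f = of_int (casimir_eigenvalue A f) * \<psi> f"
      by (subst casimir_decomp[OF \<open>finite A\<close> pos[OF \<open>P f\<close>]]) (simp_all add: low)
    then have "of_int e * \<psi> f = of_int (casimir_eigenvalue A f) * \<psi> f"
      using Suc.prems(1)[of f] by simp
    with nz have "e = casimir_eigenvalue A f" by simp
    with eig[OF \<open>P f\<close>] show False by simp
  qed
qed

text \<open>
  The linear part of the Casimir eigenvalue at \<open>c\<close>; unlike the eigenvalue itself it increases whenever
  a letter decreases, as long as the letter counts of \<open>c\<close> are decreasing.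
\<close>

definition weight :: "nat set \<Rightarrow> (nat \<Rightarrow> nat) \<Rightarrow> (nat \<Rightarrow> nat) \<Rightarrow> int" where
  "weight A c f = (\<Sum>s\<in>A. int (card {t \<in> A. c t = f s}) - int (f s))"

text \<open>Convexity of the squares: with letter counts \<open>n_l\<close> of \<open>f\<close> and
  \<open>m_l\<close> of \<open>c\<close>, the right side exceeds the left by exactly the sum of
  \<open>(n_l - m_l)^2\<close>.\<close>

lemma weight_eigenvalue:
  assumes "finite A"
  shows "2 * (weight A c f - weight A c c) \<le> casimir_eigenvalue A f - casimir_eigenvalue A c"
proof -
  define I where "I = f ` A \<union> c ` A"
  define n where "n l = int (card {t \<in> A. f t = l})" for l
  define m where "m l = int (card {t \<in> A. c t = l})" for l
  have group: "(\<Sum>s\<in>A. w (h s)) = (\<Sum>l\<in>I. int (card {t \<in> A. h t = l}) * w l)"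
    if "h ` A \<subseteq> I" for h and w :: "nat \<Rightarrow> int"
  proof -
    have "(\<Sum>s\<in>A. w (h s)) = (\<Sum>l\<in>I. \<Sum>s | s \<in> A \<and> h s = l. w (h s))"
      using assms that by (subst sum.group) (auto simp: I_def)
    also have "\<dots> = (\<Sum>l\<in>I. \<Sum>s | s \<in> A \<and> h s = l. w l)"
      by (intro sum.cong refl) auto
    finally show ?thesis by simp
  qed
  have I: "f ` A \<subseteq> I" "c ` A \<subseteq> I" by (auto simp: I_def)
  have cnt: "(\<Sum>t\<in>A. if h t = l then 1 else 0) = int (card {t \<in> A. h t = l})" for h l
    using assms by (subst sum.inter_filter[symmetric]) auto
  have ff: "(\<Sum>s\<in>A. \<Sum>t\<in>A. if f t = f s then 1 else 0) = (\<Sum>l\<in>I. n l * n l)"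
    unfolding cnt using group[OF I(1), of n] by (simp add: n_def)
  have cc: "(\<Sum>s\<in>A. \<Sum>t\<in>A. if c t = c s then 1 else 0) = (\<Sum>l\<in>I. m l * m l)"
    unfolding cnt using group[OF I(2), of m] by (simp add: m_def)
  have wf: "weight A c f = (\<Sum>l\<in>I. n l * m l) - (\<Sum>s\<in>A. int (f s))"
    unfolding weight_def using group[OF I(1), of m] by (simp add: m_def n_def sum_subtractf)
  have wc: "weight A c c = (\<Sum>l\<in>I. m l * m l) - (\<Sum>s\<in>A. int (c s))"
    unfolding weight_def using group[OF I(2), of m] by (simp add: m_def sum_subtractf)
  have "0 \<le> (\<Sum>l\<in>I. (n l - m l) * (n l - m l))"
    by (intro sum_nonneg) auto
  also have "\<dots> = (\<Sum>l\<in>I. n l * n l) + (\<Sum>l\<in>I. m l * m l) - 2 * (\<Sum>l\<in>I. n l * m l)"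
    by (simp add: algebra_simps sum.distrib sum_subtractf sum_distrib_left)
  finally show ?thesis
    unfolding casimir_eigenvalue_def ff cc wf wc by (simp add: sum_subtractf algebra_simps)
qed

lemma weight_upd:
  assumes "finite A" "s \<in> A" "i < f s"
    and "card {t \<in> A. c t = f s} \<le> card {t \<in> A. c t = i}"
  shows "weight A c f < weight A c (f(s := i))"
  using assms by (auto simp: weight_def intro!: sum_strict_mono_ex1 bexI[of _ s])

lemma weight_cong: "(\<And>s. s \<in> A \<Longrightarrow> f s = g s) \<Longrightarrow> weight A c f = weight A c g"
  by (simp add: weight_def)

section \<open>The Casimir operator modulo the Garnir relations\<close>

lemma lower_union:
  "finite A \<Longrightarrow> finite B \<Longrightarrow> A \<inter> B = {} \<Longrightarrow>
    lower (A \<union> B) i j \<psi> f = lower A i j \<psi> f + lower B i j \<psi> f"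
proof -
  assume *: "finite A" "finite B" "A \<inter> B = {}"
  have "{s. s \<in> A \<union> B \<and> f s = i} = {s. s \<in> A \<and> f s = i} \<union> {s. s \<in> B \<and> f s = i}"
    by auto
  then show ?thesis
    unfolding lower_def using * by (simp add: sum.union_disjoint disjoint_iff)
qed

text \<open>Lowering on \<open>B\<close> vanishes, so lowering on \<open>A\<close> is minus lowering
  on \<open>B - A\<close>. At \<open>f(s := i)\<close> the latter does not see the place
  \<open>s\<close>; hence no further copy of \<open>\<phi> f\<close> appears, and only exchanges of
  \<open>s\<close> with smaller letters outside \<open>A\<close> remain. Their uniform minus sign is
  the source of all nonnegativity.\<close>

lemma casimir_coinvariant:
  fixes \<phi> :: "(nat \<Rightarrow> nat) \<Rightarrow> 'k::field_char_0"
  assumes "finite B" "A \<subseteq> B"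
    and pos: "\<And>s. s \<in> B \<Longrightarrow> 1 \<le> f s"
    and low: "\<And>i j g. 1 \<le> i \<Longrightarrow> i < j \<Longrightarrow> lower B i j \<phi> g = 0"
  shows "casimir A \<phi> f = of_int (casimir_eigenvalue A f) * \<phi> f
    - 2 * (\<Sum>s\<in>A. \<Sum>t | t \<in> B - A \<and> f t < f s. \<phi> (f \<circ> transpose s t))"
proof -
  have fin: "finite A" "finite (B - A)"
    using assms finite_subset by auto
  have "(\<Sum>i\<in>{1..<f s}. lower A i (f s) \<phi> (f(s := i))) =
      - (\<Sum>t | t \<in> B - A \<and> f t < f s. \<phi> (f \<circ> transpose s t))" if s: "s \<in> A" for s
  proof -
    have "(\<Sum>i\<in>{1..<f s}. lower A i (f s) \<phi> (f(s := i))) =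
        (\<Sum>i\<in>{1..<f s}. - (\<Sum>t | t \<in> B - A \<and> f t = i. \<phi> (f \<circ> transpose s t)))"
    proof (intro sum.cong refl)
      fix i assume i: "i \<in> {1..<f s}"
      have "lower A i (f s) \<phi> (f(s := i)) + lower (B - A) i (f s) \<phi> (f(s := i)) =
          lower (A \<union> (B - A)) i (f s) \<phi> (f(s := i))"
        using fin by (subst lower_union) auto
      also have "\<dots> = 0"
        using low[of i "f s"] i \<open>A \<subseteq> B\<close> by (simp add: Un_absorb1)
      also have "lower (B - A) i (f s) \<phi> (f(s := i)) =
          (\<Sum>t | t \<in> B - A \<and> f t = i. \<phi> (f \<circ> transpose s t))"
        unfolding lower_def
      proof (rule sum.cong)
        show "{t \<in> B - A. (f(s := i)) t = i} = {t. t \<in> B - A \<and> f t = i}"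
          using s by auto
        show "\<phi> ((f(s := i))(t := f s)) = \<phi> (f \<circ> transpose s t)"
          if "t \<in> {t. t \<in> B - A \<and> f t = i}" for t
          using that s by (intro arg_cong[of _ _ \<phi>] fun_upd_transpose) auto
      qed
      finally show "lower A i (f s) \<phi> (f(s := i)) =
          - (\<Sum>t | t \<in> B - A \<and> f t = i. \<phi> (f \<circ> transpose s t))"
        by (rule eq_neg_iff_add_eq_0[THEN iffD2])
    qed
    also have "\<dots> = - (\<Sum>t | t \<in> B - A \<and> f t \<in> {1..<f s}. \<phi> (f \<circ> transpose s t))"
      using fin by (simp only: sum_negf) (subst sum_by_value, auto)
    also have "{t. t \<in> B - A \<and> f t \<in> {1..<f s}} = {t. t \<in> B - A \<and> f t < f s}"
      using pos by auto
    finally show ?thesis .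
  qed
  moreover have "casimir A \<phi> f = of_int (casimir_eigenvalue A f) * \<phi> f
      + 2 * (\<Sum>s\<in>A. \<Sum>i\<in>{1..<f s}. lower A i (f s) \<phi> (f(s := i)))"
    using assms by (intro casimir_decomp fin) auto
  ultimately show ?thesis
    by (simp add: sum_negf)
qed

text \<open>
  The coefficient with which \<open>g\<close> is reached from \<open>f\<close> by fewer than \<open>r\<close> swaps: inverting the diagonal
  part of the (halved) Casimir operator contributes one factor per visited word.
\<close>

primrec path_coeff ::
  "nat set \<Rightarrow> nat set \<Rightarrow> (nat \<Rightarrow> nat) \<Rightarrow> nat \<Rightarrow> (nat \<Rightarrow> nat) \<Rightarrow> (nat \<Rightarrow> nat) \<Rightarrow> rat" where
  "path_coeff A B c 0 f g = 0"
| "path_coeff A B c (Suc r) f g =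
    2 / of_int (casimir_eigenvalue A f - casimir_eigenvalue A c) *
    ((if g = f then 1 else 0) +
     (\<Sum>s\<in>A. \<Sum>t | t \<in> B - A \<and> f t < f s. path_coeff A B c r (f \<circ> transpose s t) g))"

lemma sum_transpose_less:
  fixes f :: "nat \<Rightarrow> nat"
  assumes "finite A" "s \<in> A" "t \<notin> A" "f t < f s"
  shows "sum (f \<circ> transpose s t) A < sum f A"
  using assms by (intro sum_strict_mono_ex1) (auto simp: transpose_def intro!: bexI[of _ s])

lemma weight_transpose:
  assumes "finite A" "s \<in> A" "t \<notin> A" "f t < f s"
    and "card {u \<in> A. c u = f s} \<le> card {u \<in> A. c u = f t}"
  shows "weight A c f < weight A c (f \<circ> transpose s t)"
proof -
  have "weight A c (f \<circ> transpose s t) = weight A c (f(s := f t))"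
    using assms by (intro weight_cong) (auto simp: transpose_def)
  then show ?thesis
    using weight_upd[of A s "f t" f c] assms by simp
qed

lemma nested_sum_nonzeroE:
  assumes "(\<Sum>s\<in>A. \<Sum>t | Q s t. F s t) \<noteq> (0 :: 'a::comm_monoid_add)"
  obtains s t where "s \<in> A" "Q s t" "F s t \<noteq> 0"
  using assms by (metis (mono_tags, lifting) mem_Collect_eq sum.neutral)

text \<open>Let \<open>e\<close> be the eigenvalue function and
  \<open>\<psi> = (casimir A \<phi> - e c * \<phi>) / 2\<close>. Where the gap
  \<open>e f - e c\<close> is positive, the hypothesis on \<phi> reads
  \<open>\<phi> f = 2 / (e f - e c)\<close> times \<open>\<psi> f\<close> plus the values of \<phi>
  at the swaps of \<open>f\<close>; unfolding it expresses \<open>\<phi> f\<close> by values of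
  \<psi> with the coefficients \<open>path_coeff\<close>. At \<open>c\<close> the gap is 0, so
  \<open>\<psi> c\<close> is minus the sum of \<phi> over the swaps of \<open>c\<close>. Inserting
  the expansions of these values gives a vanishing combination of values of \<psi>, which is the
  eigenvector equation.\<close>

lemma nonneg_casimir_eigenvector:
  fixes c :: "nat \<Rightarrow> nat"
  assumes "finite B" "A \<subseteq> B" "finite W" "c \<in> W"
    and W: "\<And>f s t. f \<in> W \<Longrightarrow> s \<in> B \<Longrightarrow> t \<in> B \<Longrightarrow> f \<circ> transpose s t \<in> W"
    and pos: "\<And>f p. f \<in> W \<Longrightarrow> p \<in> B \<Longrightarrow> 1 \<le> f p"
    and dom: "\<And>i j. 1 \<le> i \<Longrightarrow> i < j \<Longrightarrow> card {t \<in> A. c t = j} \<le> card {t \<in> A. c t = i}"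
  obtains v :: "(nat \<Rightarrow> nat) \<Rightarrow> rat" where
    "\<And>g. 0 \<le> v g"
    "\<And>g. v g \<noteq> 0 \<Longrightarrow> g \<in> W \<and> weight A c c < weight A c g \<and> (\<forall>s\<in>A. g s \<le> c s)"
    "\<And>\<phi> :: (nat \<Rightarrow> nat) \<Rightarrow> 'k::field_char_0.
       (\<And>f. f \<in> W \<Longrightarrow> casimir A \<phi> f = of_int (casimir_eigenvalue A f) * \<phi> f
          - 2 * (\<Sum>s\<in>A. \<Sum>t | t \<in> B - A \<and> f t < f s. \<phi> (f \<circ> transpose s t))) \<Longrightarrow>
       casimir A \<phi> c + (\<Sum>g\<in>W. of_rat (v g) * casimir A \<phi> g) =
       of_int (casimir_eigenvalue A c) * (\<phi> c + (\<Sum>g\<in>W. of_rat (v g) * \<phi> g))"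
proof -
  define \<kappa> where "\<kappa> = path_coeff A B c"
  \<comment> \<open>Every swap lowers the letter sum on \<open>A\<close>, so a word reached from
    \<open>c\<close> by one swap has a sum below \<open>N\<close>, and \<open>N\<close> rounds of
    the recursion exhaust all paths from it.\<close>
  define N where "N = sum c A"
  define e where "e = casimir_eigenvalue A"
  have finA: "finite A" using assms finite_subset by auto
  \<comment> \<open>The growth of the weight keeps the gaps positive, the drop of the letter sum
    ends the recursion, and the letterwise bound later becomes the condition that entries of
    \<open>S\<close> move only to the left.\<close>
  have step: "f \<circ> transpose s t \<in> W \<and> weight A c f < weight A c (f \<circ> transpose s t) \<and>
      sum (f \<circ> transpose s t) A < sum f A \<and> (\<forall>p\<in>A. (f \<circ> transpose s t) p \<le> f p)"
    if "f \<in> W" "s \<in> A" "t \<in> B - A" "f t < f s" for f s t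
  proof -
    have "1 \<le> f t" using that pos by auto
    then have "weight A c f < weight A c (f \<circ> transpose s t)"
      using that finA dom by (intro weight_transpose) auto
    moreover have "sum (f \<circ> transpose s t) A < sum f A"
      using that finA by (intro sum_transpose_less) auto
    moreover have "\<forall>p\<in>A. (f \<circ> transpose s t) p \<le> f p"
      using that by (auto simp: transpose_def)
    ultimately show ?thesis
      using that W \<open>A \<subseteq> B\<close> by auto
  qed
  have gap: "e c < e f" if "weight A c c < weight A c f" for f
    using weight_eigenvalue[OF finA, of c f] that by (simp add: e_def)
  have nonneg: "0 \<le> \<kappa> r f g" if "f \<in> W" "weight A c c < weight A c f" for r f g
    using that
  proof (induction r arbitrary: f)
    case (Suc r)
    have "0 \<le> \<kappa> r (f \<circ> transpose s t) g" if "s \<in> A" "t \<in> B - A" "f t < f s" for s t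
      by (rule Suc.IH) (use step[of f s t] that Suc.prems in \<open>blast intro: less_trans\<close>)+
    then show ?case
      using gap[OF Suc.prems(2)] unfolding \<kappa>_def e_def
      by (auto intro!: mult_nonneg_nonneg divide_nonneg_nonneg add_nonneg_nonneg sum_nonneg)
  qed (simp add: \<kappa>_def)
  have support: "g \<in> W \<and> weight A c c < weight A c g \<and> (\<forall>s\<in>A. g s \<le> f s)"
    if "f \<in> W" "weight A c c < weight A c f" "\<kappa> r f g \<noteq> 0" for r f g
    using that
  proof (induction r arbitrary: f)
    case (Suc r)
    show ?case
    proof (cases "g = f")
      case False
      then have "(\<Sum>s\<in>A. \<Sum>t | t \<in> B - A \<and> f t < f s. \<kappa> r (f \<circ> transpose s t) g) \<noteq> 0"
        using Suc.prems(3) by (auto simp: \<kappa>_def)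
      then obtain s t where st: "s \<in> A" "t \<in> B - A" "f t < f s" "\<kappa> r (f \<circ> transpose s t) g \<noteq> 0"
        by (elim nested_sum_nonzeroE) auto
      with step[of f s t] Suc.prems Suc.IH[of "f \<circ> transpose s t"] show ?thesis
        by (meson order.strict_trans order.trans)
    qed (use Suc.prems in auto)
  qed (simp add: \<kappa>_def)
  define v where "v g = (\<Sum>s\<in>A. \<Sum>t | t \<in> B - A \<and> c t < c s. \<kappa> N (c \<circ> transpose s t) g)" for g
  show thesis
  proof
    show "0 \<le> v g" for g
      unfolding v_def using step \<open>c \<in> W\<close> by (auto intro!: sum_nonneg nonneg)
    show "g \<in> W \<and> weight A c c < weight A c g \<and> (\<forall>s\<in>A. g s \<le> c s)" if "v g \<noteq> 0" for g
    proof -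
      from that obtain s t where st: "s \<in> A" "t \<in> B - A" "c t < c s" "\<kappa> N (c \<circ> transpose s t) g \<noteq> 0"
        unfolding v_def by (elim nested_sum_nonzeroE) auto
      with step[of c s t] \<open>c \<in> W\<close> support[of "c \<circ> transpose s t" N g] show ?thesis
        by (meson order.strict_trans order.trans)
    qed
    fix \<phi> :: "(nat \<Rightarrow> nat) \<Rightarrow> 'k"
    assume \<phi>: "casimir A \<phi> f = of_int (casimir_eigenvalue A f) * \<phi> f
          - 2 * (\<Sum>s\<in>A. \<Sum>t | t \<in> B - A \<and> f t < f s. \<phi> (f \<circ> transpose s t))"
      if "f \<in> W" for f
    define \<psi> where "\<psi> f = (casimir A \<phi> f - of_int (e c) * \<phi> f) / 2" for f
    have \<psi>: "\<psi> f = of_int (e f - e c) / 2 * \<phi> f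
        - (\<Sum>s\<in>A. \<Sum>t | t \<in> B - A \<and> f t < f s. \<phi> (f \<circ> transpose s t))" if "f \<in> W" for f
      unfolding \<psi>_def \<phi>[OF that] e_def by (simp add: field_simps)
    have path: "(\<Sum>g\<in>W. of_rat (\<kappa> r f g) * \<psi> g) = \<phi> f"
      if "f \<in> W" "weight A c c < weight A c f" "sum f A < r" for r f
      using that
    proof (induction r arbitrary: f)
      case (Suc r)
      define a :: 'k where "a = 2 / of_int (e f - e c)"
      have "(\<Sum>g\<in>W. of_rat (\<kappa> (Suc r) f g) * \<psi> g) =
          (\<Sum>g\<in>W. a * ((if g = f then \<psi> g else 0) +
            (\<Sum>s\<in>A. \<Sum>t | t \<in> B - A \<and> f t < f s. of_rat (\<kappa> r (f \<circ> transpose s t) g) * \<psi> g)))"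
        by (intro sum.cong refl)
          (simp add: \<kappa>_def a_def e_def of_rat_mult of_rat_add of_rat_sum of_rat_divide
            sum_distrib_right sum_distrib_left algebra_simps of_rat_diff)
      also have "\<dots> = a * (\<psi> f +
            (\<Sum>g\<in>W. \<Sum>s\<in>A. \<Sum>t | t \<in> B - A \<and> f t < f s. of_rat (\<kappa> r (f \<circ> transpose s t) g) * \<psi> g))"
        using Suc.prems(1) \<open>finite W\<close> by (simp add: sum_distrib_left[symmetric] sum.distrib)
      also have "(\<Sum>g\<in>W. \<Sum>s\<in>A. \<Sum>t | t \<in> B - A \<and> f t < f s. of_rat (\<kappa> r (f \<circ> transpose s t) g) * \<psi> g) =
          (\<Sum>s\<in>A. \<Sum>g\<in>W. \<Sum>t | t \<in> B - A \<and> f t < f s. of_rat (\<kappa> r (f \<circ> transpose s t) g) * \<psi> g)"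
        by (rule sum.swap)
      also have "\<dots> = (\<Sum>s\<in>A. \<Sum>t | t \<in> B - A \<and> f t < f s. \<Sum>g\<in>W. of_rat (\<kappa> r (f \<circ> transpose s t) g) * \<psi> g)"
        by (intro sum.cong refl sum.swap)
      also have "\<dots> = (\<Sum>s\<in>A. \<Sum>t | t \<in> B - A \<and> f t < f s. \<phi> (f \<circ> transpose s t))"
      proof (intro sum.cong refl)
        fix s t assume "s \<in> A" "t \<in> {t. t \<in> B - A \<and> f t < f s}"
        then show "(\<Sum>g\<in>W. of_rat (\<kappa> r (f \<circ> transpose s t) g) * \<psi> g) = \<phi> (f \<circ> transpose s t)"
          using step[of f s t] Suc.prems by (intro Suc.IH[of "f \<circ> transpose s t"]) (simp_all del: o_apply)
      qed
      also have "a * (\<psi> f + \<dots>) = \<phi> f"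
        using gap[OF Suc.prems(2)] unfolding \<psi>[OF Suc.prems(1)] a_def by simp
      finally show ?case .
    qed simp
    have "(\<Sum>g\<in>W. of_rat (v g) * \<psi> g) =
        (\<Sum>g\<in>W. \<Sum>s\<in>A. \<Sum>t | t \<in> B - A \<and> c t < c s. of_rat (\<kappa> N (c \<circ> transpose s t) g) * \<psi> g)"
      by (simp add: v_def of_rat_sum sum_distrib_right)
    also have "\<dots> =
        (\<Sum>s\<in>A. \<Sum>g\<in>W. \<Sum>t | t \<in> B - A \<and> c t < c s. of_rat (\<kappa> N (c \<circ> transpose s t) g) * \<psi> g)"
      by (rule sum.swap)
    also have "\<dots> = (\<Sum>s\<in>A. \<Sum>t | t \<in> B - A \<and> c t < c s. \<Sum>g\<in>W. of_rat (\<kappa> N (c \<circ> transpose s t) g) * \<psi> g)"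
      by (intro sum.cong refl sum.swap)
    also have "\<dots> = (\<Sum>s\<in>A. \<Sum>t | t \<in> B - A \<and> c t < c s. \<phi> (c \<circ> transpose s t))"
    proof (intro sum.cong refl)
      fix s t assume "s \<in> A" "t \<in> {t. t \<in> B - A \<and> c t < c s}"
      then show "(\<Sum>g\<in>W. of_rat (\<kappa> N (c \<circ> transpose s t) g) * \<psi> g) = \<phi> (c \<circ> transpose s t)"
        using step[of c s t] \<open>c \<in> W\<close> by (intro path) (auto simp: N_def)
    qed
    finally have zero: "\<psi> c + (\<Sum>g\<in>W. of_rat (v g) * \<psi> g) = 0"
      using \<psi>[OF \<open>c \<in> W\<close>] by simp
    have two: "2 * \<psi> f = casimir A \<phi> f - of_int (e c) * \<phi> f" for f
      by (simp add: \<psi>_def)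
    have "2 * (\<psi> c + (\<Sum>g\<in>W. of_rat (v g) * \<psi> g)) = 0"
      using zero by simp
    then have "2 * \<psi> c + (\<Sum>g\<in>W. of_rat (v g) * (2 * \<psi> g)) = 0"
      by (simp add: sum_distrib_left mult.left_commute ring_distribs)
    then show "casimir A \<phi> c + (\<Sum>g\<in>W. of_rat (v g) * casimir A \<phi> g) =
       of_int (casimir_eigenvalue A c) * (\<phi> c + (\<Sum>g\<in>W. of_rat (v g) * \<phi> g))"
      unfolding two by (simp add: e_def algebra_simps sum_subtractf sum_distrib_left)
  qed
qed

section \<open>Permutations preserving a labelling\<close>

text \<open>The row group for \<open>r = row\<close> and the column group for
  \<open>r = col\<close>. Comparing labels at all places rather than only on \<open>A\<close> is
  harmless, as places outside \<open>A\<close> are fixed, and it gives the equation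
  \<open>r \<circ> \<sigma> = r\<close> between functions.\<close>

definition stab :: "(nat \<Rightarrow> nat) \<Rightarrow> nat set \<Rightarrow> (nat \<Rightarrow> nat) set" where
  "stab r A = {\<sigma>. \<sigma> permutes A \<and> (\<forall>p. r (\<sigma> p) = r p)}"

lemma stab_permutes: "\<sigma> \<in> stab r A \<Longrightarrow> \<sigma> permutes A"
  by (simp add: stab_def)

lemma finite_stab: "finite A \<Longrightarrow> finite (stab r A)"
  by (rule finite_subset[OF _ finite_permutations[of A]]) (auto simp: stab_def)

lemma id_in_stab: "id \<in> stab r A"
  by (simp add: stab_def permutes_id)

lemma stab_compose: "\<sigma> \<in> stab r A \<Longrightarrow> \<tau> \<in> stab r A \<Longrightarrow> \<sigma> \<circ> \<tau> \<in> stab r A"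
  unfolding stab_def using permutes_compose by auto

lemma stab_inverse:
  assumes "\<sigma> \<in> stab r A"
  shows "inv' \<sigma> \<in> stab r A"
proof -
  note p = stab_permutes[OF assms]
  have "r (inv' \<sigma> x) = r x" for x
    using assms permutes_inverses(1)[OF p, of x] unfolding stab_def
    by (metis (mono_tags, lifting) mem_Collect_eq)
  then show ?thesis
    using permutes_inv[OF p] unfolding stab_def by blast
qed

lemma stab_mono: "A \<subseteq> B \<Longrightarrow> stab r A \<subseteq> stab r B"
  unfolding stab_def using permutes_subset by blast

lemma transpose_in_stab: "s \<in> A \<Longrightarrow> t \<in> A \<Longrightarrow> r s = r t \<Longrightarrow> transpose s t \<in> stab r A"
  by (auto simp: stab_def permutes_swap_id transpose_def)

lemma stab_compose_word: "\<sigma> \<in> stab r A \<Longrightarrow> r \<circ> \<sigma> = r"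
  by (auto simp: stab_def)

lemma stab_empty: "stab r {} = {id}"
  by (auto simp: stab_def)

lemma sum_stab_compose_left:
  assumes "\<tau> \<in> stab r A"
  shows "(\<Sum>\<sigma>\<in>stab r A. g (\<tau> \<circ> \<sigma>)) = (\<Sum>\<sigma>\<in>stab r A. g \<sigma>)"
proof (rule sum.reindex_bij_witness[where i = "\<lambda>\<sigma>. inv' \<tau> \<circ> \<sigma>" and j = "\<lambda>\<sigma>. \<tau> \<circ> \<sigma>"])
  note p = stab_permutes[OF assms]
  show "inv' \<tau> \<circ> (\<tau> \<circ> \<sigma>) = \<sigma>" "\<tau> \<circ> (inv' \<tau> \<circ> \<sigma>) = \<sigma>" for \<sigma>
    using permutes_inverses[OF p] by (auto simp: fun_eq_iff)
qed (use assms in \<open>simp_all add: stab_compose stab_inverse\<close>)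

lemma sum_stab_inverse:
  shows "(\<Sum>\<sigma>\<in>stab r A. g (inv' \<sigma>)) = (\<Sum>\<sigma>\<in>stab r A. g \<sigma>)"
  by (rule sum.reindex_bij_witness[where i = inv' and j = inv'])
    (simp_all add: stab_inverse permutes_inv_inv[OF stab_permutes])

lemma permutes_disjoint_commute:
  assumes "\<sigma> permutes A" "\<tau> permutes B" "A \<inter> B = {}"
  shows "\<sigma> \<circ> \<tau> = \<tau> \<circ> \<sigma>"
proof
  fix p
  consider "p \<in> A" | "p \<in> B" | "p \<notin> A" "p \<notin> B" by auto
  then show "(\<sigma> \<circ> \<tau>) p = (\<tau> \<circ> \<sigma>) p"
  proof cases
    case 1
    then have "\<sigma> p \<notin> B" "p \<notin> B"
      using permutes_in_image[OF assms(1)] assms(3) by auto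
    then show ?thesis using permutes_not_in[OF assms(2)] by simp
  next
    case 2
    then have "\<tau> p \<notin> A" "p \<notin> A"
      using permutes_in_image[OF assms(2)] assms(3) by auto
    then show ?thesis using permutes_not_in[OF assms(1)] by simp
  next
    case 3
    then show ?thesis using permutes_not_in[OF assms(1)] permutes_not_in[OF assms(2)] by simp
  qed
qed

text \<open>Within \<open>B \<union> A\<close> the set \<open>B\<close> is a full label class, so a
  permutation preserving labels maps \<open>B\<close> and \<open>A\<close> to themselves and is the
  product of its two restrictions.\<close>

lemma bij_betw_stab_union:
  assumes "finite A" "finite B" and B: "\<And>p. p \<in> B \<Longrightarrow> r p = i" and A: "\<And>p. p \<in> A \<Longrightarrow> r p \<noteq> i"
  shows "bij_betw (\<lambda>(\<sigma>, \<tau>). \<sigma> \<circ> \<tau>) ({\<sigma>. \<sigma> permutes B} \<times> stab r A) (stab r (B \<union> A))"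
  unfolding bij_betw_def
proof
  have disj: "A \<inter> B = {}" using A B by auto
  show "inj_on (\<lambda>(\<sigma>, \<tau>). \<sigma> \<circ> \<tau>) ({\<sigma>. \<sigma> permutes B} \<times> stab r A)"
  proof (rule inj_onI, clarify)
    fix \<sigma> \<tau> \<sigma>' \<tau>'
    assume p: "\<sigma> permutes B" "\<tau> \<in> stab r A" "\<sigma>' permutes B" "\<tau>' \<in> stab r A"
      and eq: "\<sigma> \<circ> \<tau> = \<sigma>' \<circ> \<tau>'"
    note q = stab_permutes[OF p(2)] stab_permutes[OF p(4)]
    have "\<tau> x = \<tau>' x" for x
    proof (cases "x \<in> A")
      case True
      then have "\<tau> x \<in> A" "\<tau>' x \<in> A" using q by (auto simp: permutes_in_image)
      then have "\<tau> x \<notin> B" "\<tau>' x \<notin> B" using disj by auto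
      then show ?thesis using fun_cong[OF eq, of x] p by (simp add: permutes_not_in)
    qed (use q in \<open>simp add: permutes_not_in\<close>)
    then have "\<tau> = \<tau>'" by auto
    moreover have "\<sigma> = \<sigma>'"
    proof
      fix x
      show "\<sigma> x = \<sigma>' x"
        using fun_cong[OF eq, of "inv' \<tau> x"] \<open>\<tau> = \<tau>'\<close> by (simp add: permutes_inverses[OF q(2)])
    qed
    ultimately show "\<sigma> = \<sigma>' \<and> \<tau> = \<tau>'" by simp
  qed
  show "(\<lambda>(\<sigma>, \<tau>). \<sigma> \<circ> \<tau>) ` ({\<sigma>. \<sigma> permutes B} \<times> stab r A) = stab r (B \<union> A)"
  proof (intro equalityI subsetI)
    fix \<pi> assume "\<pi> \<in> (\<lambda>(\<sigma>, \<tau>). \<sigma> \<circ> \<tau>) ` ({\<sigma>. \<sigma> permutes B} \<times> stab r A)"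
    then obtain \<sigma> \<tau> where \<pi>: "\<pi> = \<sigma> \<circ> \<tau>" "\<sigma> permutes B" "\<tau> \<in> stab r A" by auto
    have "r (\<sigma> x) = r x" for x
      using B[of x] B[of "\<sigma> x"] permutes_in_image[OF \<pi>(2), of x] permutes_not_in[OF \<pi>(2), of x]
      by (cases "x \<in> B") auto
    then have "\<sigma> \<in> stab r (B \<union> A)"
      unfolding stab_def using permutes_subset[OF \<pi>(2), of "B \<union> A"] by blast
    moreover have "\<tau> \<in> stab r (B \<union> A)" using \<pi>(3) stab_mono[of A "B \<union> A"] by auto
    ultimately show "\<pi> \<in> stab r (B \<union> A)" unfolding \<pi> by (rule stab_compose)
  next
    fix \<pi> assume \<pi>: "\<pi> \<in> stab r (B \<union> A)"
    note p = stab_permutes[OF \<pi>]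
    have r: "r (\<pi> x) = r x" for x using \<pi> by (simp add: stab_def)
    have im: "\<pi> x \<in> B \<union> A \<longleftrightarrow> x \<in> B \<union> A" for x using p by (rule permutes_in_image)
    have imB: "\<pi> ` B \<subseteq> B"
    proof
      fix y assume "y \<in> \<pi> ` B"
      then obtain x where "x \<in> B" "y = \<pi> x" by auto
      then show "y \<in> B" using r[of x] im[of x] A[of y] B[of x] by auto
    qed
    have imA: "\<pi> ` A \<subseteq> A"
    proof
      fix y assume "y \<in> \<pi> ` A"
      then obtain x where "x \<in> A" "y = \<pi> x" by auto
      then show "y \<in> A" using r[of x] im[of x] A[of x] B[of y] by auto
    qed
    have inj: "inj_on \<pi> Y" for Y using permutes_inj[OF p] inj_on_subset by blast
    have perm: "(\<lambda>x. if x \<in> Y then \<pi> x else x) permutes Y" if "\<pi> ` Y \<subseteq> Y" "finite Y" for Y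
    proof (rule bij_imp_permutes)
      have "bij_betw \<pi> Y Y" using that inj by (simp add: bij_betw_def endo_inj_surj)
      then show "bij_betw (\<lambda>x. if x \<in> Y then \<pi> x else x) Y Y"
        using bij_betw_cong[of Y \<pi> "\<lambda>x. if x \<in> Y then \<pi> x else x" Y] by simp
    qed auto
    define \<sigma> where "\<sigma> x = (if x \<in> B then \<pi> x else x)" for x
    define \<tau> where "\<tau> x = (if x \<in> A then \<pi> x else x)" for x
    have "\<sigma> permutes B" "\<tau> permutes A"
      using perm imA imB assms by (auto simp: \<sigma>_def[abs_def] \<tau>_def[abs_def])
    moreover have "\<tau> \<in> stab r A"
      using \<open>\<tau> permutes A\<close> r by (auto simp: stab_def \<tau>_def)
    moreover have "\<pi> = \<sigma> \<circ> \<tau>"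
      using imA disj p by (auto simp: fun_eq_iff \<sigma>_def \<tau>_def permutes_not_in)
    ultimately show "\<pi> \<in> (\<lambda>(\<sigma>, \<tau>). \<sigma> \<circ> \<tau>) ` ({\<sigma>. \<sigma> permutes B} \<times> stab r A)"
      by force
  qed
qed

lemma sum_stab_union:
  assumes "finite A" "finite B" "\<And>p. p \<in> B \<Longrightarrow> r p = i" "\<And>p. p \<in> A \<Longrightarrow> r p \<noteq> i"
  shows "(\<Sum>\<pi>\<in>stab r (B \<union> A). g \<pi>) = (\<Sum>\<tau>\<in>stab r A. \<Sum>\<sigma> | \<sigma> permutes B. g (\<tau> \<circ> \<sigma>))"
proof -
  have "(\<Sum>\<pi>\<in>stab r (B \<union> A). g \<pi>) = (\<Sum>(\<sigma>, \<tau>)\<in>{\<sigma>. \<sigma> permutes B} \<times> stab r A. g (\<sigma> \<circ> \<tau>))"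
    using sum.reindex_bij_betw[OF bij_betw_stab_union[OF assms], where g = g]
    by (simp add: case_prod_unfold)
  also have "\<dots> = (\<Sum>\<sigma> | \<sigma> permutes B. \<Sum>\<tau>\<in>stab r A. g (\<sigma> \<circ> \<tau>))"
    by (rule sum.cartesian_product[symmetric])
  also have "\<dots> = (\<Sum>\<tau>\<in>stab r A. \<Sum>\<sigma> | \<sigma> permutes B. g (\<sigma> \<circ> \<tau>))"
    by (rule sum.swap)
  also have "\<dots> = (\<Sum>\<tau>\<in>stab r A. \<Sum>\<sigma> | \<sigma> permutes B. g (\<tau> \<circ> \<sigma>))"
  proof (intro sum.cong refl arg_cong[of _ _ g] permutes_disjoint_commute)
    show "B \<inter> A = {}" using assms(3,4) by auto
  qed (auto dest: stab_permutes)
  finally show ?thesis .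
qed

lemma sign_compose_permutes:
  assumes "finite A" "finite B" "\<sigma> permutes A" "\<tau> permutes B"
  shows "sign (\<sigma> \<circ> \<tau>) = sign \<sigma> * sign \<tau>"
  using assms by (intro sign_compose) (auto simp: permutation_permutes)

lemma of_int_sign_square: "of_int (sign p) * (of_int (sign p) * x) = (x :: 'k::field_char_0)"
  by (simp add: sign_def)

lemma finite_young_diagram: "finite (young_diagram mu)"
proof (rule finite_subset)
  have "i \<le> length mu" if "1 \<le> j" "j \<le> part mu i" for i j
    using that by (cases "i \<le> length mu") (simp_all add: part_def)
  then show "young_diagram mu \<subseteq> (SIGMA i:{..length mu}. {..part mu i})"
    unfolding young_diagram_def by blast
qed simp

section \<open>The Capelli computation of the hook product\<close>

text \<open>A tableau is given by the coordinates of its entries instead of a map on boxes. The same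
  functions \<open>row\<close> and \<open>col\<close> can then serve both for \<open>T\<close> on
  all entries and for \<open>S\<close> on the subset of its own entries.\<close>

locale young_filling =
  fixes mu :: "nat list" and X :: "nat set" and row col :: "nat \<Rightarrow> nat"
  assumes part_Suc: "\<And>i. 1 \<le> i \<Longrightarrow> part mu (Suc i) \<le> part mu i"
    and position: "bij_betw (\<lambda>p. (row p, col p)) X (young_diagram mu)"
begin

lemma finite_X: "finite X"
  using bij_betw_finite[OF position] finite_young_diagram by simp

lemma position_eqI: "p \<in> X \<Longrightarrow> q \<in> X \<Longrightarrow> row p = row q \<Longrightarrow> col p = col q \<Longrightarrow> p = q"
  using bij_betw_imp_inj_on[OF position] by (auto simp: inj_on_def)

lemma position_bounds:
  assumes "p \<in> X"
  shows "1 \<le> row p" "1 \<le> col p" "col p \<le> part mu (row p)"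
  using bij_betwE[OF position] assms by (auto simp: young_diagram_def)

lemma obtain_position:
  assumes "1 \<le> i" "1 \<le> j" "j \<le> part mu i"
  obtains p where "p \<in> X" "row p = i" "col p = j"
proof -
  have "(i, j) \<in> (\<lambda>p. (row p, col p)) ` X"
    using assms bij_betw_imp_surj_on[OF position] by (simp add: young_diagram_def)
  then show thesis using that by auto
qed

text \<open>The box of \<open>p\<close> itself is counted here and not in \<open>arm\<close>, so
  that \<open>leg p + arm p\<close> is the hook length and the legs in a column of height
  \<open>h\<close> run through 1 to \<open>h\<close>.\<close>

definition leg :: "nat \<Rightarrow> nat" where
  "leg p = card {q \<in> X. col q = col p \<and> row p \<le> row q}"

definition arm :: "nat \<Rightarrow> nat" where
  "arm p = card {q \<in> X. row q = row p \<and> col p < col q}"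

definition rows_from :: "nat \<Rightarrow> nat set" where
  "rows_from i = {p \<in> X. i \<le> row p}"

lemma finite_rows_from: "finite (rows_from i)"
  using finite_X by (simp add: rows_from_def)

text \<open>
  In the word on the left, \<open>t\<close> carries the letter \<open>col b\<close> and the place sent to \<open>b\<close> by \<open>q\<close> carries \<open>col t\<close>.
  Resetting \<open>t\<close> to \<open>col t\<close> and lowering to \<open>col b\<close> gives \<open>leg t\<close> copies of this word, one for each place in
  the column of \<open>t\<close>, and the word \<open>col \<circ> q\<close>.
\<close>

lemma capelli_step:
  fixes \<psi> :: "(nat \<Rightarrow> nat) \<Rightarrow> 'k::field_char_0"
  assumes inv: "\<And>\<tau> f. \<tau> \<in> stab col (rows_from i) \<Longrightarrow> \<psi> (f \<circ> \<tau>) = \<psi> f"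
    and low: "\<And>a b f. 1 \<le> a \<Longrightarrow> a < b \<Longrightarrow> b \<le> part mu i \<Longrightarrow> (\<And>p. p \<notin> rows_from i \<Longrightarrow> f p = col p)
      \<Longrightarrow> lower (rows_from i) a b \<psi> f = 0"
    and Q: "Q = {p \<in> X. row p = i \<and> col t < col p}"
    and t: "t \<in> X" "row t = i" and b: "b \<in> Q" and q: "q permutes Q"
  shows "of_nat (leg t) * \<psi> (col \<circ> (transpose t b \<circ> q)) = - \<psi> (col \<circ> q)"
proof -
  define w where "w = col \<circ> (transpose t b \<circ> q)"
  define c where "c = col t"
  define j where "j = col b"
  define p where "p = inv' q b"
  define C where "C = {s \<in> rows_from i. col s = c}"
  define g where "g = w(t := c)"
  have tQ: "t \<notin> Q" by (simp add: Q)
  have qQ: "q s \<in> Q \<longleftrightarrow> s \<in> Q" for s using permutes_in_image[OF q] .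
  have qnot: "q s = s" if "s \<notin> Q" for s using permutes_not_in[OF q that] .
  have qp: "q p = b" by (simp add: p_def permutes_inverses[OF q])
  have pQ: "p \<in> Q" using qp b qQ by metis
  have q_eq_b: "q s = b \<longleftrightarrow> s = p" for s using qp permutes_inj[OF q] by (metis injD)
  have QX: "Q \<subseteq> rows_from i" by (auto simp: Q rows_from_def)
  have colQ: "c < col s" if "s \<in> Q" for s using that by (simp add: Q c_def)
  have tX: "t \<in> rows_from i" using t by (simp add: rows_from_def)
  have w_off: "w s = col s" if "s \<notin> Q" "s \<noteq> t" for s
    using that b qnot by (auto simp: w_def transpose_def)
  have w_t: "w t = j" using tQ by (simp add: w_def qnot j_def)
  have w_p: "w p = c" by (simp add: w_def qp c_def)
  have w_Q: "w s = col (q s)" if "s \<in> Q" "s \<noteq> p" for s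
    using that q_eq_b qQ[of s] tQ by (auto simp: w_def transpose_def)
  have "lower (rows_from i) c j \<psi> g = 0"
  proof (rule low)
    show "1 \<le> c" using position_bounds[OF t(1)] by (simp add: c_def)
    show "c < j" using colQ[OF b] by (simp add: j_def)
    show "j \<le> part mu i" using position_bounds[of b] b by (auto simp: Q j_def)
    show "g s = col s" if "s \<notin> rows_from i" for s
      using that QX tX w_off[of s] by (auto simp: g_def)
  qed
  moreover have "{s. s \<in> rows_from i \<and> g s = c} = insert p C"
  proof (intro equalityI subsetI)
    fix s assume s: "s \<in> {s. s \<in> rows_from i \<and> g s = c}"
    show "s \<in> insert p C"
    proof (cases "s \<in> Q")
      case True
      then have "s = p"
        using s w_Q[of s] colQ[of "q s"] qQ[of s] tQ by (cases "s = p") (auto simp: g_def split: if_splits)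
      then show ?thesis by simp
    next
      case False
      then show ?thesis using s w_off[of s] by (auto simp: g_def C_def c_def split: if_splits)
    qed
  next
    fix s assume "s \<in> insert p C"
    then show "s \<in> {s. s \<in> rows_from i \<and> g s = c}"
      using pQ QX w_p w_off[of s] colQ[of s] tX by (cases "s \<in> Q"; cases "s = p") (auto simp: C_def g_def)
  qed
  moreover have "p \<notin> C" using colQ[OF pQ] by (auto simp: C_def)
  moreover have finC: "finite C" using finite_rows_from by (simp add: C_def)
  moreover have "\<psi> (g(s := j)) = \<psi> w" if s: "s \<in> C" for s
  proof -
    have "g(s := j) = w \<circ> transpose t s"
    proof (cases "s = t")
      case True
      then show ?thesis using w_t by (auto simp: g_def fun_eq_iff)
    next
      case False
      have "w s = c"
        using s colQ[of s] False w_off[of s] by (cases "s \<in> Q") (auto simp: C_def)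
      then show ?thesis
        using False fun_upd_transpose[of w s c t] w_t by (simp add: g_def)
    qed
    moreover have "transpose t s \<in> stab col (rows_from i)"
      using s tX by (intro transpose_in_stab) (auto simp: C_def c_def)
    ultimately show ?thesis using inv by simp
  qed
  moreover have "g(p := j) = col \<circ> q"
  proof
    fix s
    show "(g(p := j)) s = (col \<circ> q) s"
      using w_Q[of s] w_off[of s] qnot[of s] tQ qp
      by (cases "s = p"; cases "s = t"; cases "s \<in> Q") (auto simp: g_def j_def c_def)
  qed
  ultimately have "\<psi> (col \<circ> q) + of_nat (card C) * \<psi> w = 0"
    by (simp add: lower_def)
  moreover have "card C = leg t"
    unfolding C_def leg_def c_def rows_from_def using t by (intro arg_cong[of _ _ card]) auto
  ultimately show ?thesis
    by (simp add: w_def eq_neg_iff_add_eq_0 add.commute)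
qed

text \<open>Boxes of row \<open>i\<close> are added from right to left. A permutation of
  \<open>insert t Q'\<close> is uniquely \<open>transpose t b \<circ> q\<close> with
  \<open>q\<close> a permutation of the boxes to the right of \<open>t\<close>. After multiplication
  by \<open>leg t\<close>, the choice \<open>b = t\<close> gives \<open>leg t\<close> times the
  signed sum over \<open>q\<close>, and each of the \<open>arm t\<close> other choices gives that
  sum once, the sign of the transposition cancelling the one in \<open>capelli_step\<close>. So
  \<open>t\<close> contributes its hook length over its leg, the legs being kept on the left
  side.\<close>

lemma capelli_row:
  fixes \<psi> :: "(nat \<Rightarrow> nat) \<Rightarrow> 'k::field_char_0"
  assumes i: "1 \<le> i"
    and inv: "\<And>\<tau> f. \<tau> \<in> stab col (rows_from i) \<Longrightarrow> \<psi> (f \<circ> \<tau>) = \<psi> f"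
    and low: "\<And>a b f. 1 \<le> a \<Longrightarrow> a < b \<Longrightarrow> b \<le> part mu i \<Longrightarrow> (\<And>p. p \<notin> rows_from i \<Longrightarrow> f p = col p)
      \<Longrightarrow> lower (rows_from i) a b \<psi> f = 0"
  shows "(\<Sum>\<rho> | \<rho> permutes {p \<in> X. row p = i}. of_int (sign \<rho>) * \<psi> (col \<circ> \<rho>))
      * (\<Prod>p | p \<in> X \<and> row p = i. of_nat (leg p)) =
    (\<Prod>p | p \<in> X \<and> row p = i. of_nat (leg p + arm p)) * \<psi> col"
proof -
  define Q where "Q c = {p \<in> X. row p = i \<and> c \<le> col p}" for c
  have "(\<Sum>\<rho> | \<rho> permutes Q c. of_int (sign \<rho>) * \<psi> (col \<circ> \<rho>)) * (\<Prod>p\<in>Q c. of_nat (leg p)) =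
    (\<Prod>p\<in>Q c. of_nat (leg p + arm p)) * \<psi> col" if "1 \<le> c" "c \<le> Suc (part mu i)" for c
    using that(2,1)
  proof (induction c rule: inc_induct)
    case base
    have "Q (Suc (part mu i)) = {}"
      using position_bounds by (fastforce simp: Q_def)
    then show ?case by (simp add: sign_id)
  next
    case (step c)
    obtain t where t: "t \<in> X" "row t = i" "col t = c"
      using obtain_position[of i c] i step by auto
    define Q' where "Q' = Q (Suc c)"
    have Q': "Q' = {p \<in> X. row p = i \<and> col t < col p}" by (auto simp: Q'_def Q_def t)
    have ins: "Q c = insert t Q'"
      using t position_eqI by (auto simp: Q'_def Q_def) (metis le_neq_implies_less Suc_leI)
    have tQ: "t \<notin> Q'" and fin: "finite Q'" using finite_X by (auto simp: Q')
    have arm: "card Q' = arm t" by (simp add: Q' arm_def t)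
    define D where "D = (\<Sum>q | q permutes Q'. of_int (sign q) * \<psi> (col \<circ> q))"
    have swapped: "of_nat (leg t) * (of_int (sign (transpose t b \<circ> q)) * \<psi> (col \<circ> (transpose t b \<circ> q))) =
        of_int (sign q) * \<psi> (col \<circ> q)" if "b \<in> Q'" "q permutes Q'" for b q
    proof -
      have "sign (transpose t b \<circ> q) = - sign q"
      proof -
        have "permutation q" using that fin permutation_permutes by blast
        moreover have "t \<noteq> b" using that tQ by auto
        ultimately show ?thesis
          using sign_compose[OF permutation_swap_id[of t b]] by (simp add: sign_swap_id)
      qed
      moreover have "of_nat (leg t) * \<psi> (col \<circ> (transpose t b \<circ> q)) = - \<psi> (col \<circ> q)"
      proof (rule capelli_step[where i = i and Q = Q'])
        show "\<psi> (f \<circ> \<tau>) = \<psi> f" if "\<tau> \<in> stab col (rows_from i)" for \<tau> f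
          using that by (rule inv)
        show "lower (rows_from i) a b \<psi> f = 0"
          if "1 \<le> a" "a < b" "b \<le> part mu i" "\<And>p. p \<notin> rows_from i \<Longrightarrow> f p = col p" for a b f
          using that by (rule low)
      qed (fact Q' t that)+
      ultimately show ?thesis by (simp add: mult.left_commute del: o_apply)
    qed
    have "of_nat (leg t) * (\<Sum>\<rho> | \<rho> permutes Q c. of_int (sign \<rho>) * \<psi> (col \<circ> \<rho>)) =
        (\<Sum>b\<in>insert t Q'. \<Sum>q | q permutes Q'.
          of_nat (leg t) * (of_int (sign (transpose t b \<circ> q)) * \<psi> (col \<circ> (transpose t b \<circ> q))))"
      unfolding ins by (subst sum_over_permutations_insert[OF fin tQ]) (simp only: sum_distrib_left)
    also have "\<dots> = of_nat (leg t) * D + (\<Sum>b\<in>Q'. D)"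
      using tQ fin by (simp add: D_def sum_distrib_left swapped)
    also have "\<dots> = of_nat (leg t + arm t) * D"
      by (simp add: arm ring_distribs)
    finally have main: "of_nat (leg t) * (\<Sum>\<rho> | \<rho> permutes Q c. of_int (sign \<rho>) * \<psi> (col \<circ> \<rho>)) =
        of_nat (leg t + arm t) * D" .
    have "(\<Sum>\<rho> | \<rho> permutes Q c. of_int (sign \<rho>) * \<psi> (col \<circ> \<rho>)) * (\<Prod>p\<in>Q c. of_nat (leg p)) =
        of_nat (leg t) * (\<Sum>\<rho> | \<rho> permutes Q c. of_int (sign \<rho>) * \<psi> (col \<circ> \<rho>))
          * (\<Prod>p\<in>Q'. of_nat (leg p))"
      unfolding ins using tQ fin by simp
    also have "\<dots> = of_nat (leg t + arm t) * (D * (\<Prod>p\<in>Q'. of_nat (leg p)))"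
      unfolding main by simp
    also have "D * (\<Prod>p\<in>Q'. of_nat (leg p)) = (\<Prod>p\<in>Q'. of_nat (leg p + arm p)) * \<psi> col"
      unfolding D_def Q'_def by (rule step.IH) simp
    finally show ?case
      unfolding ins using tQ fin by simp
  qed
  from this[of 1] have "(\<Sum>\<rho> | \<rho> permutes Q 1. of_int (sign \<rho>) * \<psi> (col \<circ> \<rho>)) * (\<Prod>p\<in>Q 1. of_nat (leg p)) =
    (\<Prod>p\<in>Q 1. of_nat (leg p + arm p)) * \<psi> col" by simp
  moreover have "Q 1 = {p \<in> X. row p = i}"
    using position_bounds by (auto simp: Q_def)
  ultimately show ?thesis by simp
qed

end

section \<open>Cancellation, counting and rearrangement\<close>

lemma stab_const: "stab (\<lambda>_. c) A = {\<sigma>. \<sigma> permutes A}"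
  by (simp add: stab_def)

text \<open>Composing with \<open>transpose s t\<close> on the left permutes the summands, does not
  change the word and reverses the sign, so the sum equals its own negative.\<close>

lemma signed_sum_stab_zero:
  fixes \<psi> :: "(nat \<Rightarrow> nat) \<Rightarrow> 'k::field_char_0"
  assumes "finite A" "s \<in> A" "t \<in> A" "s \<noteq> t" "r s = r t" "f s = f t"
  shows "(\<Sum>\<sigma>\<in>stab r A. of_int (sign \<sigma>) * \<psi> (f \<circ> \<sigma>)) = 0"
proof -
  have tr: "transpose s t \<in> stab r A"
    using assms by (intro transpose_in_stab)
  have f: "f \<circ> transpose s t = f"
    using assms by (auto simp: fun_eq_iff transpose_def)
  have "(\<Sum>\<sigma>\<in>stab r A. of_int (sign \<sigma>) * \<psi> (f \<circ> \<sigma>)) =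
      (\<Sum>\<sigma>\<in>stab r A. of_int (sign (transpose s t \<circ> \<sigma>)) * \<psi> (f \<circ> (transpose s t \<circ> \<sigma>)))"
    by (rule sum_stab_compose_left[OF tr, symmetric])
  also have "\<dots> = (\<Sum>\<sigma>\<in>stab r A. - (of_int (sign \<sigma>) * \<psi> (f \<circ> \<sigma>)))"
  proof (rule sum.cong[OF refl])
    fix \<sigma> assume "\<sigma> \<in> stab r A"
    then have "sign (transpose s t \<circ> \<sigma>) = - sign \<sigma>"
      using sign_compose_permutes[OF assms(1,1) stab_permutes[OF tr] stab_permutes] assms(4)
      by (simp add: sign_swap_id)
    moreover have "f \<circ> (transpose s t \<circ> \<sigma>) = f \<circ> \<sigma>"
      by (simp only: o_assoc f)
    ultimately show "of_int (sign (transpose s t \<circ> \<sigma>)) * \<psi> (f \<circ> (transpose s t \<circ> \<sigma>)) =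
        - (of_int (sign \<sigma>) * \<psi> (f \<circ> \<sigma>))"
      by (simp del: o_apply)
  qed
  finally have "2 * (\<Sum>\<sigma>\<in>stab r A. of_int (sign \<sigma>) * \<psi> (f \<circ> \<sigma>)) = 0"
    unfolding sum_negf mult_2 by (simp only: eq_neg_iff_add_eq_0)
  then show ?thesis by simp
qed

text \<open>Counted from the top, the ranks are 1 to \<open>card B\<close>, once each. The smallest
  element contributes \<open>card B\<close>, and removing it does not affect the other
  factors.\<close>

lemma prod_ranks:
  fixes r :: "'a \<Rightarrow> nat"
  assumes "finite B" "inj_on r B"
  shows "(\<Prod>p\<in>B. card {q \<in> B. r p \<le> r q}) = fact (card B)"
  using assms
proof (induction "card B" arbitrary: B)
  case 0
  then show ?case by simp
next
  case (Suc n)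
  define x where "x = arg_min_on r B"
  have ne: "B \<noteq> {}" using Suc.hyps by auto
  have x: "x \<in> B" "\<And>y. y \<in> B \<Longrightarrow> r x \<le> r y"
    using arg_min_if_finite[OF Suc.prems(1) ne, of r] unfolding x_def by (auto simp: not_less)
  have card: "n = card (B - {x})" using Suc.hyps(2) Suc.prems(1) x(1) by simp
  have "(\<Prod>p\<in>B. card {q \<in> B. r p \<le> r q}) =
      card {q \<in> B. r x \<le> r q} * (\<Prod>p\<in>B - {x}. card {q \<in> B. r p \<le> r q})"
    using x Suc.prems by (intro prod.remove)
  also have "{q \<in> B. r x \<le> r q} = B" using x by auto
  also have "(\<Prod>p\<in>B - {x}. card {q \<in> B. r p \<le> r q}) = (\<Prod>p\<in>B - {x}. card {q \<in> B - {x}. r p \<le> r q})"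
  proof (intro prod.cong refl arg_cong[of _ _ card])
    fix p assume p: "p \<in> B - {x}"
    then have "r p \<noteq> r x" using Suc.prems(2) x by (auto simp: inj_on_def)
    moreover have "r x \<le> r p" using x p by auto
    ultimately show "{q \<in> B. r p \<le> r q} = {q \<in> B - {x}. r p \<le> r q}" by auto
  qed
  also have "\<dots> = fact (card (B - {x}))"
    using Suc.prems card x by (intro Suc.hyps(1)) (auto simp: inj_on_diff)
  finally show ?case
    using Suc.hyps(2) card by (metis fact_Suc of_nat_id)
qed

lemma card_stab:
  assumes "finite A" "finite I"
  shows "card (stab r {p \<in> A. r p \<in> I}) = (\<Prod>i\<in>I. fact (card {p \<in> A. r p = i}))"
  using assms(2)
proof induction
  case empty
  then show ?case by (simp add: stab_empty)
next
  case (insert i I)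
  have "{p \<in> A. r p \<in> insert i I} = {p \<in> A. r p = i} \<union> {p \<in> A. r p \<in> I}" by auto
  moreover have "bij_betw (\<lambda>(\<sigma>, \<tau>). \<sigma> \<circ> \<tau>) ({\<sigma>. \<sigma> permutes {p \<in> A. r p = i}} \<times> stab r {p \<in> A. r p \<in> I})
      (stab r ({p \<in> A. r p = i} \<union> {p \<in> A. r p \<in> I}))"
    using assms insert.hyps by (intro bij_betw_stab_union[of _ _ _ i]) auto
  ultimately have "card (stab r {p \<in> A. r p \<in> insert i I}) =
      card ({\<sigma>. \<sigma> permutes {p \<in> A. r p = i}} \<times> stab r {p \<in> A. r p \<in> I})"
    by (simp add: bij_betw_same_card)
  then show ?case
    using insert assms by (simp add: card_cartesian_product card_permutations)
qed

text \<open>The maximum of \<open>F\<close> is at least \<open>card F\<close>, so \<omega> is at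
  most \<open>\<omega> (card F)\<close> there; remove it and induct.\<close>

lemma sum_antitone_le:
  fixes \<omega> :: "nat \<Rightarrow> int"
  assumes "finite F" "\<And>a. a \<in> F \<Longrightarrow> 1 \<le> a"
    and anti: "\<And>i j. 1 \<le> i \<Longrightarrow> i < j \<Longrightarrow> \<omega> j \<le> \<omega> i"
  shows "sum \<omega> F \<le> sum \<omega> {1..card F}"
  using assms(1,2)
proof (induction "card F" arbitrary: F)
  case 0
  then show ?case by simp
next
  case (Suc n)
  define x where "x = Max F"
  have ne: "F \<noteq> {}" using Suc.hyps by auto
  have x: "x \<in> F" "\<And>y. y \<in> F \<Longrightarrow> y \<le> x"
    using Suc.prems ne by (auto simp: x_def)
  then have "F \<subseteq> {1..x}" using Suc.prems by auto
  then have "card F \<le> x" using card_mono[of "{1..x}" F] by simp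
  then have "\<omega> x \<le> \<omega> (Suc n)"
    using anti[of "Suc n" x] Suc.hyps(2) by (cases "x = Suc n") auto
  moreover have "sum \<omega> (F - {x}) \<le> sum \<omega> {1..n}"
  proof -
    have "n = card (F - {x})" using Suc.hyps(2) Suc.prems(1) x(1) by simp
    then show ?thesis using Suc.hyps(1)[of "F - {x}"] Suc.prems by auto
  qed
  moreover have "sum \<omega> F = \<omega> x + sum \<omega> (F - {x})"
    using Suc.prems x by (intro sum.remove)
  ultimately show ?case
    unfolding Suc.hyps(2)[symmetric] by simp
qed

section \<open>From single rows to the hook product\<close>

context young_filling
begin

lemma finite_stab_X: "finite (stab r X)"
  by (rule finite_stab[OF finite_X])

text \<open>Induction from the last row upwards. The row group of the rows from \<open>i\<close> on
  factors into the permutations of row \<open>i\<close> and the row group below. The former are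
  absorbed into a new function \<eta>, to which the induction hypothesis applies, and
  \<open>capelli_row\<close> then evaluates \<open>\<eta> col\<close>. The lowering hypothesis is
  limited to letters up to \<open>part mu i\<close> and to words agreeing with \<open>col\<close>
  outside the rows considered, because only this much is inherited by \<eta>.\<close>

lemma hook_scalar:
  fixes \<psi> :: "(nat \<Rightarrow> nat) \<Rightarrow> 'k::field_char_0"
  assumes "i \<le> Suc (length mu)" "1 \<le> i"
    and "\<And>\<tau> f. \<tau> \<in> stab col (rows_from i) \<Longrightarrow> \<psi> (f \<circ> \<tau>) = \<psi> f"
    and "\<And>a b f. 1 \<le> a \<Longrightarrow> a < b \<Longrightarrow> b \<le> part mu i \<Longrightarrow> (\<And>p. p \<notin> rows_from i \<Longrightarrow> f p = col p)
      \<Longrightarrow> lower (rows_from i) a b \<psi> f = 0"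
  shows "(\<Sum>\<rho>\<in>stab row (rows_from i). of_int (sign \<rho>) * \<psi> (col \<circ> \<rho>)) * (\<Prod>p\<in>rows_from i. of_nat (leg p)) =
    (\<Prod>p\<in>rows_from i. of_nat (leg p + arm p)) * \<psi> col"
  using assms
proof (induction i arbitrary: \<psi> rule: inc_induct)
  case base
  have "part mu (row p) = 0" if "p \<in> rows_from (Suc (length mu))" for p
    using that by (simp add: rows_from_def part_def)
  then have "rows_from (Suc (length mu)) = {}"
    using position_bounds by (fastforce simp: rows_from_def)
  then show ?case by (simp add: stab_empty sign_id)
next
  case (step i)
  note inv = step.prems(2) and low = step.prems(3)
  define R where "R = {p \<in> X. row p = i}"
  define Y where "Y = rows_from (Suc i)"
  define \<eta> where "\<eta> f = (\<Sum>\<rho> | \<rho> permutes R. of_int (sign \<rho>) * \<psi> (f \<circ> \<rho>))" for f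
  have split: "rows_from i = R \<union> Y" by (auto simp: rows_from_def R_def Y_def)
  have disj: "R \<inter> Y = {}" by (auto simp: rows_from_def R_def Y_def)
  have fin: "finite R" "finite Y" using finite_X by (auto simp: R_def Y_def rows_from_def)
  have \<eta>_stab: "\<eta> f = (\<Sum>\<rho>\<in>stab (\<lambda>_. 0) R. of_int (sign \<rho>) * \<psi> (f \<circ> \<rho>))" for f
    by (simp add: \<eta>_def stab_const)
  have "(\<Sum>\<rho>\<in>stab row (rows_from i). of_int (sign \<rho>) * \<psi> (col \<circ> \<rho>)) =
      (\<Sum>\<tau>\<in>stab row Y. \<Sum>\<rho> | \<rho> permutes R. of_int (sign (\<tau> \<circ> \<rho>)) * \<psi> (col \<circ> (\<tau> \<circ> \<rho>)))"
    unfolding split using fin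
    by (intro sum_stab_union[where i = i]) (auto simp: R_def Y_def rows_from_def)
  also have "\<dots> = (\<Sum>\<tau>\<in>stab row Y. of_int (sign \<tau>) * \<eta> (col \<circ> \<tau>))"
    unfolding \<eta>_def sum_distrib_left
  proof (intro sum.cong refl)
    fix \<tau> \<rho> assume "\<tau> \<in> stab row Y" "\<rho> \<in> {\<rho>. \<rho> permutes R}"
    then have "sign (\<tau> \<circ> \<rho>) = sign \<tau> * sign \<rho>"
      using fin by (intro sign_compose_permutes[of Y R]) (auto dest: stab_permutes)
    then show "of_int (sign (\<tau> \<circ> \<rho>)) * \<psi> (col \<circ> (\<tau> \<circ> \<rho>)) =
        of_int (sign \<tau>) * (of_int (sign \<rho>) * \<psi> (col \<circ> \<tau> \<circ> \<rho>))"
      by (simp add: o_assoc del: o_apply)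
  qed
  finally have sum: "(\<Sum>\<rho>\<in>stab row (rows_from i). of_int (sign \<rho>) * \<psi> (col \<circ> \<rho>)) =
      (\<Sum>\<tau>\<in>stab row Y. of_int (sign \<tau>) * \<eta> (col \<circ> \<tau>))" .
  have rest: "(\<Sum>\<tau>\<in>stab row Y. of_int (sign \<tau>) * \<eta> (col \<circ> \<tau>)) * (\<Prod>p\<in>Y. of_nat (leg p)) =
      (\<Prod>p\<in>Y. of_nat (leg p + arm p)) * \<eta> col"
    unfolding Y_def
  proof (rule step.IH[of \<eta>])
    show "1 \<le> Suc i" by simp
    show "\<eta> (f \<circ> \<tau>) = \<eta> f" if "\<tau> \<in> stab col (rows_from (Suc i))" for \<tau> f
      unfolding \<eta>_def
    proof (intro sum.cong refl)
      fix \<rho> assume "\<rho> \<in> {\<rho>. \<rho> permutes R}"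
      then have "\<tau> \<circ> \<rho> = \<rho> \<circ> \<tau>"
        using that disj stab_permutes[OF that]
        by (intro permutes_disjoint_commute[of _ Y _ R]) (auto simp: Y_def)
      then have "f \<circ> \<tau> \<circ> \<rho> = f \<circ> \<rho> \<circ> \<tau>" by (simp only: o_assoc[symmetric])
      moreover have "\<tau> \<in> stab col (rows_from i)"
        using that stab_mono[of Y "rows_from i" col] split by (auto simp: Y_def)
      ultimately show "of_int (sign \<rho>) * \<psi> (f \<circ> \<tau> \<circ> \<rho>) = of_int (sign \<rho>) * \<psi> (f \<circ> \<rho>)"
        using inv by (simp del: o_apply)
    qed
    show "lower (rows_from (Suc i)) a b \<eta> f = 0"
      if ab: "1 \<le> a" "a < b" "b \<le> part mu (Suc i)" and f: "\<And>p. p \<notin> rows_from (Suc i) \<Longrightarrow> f p = col p"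
      for a b f
    proof -
      have b: "b \<le> part mu i" using ab part_Suc[of i] step.prems(1) by simp
      have "lower (rows_from i) a b \<eta> f =
          (\<Sum>\<rho> | \<rho> permutes R. of_int (sign \<rho>) * lower (rows_from i) a b (\<lambda>f. \<psi> (f \<circ> \<rho>)) f)"
        unfolding \<eta>_def[abs_def] by (rule lower_sum)
      also have "\<dots> = (\<Sum>\<rho> | \<rho> permutes R. of_int (sign \<rho>) * 0)"
      proof (intro sum.cong refl)
        fix \<rho> assume "\<rho> \<in> {\<rho>. \<rho> permutes R}"
        then have \<rho>: "\<rho> permutes rows_from i" using permutes_subset[of \<rho> R] split by auto
        have "lower (rows_from i) a b \<psi> (f \<circ> \<rho>) = 0"
        proof (rule low[OF ab(1,2) b])
          show "(f \<circ> \<rho>) p = col p" if "p \<notin> rows_from i" for p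
            using that f[of p] permutes_not_in[OF \<rho> that] split by (simp add: Y_def)
        qed
        then show "of_int (sign \<rho>) * lower (rows_from i) a b (\<lambda>f. \<psi> (f \<circ> \<rho>)) f = of_int (sign \<rho>) * 0"
          using lower_compose[OF \<rho>, of a b \<psi> f] by simp
      qed
      finally have "lower R a b \<eta> f + lower Y a b \<eta> f = 0"
        unfolding split using lower_union[OF fin disj, of a b \<eta> f] by simp
      \<comment> \<open>Row \<open>i\<close> of \<open>f\<close> still reads like \<open>col\<close>
        and is at least as long as row \<open>Suc i\<close>, so it already contains
        \<open>b\<close>. Turning another of its letters into \<open>b\<close> creates a repetition,
        which the alternating sum \<eta> kills.\<close>
      moreover have "lower R a b \<eta> f = 0"
        unfolding lower_def
      proof (rule sum.neutral, clarify)
        fix s assume s: "s \<in> R" "a = f s"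
        obtain q where q: "q \<in> X" "row q = i" "col q = b"
          using obtain_position[of i b] ab b step.prems(1) by auto
        have "s \<notin> Y" "q \<notin> Y" using s disj q by (auto simp: R_def Y_def rows_from_def)
        then have "f s = col s" "f q = col q" using f by (auto simp: Y_def)
        then have "s \<noteq> q" using ab s q by auto
        then show "\<eta> (f(s := b)) = 0"
          unfolding \<eta>_stab using s q fin \<open>f q = col q\<close>
          by (intro signed_sum_stab_zero[of R s q]) (auto simp: R_def)
      qed
      ultimately show ?thesis by (simp add: Y_def)
    qed
  qed
  have first: "\<eta> col * (\<Prod>p\<in>R. of_nat (leg p)) = (\<Prod>p\<in>R. of_nat (leg p + arm p)) * \<psi> col"
    unfolding \<eta>_def R_def
  proof (rule capelli_row[OF step.prems(1)])
    show "\<psi> (f \<circ> \<tau>) = \<psi> f" if "\<tau> \<in> stab col (rows_from i)" for \<tau> f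
      using that by (rule inv)
    show "lower (rows_from i) a b \<psi> f = 0"
      if "1 \<le> a" "a < b" "b \<le> part mu i" "\<And>p. p \<notin> rows_from i \<Longrightarrow> f p = col p" for a b f
      using that by (rule low)
  qed
  have "(\<Sum>\<rho>\<in>stab row (rows_from i). of_int (sign \<rho>) * \<psi> (col \<circ> \<rho>)) * (\<Prod>p\<in>rows_from i. of_nat (leg p)) =
     ((\<Sum>\<tau>\<in>stab row Y. of_int (sign \<tau>) * \<eta> (col \<circ> \<tau>)) * (\<Prod>p\<in>Y. of_nat (leg p))) * (\<Prod>p\<in>R. of_nat (leg p))"
    unfolding sum unfolding split using fin disj by (subst prod.union_disjoint) (simp_all add: mult_ac)
  also have "\<dots> = (\<Prod>p\<in>Y. of_nat (leg p + arm p)) * (\<eta> col * (\<Prod>p\<in>R. of_nat (leg p)))"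
    unfolding rest by (simp only: mult_ac)
  also have "\<dots> = (\<Prod>p\<in>rows_from i. of_nat (leg p + arm p)) * \<psi> col"
    unfolding first split using fin disj by (subst prod.union_disjoint) (simp_all only: mult_ac)
  finally show ?case .
qed

text \<open>The order is the product of the factorials of the column heights, and the legs within
  one column multiply to such a factorial. This is what clears the legs in
  \<open>hook_scalar\<close>.\<close>

lemma card_column_stab: "card (stab col X) = (\<Prod>p\<in>X. leg p)"
proof -
  have "card (stab col {p \<in> X. col p \<in> col ` X}) = (\<Prod>j\<in>col ` X. fact (card {p \<in> X. col p = j}))"
    using finite_X by (intro card_stab) auto
  also have "\<dots> = (\<Prod>j\<in>col ` X. \<Prod>p\<in>{p \<in> X. col p = j}. leg p)"
  proof (rule prod.cong[OF refl])
    fix j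
    have "(\<Prod>p\<in>{p \<in> X. col p = j}. card {q \<in> {p \<in> X. col p = j}. row p \<le> row q}) =
        fact (card {p \<in> X. col p = j})"
      using finite_X position_eqI by (intro prod_ranks) (auto simp: inj_on_def)
    moreover have "card {q \<in> {p \<in> X. col p = j}. row p \<le> row q} = leg p"
      if "p \<in> {p \<in> X. col p = j}" for p
      unfolding leg_def using that by (intro arg_cong[of _ _ card]) auto
    ultimately show "fact (card {p \<in> X. col p = j}) = (\<Prod>p\<in>{p \<in> X. col p = j}. leg p)"
      by simp
  qed
  also have "\<dots> = (\<Prod>p\<in>X. leg p)"
    using finite_X by (intro prod.group) auto
  also have "{p \<in> X. col p \<in> col ` X} = X" by auto
  finally show ?thesis .
qed

lemma hook_product_positions: "hook_product mu = (\<Prod>p\<in>X. leg p + arm p)"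
proof -
  let ?pos = "\<lambda>p. (row p, col p)"
  have inj: "inj_on ?pos Y" if "Y \<subseteq> X" for Y
    using bij_betw_imp_inj_on[OF position] that inj_on_subset by blast
  have D: "young_diagram mu = ?pos ` X" using bij_betw_imp_surj_on[OF position] by simp
  have "card (hook mu (row p) (col p)) = leg p + arm p" if "p \<in> X" for p
  proof -
    have "hook mu (row p) (col p) = {d \<in> young_diagram mu.
        fst d = row p \<and> col p \<le> snd d \<or> snd d = col p \<and> row p \<le> fst d}"
      unfolding hook_def by auto
    also have "\<dots> = {d \<in> young_diagram mu. snd d = col p \<and> row p \<le> fst d} \<union>
        {d \<in> young_diagram mu. fst d = row p \<and> col p < snd d}"
      by auto
    also have "\<dots> =
        ?pos ` {q \<in> X. col q = col p \<and> row p \<le> row q} \<union> ?pos ` {q \<in> X. row q = row p \<and> col p < col q}"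
    proof -
      have "{d \<in> ?pos ` X. P d} = ?pos ` {q \<in> X. P (?pos q)}" for P by auto
      then show ?thesis unfolding D by simp
    qed
    finally have hook: "hook mu (row p) (col p) =
        ?pos ` {q \<in> X. col q = col p \<and> row p \<le> row q} \<union> ?pos ` {q \<in> X. row q = row p \<and> col p < col q}" .
    have card: "card (?pos ` {q \<in> X. P q}) = card {q \<in> X. P q}" for P
      by (intro card_image inj) auto
    have "card (hook mu (row p) (col p)) =
        card (?pos ` {q \<in> X. col q = col p \<and> row p \<le> row q}) +
        card (?pos ` {q \<in> X. row q = row p \<and> col p < col q})"
      unfolding hook using finite_X by (intro card_Un_disjoint) auto
    then show ?thesis
      unfolding card by (simp only: leg_def arm_def)
  qed
  then show ?thesis
    unfolding hook_product_def
    using prod.reindex_bij_betw[OF position, of "\<lambda>(x, y). card (hook mu x y)"] by simp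
qed

lemma card_column_antimono:
  assumes "1 \<le> i" "i < j"
  shows "card {t \<in> X. col t = j} \<le> card {t \<in> X. col t = i}"
proof -
  have card: "card {t \<in> X. col t = l} = card (row ` {t \<in> X. col t = l})" for l
    using position_eqI by (intro card_image[symmetric]) (auto simp: inj_on_def)
  have "row ` {t \<in> X. col t = j} \<subseteq> row ` {t \<in> X. col t = i}"
  proof clarify
    fix t assume t: "t \<in> X" "j = col t"
    obtain p where "p \<in> X" "row p = row t" "col p = i"
      using obtain_position[of "row t" i] position_bounds[OF t(1)] t assms by auto
    then show "row t \<in> row ` {u \<in> X. col u = i}" by (metis (mono_tags, lifting) imageI mem_Collect_eq)
  qed
  then show ?thesis
    unfolding card using finite_X by (intro card_mono) auto
qed

text \<open>Suppose the letters in each row are distinct. Then a row of length \<open>r\<close> sums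
  an antitone function over \<open>r\<close> distinct positive letters, which is at most its sum
  over 1 to \<open>r\<close>, the contribution of the same row of \<open>col\<close>. Adding up, the
  weight could not exceed that of \<open>col\<close>.\<close>

lemma repeated_letter:
  assumes pos: "\<And>p. p \<in> X \<Longrightarrow> 1 \<le> f p" and weight: "weight X col col < weight X col f"
  obtains s t where "s \<in> X" "t \<in> X" "s \<noteq> t" "row s = row t" "f s = f t"
proof (rule ccontr)
  assume contra: "\<not> thesis"
  have inj: "inj_on f {s \<in> X. row s = i}" for i
  proof (rule inj_onI, rule ccontr)
    fix s t assume "s \<in> {s \<in> X. row s = i}" "t \<in> {s \<in> X. row s = i}" "f s = f t" "s \<noteq> t"
    then show False using that[of s t] contra by simp
  qed
  \<comment> \<open>The weight is the sum of \<omega> over the letters of the word. Both terms of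
    \<omega> decrease: column heights of a diagram do, and so does minus the letter.\<close>
  define \<omega> where "\<omega> a = int (card {t \<in> X. col t = a}) - int a" for a
  have anti: "\<omega> j \<le> \<omega> i" if "1 \<le> i" "i < j" for i j
    using card_column_antimono[OF that] that by (simp add: \<omega>_def)
  have grp: "weight X col g = (\<Sum>i\<in>row ` X. \<Sum>s | s \<in> X \<and> row s = i. \<omega> (g s))" for g
    unfolding weight_def \<omega>_def using finite_X by (intro sum.group[symmetric]) auto
  have "weight X col f \<le> weight X col col"
    unfolding grp
  proof (rule sum_mono)
    fix i assume i: "i \<in> row ` X"
    define R where "R = {s. s \<in> X \<and> row s = i}"
    have fin: "finite R" using finite_X by (simp add: R_def)
    have injc: "inj_on col R" using position_eqI by (auto simp: R_def inj_on_def)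
    have colR: "col ` R = {1..part mu i}"
    proof (intro equalityI subsetI)
      fix a assume "a \<in> {1..part mu i}"
      then obtain p where "p \<in> X" "row p = i" "col p = a"
        using obtain_position[of i a] i position_bounds by auto
      then show "a \<in> col ` R" by (auto simp: R_def)
    qed (use position_bounds in \<open>auto simp: R_def\<close>)
    have "card R = part mu i"
      using card_image[OF injc] colR by simp
    have "(\<Sum>s\<in>R. \<omega> (f s)) = sum \<omega> (f ` R)"
      using inj[of i] by (simp add: sum.reindex R_def)
    also have "\<dots> \<le> sum \<omega> {1..card (f ` R)}"
      using fin pos anti by (intro sum_antitone_le) (auto simp: R_def)
    also have "card (f ` R) = part mu i"
      using inj[of i] \<open>card R = part mu i\<close> by (simp add: card_image R_def)
    also have "sum \<omega> {1..part mu i} = (\<Sum>s\<in>R. \<omega> (col s))"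
      unfolding colR[symmetric] using injc by (simp add: sum.reindex)
    finally show "(\<Sum>s | s \<in> X \<and> row s = i. \<omega> (f s)) \<le> (\<Sum>s | s \<in> X \<and> row s = i. \<omega> (col s))"
      by (simp add: R_def)
  qed
  then show False using weight by simp
qed

end

section \<open>Straightening\<close>

lemma weight_permute:
  assumes "\<sigma> permutes A"
  shows "weight A c (f \<circ> \<sigma>) = weight A c f"
  unfolding weight_def
  using sum.permute[OF assms, of "\<lambda>s. int (card {t \<in> A. c t = f s}) - int (f s)"] by (simp add: o_def)

lemma transpose_compose_permutes:
  assumes "\<sigma> permutes A"
  shows "transpose (\<sigma> s) (\<sigma> t) \<circ> \<sigma> = \<sigma> \<circ> transpose s t"
  using permutes_inj[OF assms] by (auto simp: fun_eq_iff transpose_def inj_eq)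

lemma casimir_compose:
  assumes "\<sigma> permutes A"
  shows "casimir A (\<lambda>f. \<psi> (f \<circ> \<sigma>)) f = casimir A \<psi> (f \<circ> \<sigma>)"
proof -
  have "casimir A (\<lambda>f. \<psi> (f \<circ> \<sigma>)) f = (\<Sum>s\<in>A. \<Sum>t\<in>A. \<psi> (f \<circ> transpose (\<sigma> s) (\<sigma> t) \<circ> \<sigma>))"
    unfolding casimir_def
    using sum.permute[OF assms, of "\<lambda>s. \<Sum>t\<in>A. \<psi> (f \<circ> transpose s t \<circ> \<sigma>)"]
      sum.permute[OF assms, of "\<lambda>t. \<psi> (f \<circ> transpose (\<sigma> _) t \<circ> \<sigma>)"]
    by (simp add: o_def)
  also have "\<dots> = casimir A \<psi> (f \<circ> \<sigma>)"
    unfolding casimir_def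
    by (simp only: o_assoc[symmetric] transpose_compose_permutes[OF assms])
  finally show ?thesis .
qed

context young_filling
begin

text \<open>The permutations representing the word \<open>h\<close> on \<open>X\<close>: a coset of
  the column group, or the empty set when \<open>h\<close> is not a rearrangement of
  \<open>col\<close>.\<close>

definition words :: "(nat \<Rightarrow> nat) \<Rightarrow> (nat \<Rightarrow> nat) set" where
  "words h = {\<sigma>. \<sigma> permutes X \<and> (\<forall>s\<in>X. col (\<sigma> s) = h s)}"

lemma bij_betw_words:
  assumes "\<pi> permutes X"
  shows "bij_betw (\<lambda>\<sigma>. \<sigma> \<circ> \<pi>) (words h) (words (h \<circ> \<pi>))"
proof (rule bij_betwI[where g = "\<lambda>\<sigma>. \<sigma> \<circ> inv' \<pi>"])
  note inv = permutes_inverses[OF assms]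
  show "(\<lambda>\<sigma>. \<sigma> \<circ> \<pi>) \<in> words h \<rightarrow> words (h \<circ> \<pi>)"
  proof
    fix \<sigma> assume "\<sigma> \<in> words h"
    then show "\<sigma> \<circ> \<pi> \<in> words (h \<circ> \<pi>)"
      using permutes_compose[OF assms, of \<sigma>] permutes_in_image[OF assms] by (simp add: words_def)
  qed
  show "(\<lambda>\<sigma>. \<sigma> \<circ> inv' \<pi>) \<in> words (h \<circ> \<pi>) \<rightarrow> words h"
  proof
    fix \<sigma> assume "\<sigma> \<in> words (h \<circ> \<pi>)"
    then show "\<sigma> \<circ> inv' \<pi> \<in> words h"
      using permutes_compose[OF permutes_inv[OF assms], of \<sigma>] permutes_in_image[OF permutes_inv[OF assms]] inv
      by (simp add: words_def)
  qed
  show "\<sigma> \<circ> \<pi> \<circ> inv' \<pi> = \<sigma>" "\<sigma> \<circ> inv' \<pi> \<circ> \<pi> = \<sigma>" for \<sigma>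
    using inv by (auto simp: fun_eq_iff)
qed

lemma words_col: "words col = stab col X"
proof -
  have "(\<forall>s\<in>X. col (\<sigma> s) = col s) \<longleftrightarrow> (\<forall>s. col (\<sigma> s) = col s)" if "\<sigma> permutes X" for \<sigma>
    using permutes_not_in[OF that] by metis
  then show ?thesis unfolding words_def stab_def by blast
qed

text \<open>The coset sums \<chi> form a Casimir eigenfunction supported on rearrangements of
  \<open>col\<close>, which all have the weight of \<open>col\<close>. A word in the support of
  \<open>lower X i j \<chi>\<close> arises from such a rearrangement by decreasing a letter, so its
  weight is strictly larger and its eigenvalue is different. Hence
  \<open>casimir_eigenvector_zero\<close> applies to \<open>lower X i j \<chi>\<close>.\<close>

lemma coset_casimir_lower:
  fixes x :: "(nat \<Rightarrow> nat) \<Rightarrow> 'k::field_char_0"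
  assumes eig: "\<And>\<sigma>. \<sigma> permutes X \<Longrightarrow>
      (\<Sum>s\<in>X. \<Sum>t\<in>X. x (\<sigma> \<circ> transpose s t)) = of_int (casimir_eigenvalue X col) * x \<sigma>"
    and ij: "1 \<le> i" "i < j"
  shows "lower X i j (\<lambda>h. \<Sum>\<sigma>\<in>words h. x \<sigma>) f = 0"
proof -
  define \<chi> where "\<chi> h = (\<Sum>\<sigma>\<in>words h. x \<sigma>)" for h
  define e where "e = casimir_eigenvalue X col"
  define P where "P f \<longleftrightarrow> (\<forall>s\<in>X. 1 \<le> f s) \<and> weight X col col < weight X col f" for f
  have \<chi>_supp: "weight X col h = weight X col col \<and> sum h X = sum col X \<and> (\<forall>s\<in>X. 1 \<le> h s)"
    if nz: "\<chi> h \<noteq> 0" for h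
  proof -
    obtain \<sigma> where \<sigma>: "\<sigma> permutes X" "\<And>s. s \<in> X \<Longrightarrow> h s = col (\<sigma> s)"
      using nz sum.neutral[of "words h" x] unfolding \<chi>_def words_def by fastforce
    have "weight X col h = weight X col (col \<circ> \<sigma>)"
      using \<sigma> by (intro weight_cong) simp
    moreover have "sum h X = sum (col \<circ> \<sigma>) X"
      using \<sigma> by (intro sum.cong) simp_all
    moreover have "\<forall>s\<in>X. 1 \<le> h s"
      using \<sigma> position_bounds(2) permutes_in_image[OF \<sigma>(1)] by simp
    ultimately show ?thesis
      using weight_permute[OF \<sigma>(1), of col col] sum.permute[OF \<sigma>(1), of col] by simp
  qed
  have \<chi>_eig: "casimir X \<chi> h = of_int e * \<chi> h" for h
  proof -
    have "casimir X \<chi> h = (\<Sum>s\<in>X. \<Sum>t\<in>X. \<Sum>\<sigma>\<in>words h. x (\<sigma> \<circ> transpose s t))"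
      unfolding casimir_def \<chi>_def
    proof (rule sum.cong[OF refl], rule sum.cong[OF refl])
      fix s t assume "s \<in> X" "t \<in> X"
      then have "transpose s t permutes X" by (rule permutes_swap_id)
      from sum.reindex_bij_betw[OF bij_betw_words[OF this], where g = x]
      show "sum x (words (h \<circ> transpose s t)) = (\<Sum>\<sigma>\<in>words h. x (\<sigma> \<circ> transpose s t))" by simp
    qed
    also have "\<dots> = (\<Sum>s\<in>X. \<Sum>\<sigma>\<in>words h. \<Sum>t\<in>X. x (\<sigma> \<circ> transpose s t))"
      by (intro sum.cong refl sum.swap)
    also have "\<dots> = (\<Sum>\<sigma>\<in>words h. \<Sum>s\<in>X. \<Sum>t\<in>X. x (\<sigma> \<circ> transpose s t))"
      by (rule sum.swap)
    also have "\<dots> = (\<Sum>\<sigma>\<in>words h. of_int e * x \<sigma>)"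
      unfolding e_def by (intro sum.cong refl eig) (simp add: words_def)
    finally show ?thesis unfolding \<chi>_def sum_distrib_left .
  qed
  have up: "weight X col g < weight X col (g(s := a))" if "s \<in> X" "1 \<le> a" "a < g s" for g s a
    using that finite_X card_column_antimono by (intro weight_upd) auto
  have "lower X i j \<chi> f = 0"
  proof (rule casimir_eigenvector_zero[where A = X and e = e and P = P and N = "sum col X" and \<psi> = "lower X i j \<chi>"])
    show "finite X" by (rule finite_X)
    show "1 \<le> g s" if "P g" "s \<in> X" for g s using that by (simp add: P_def)
    show "casimir_eigenvalue X g \<noteq> e" if "P g" for g
      using that weight_eigenvalue[OF finite_X, of col g] by (auto simp: P_def e_def)
    show "P (g(s := a))" if "P g" "s \<in> X" "1 \<le> a" "a < g s" for g s a
      using that up[of s a g] by (auto simp: P_def)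
    show "casimir X (lower X i j \<chi>) g = of_int e * lower X i j \<chi> g" for g
      unfolding casimir_lower by (simp only: lower_def \<chi>_eig sum_distrib_left)
    fix g assume "lower X i j \<chi> g \<noteq> 0"
    then obtain s where s: "s \<in> X" "g s = i" "\<chi> (g(s := j)) \<noteq> 0"
      unfolding lower_def by (auto dest: sum.not_neutral_contains_not_neutral)
    note supp = \<chi>_supp[OF s(3)]
    have "(g(s := j))(s := i) = g" using s by auto
    then have "weight X col (g(s := j)) < weight X col g"
      using up[of s i "g(s := j)"] s ij by simp
    moreover have "\<forall>u\<in>X. 1 \<le> g u" using supp s ij by (metis fun_upd_other)
    ultimately show "P g" using supp by (simp add: P_def)
    have "sum g X < sum (g(s := j)) X"
      using finite_X s ij by (intro sum_strict_mono_ex1) auto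
    then show "sum g X < sum col X" using supp by simp
  qed
  then show ?thesis by (simp add: \<chi>_def[abs_def])
qed

text \<open>The function \<chi> of coset sums is killed by lowering, and averaging it over columns
  without normalization gives \<psi>, which is also invariant under the column group
  \<open>C\<close>; so \<open>hook_scalar\<close> applies from row 1 on. It carries the product of
  the legs, \<open>card C\<close>, on the left, and the same factor occurs in
  \<open>\<psi> col\<close>.\<close>

lemma casimir_eigenvector_symmetrizer:
  fixes x :: "(nat \<Rightarrow> nat) \<Rightarrow> 'k::field_char_0"
  assumes eig: "\<And>\<sigma>. \<sigma> permutes X \<Longrightarrow>
      (\<Sum>s\<in>X. \<Sum>t\<in>X. x (\<sigma> \<circ> transpose s t)) = of_int (casimir_eigenvalue X col) * x \<sigma>"
  shows "(\<Sum>\<rho>\<in>stab row X. of_int (sign \<rho>) * (\<Sum>\<tau>\<in>stab col X. \<Sum>\<sigma>\<in>stab col X. x (\<sigma> \<circ> (\<rho> \<circ> \<tau>)))) =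
    of_nat (hook_product mu) * (\<Sum>\<sigma>\<in>stab col X. x \<sigma>)"
proof -
  define C where "C = stab col X"
  define \<chi> where "\<chi> h = (\<Sum>\<sigma>\<in>words h. x \<sigma>)" for h
  define \<psi> where "\<psi> f = (\<Sum>\<tau>\<in>C. \<chi> (f \<circ> \<tau>))" for f
  have low: "lower X a b \<chi> f = 0" if "1 \<le> a" "a < b" for a b f
    using coset_casimir_lower[of x, OF eig that] by (simp add: \<chi>_def[abs_def])
  have all: "rows_from 1 = X" using position_bounds(1) by (auto simp: rows_from_def)
  have "(\<Sum>\<rho>\<in>stab row (rows_from 1). of_int (sign \<rho>) * \<psi> (col \<circ> \<rho>)) * (\<Prod>p\<in>rows_from 1. of_nat (leg p)) =
      (\<Prod>p\<in>rows_from 1. of_nat (leg p + arm p)) * \<psi> col"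
  proof (rule hook_scalar)
    show "1 \<le> Suc (length mu)" "(1::nat) \<le> 1" by simp_all
    show "\<psi> (f \<circ> \<tau>) = \<psi> f" if "\<tau> \<in> stab col (rows_from 1)" for \<tau> f
      using sum_stab_compose_left[of \<tau> col X "\<lambda>\<sigma>. \<chi> (f \<circ> \<sigma>)"] that
      unfolding all \<psi>_def C_def o_assoc by simp
    show "lower (rows_from 1) a b \<psi> f = 0" if "1 \<le> a" "a < b" for a b f
    proof -
      have "lower X a b \<psi> f = (\<Sum>\<tau>\<in>C. 1 * lower X a b (\<lambda>f. \<chi> (f \<circ> \<tau>)) f)"
        unfolding \<psi>_def[abs_def] using lower_sum[of X a b "\<lambda>_. 1" "\<lambda>\<tau> f. \<chi> (f \<circ> \<tau>)" C f] by simp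
      also have "\<dots> = 0"
      proof (rule sum.neutral, rule ballI)
        fix \<tau> assume "\<tau> \<in> C"
        then have "\<tau> permutes X" unfolding C_def by (rule stab_permutes)
        then show "1 * lower X a b (\<lambda>f. \<chi> (f \<circ> \<tau>)) f = 0"
          using lower_compose[of \<tau> X a b \<chi> f] low[OF that] by simp
      qed
      finally show ?thesis unfolding all .
    qed
  qed
  then have hook: "(\<Sum>\<rho>\<in>stab row X. of_int (sign \<rho>) * \<psi> (col \<circ> \<rho>)) * of_nat (card C) =
      of_nat (hook_product mu) * \<psi> col"
    unfolding all by (simp add: C_def card_column_stab hook_product_positions)
  have \<chi>_coset: "\<chi> (col \<circ> \<pi>) = (\<Sum>\<sigma>\<in>C. x (\<sigma> \<circ> \<pi>))" if "\<pi> permutes X" for \<pi>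
    using sum.reindex_bij_betw[OF bij_betw_words[OF that, of col], where g = x]
    by (simp add: \<chi>_def words_col C_def)
  have "\<psi> col = (\<Sum>\<tau>\<in>C. \<chi> col)"
    unfolding \<psi>_def C_def by (intro sum.cong refl) (simp add: stab_compose_word)
  also have "\<chi> col = (\<Sum>\<sigma>\<in>C. x \<sigma>)"
    by (simp add: \<chi>_def words_col C_def)
  finally have \<psi>_col: "\<psi> col = of_nat (card C) * (\<Sum>\<sigma>\<in>C. x \<sigma>)" by simp
  have "card C \<noteq> 0"
    using finite_stab_X[of col] id_in_stab[of col X] unfolding C_def by auto
  then have "(\<Sum>\<rho>\<in>stab row X. of_int (sign \<rho>) * \<psi> (col \<circ> \<rho>)) = of_nat (hook_product mu) * (\<Sum>\<sigma>\<in>C. x \<sigma>)"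
    using hook unfolding \<psi>_col by (simp add: mult.commute mult.left_commute)
  moreover have "\<psi> (col \<circ> \<rho>) = (\<Sum>\<tau>\<in>C. \<Sum>\<sigma>\<in>C. x (\<sigma> \<circ> (\<rho> \<circ> \<tau>)))" if "\<rho> \<in> stab row X" for \<rho>
    unfolding \<psi>_def
  proof (rule sum.cong[OF refl])
    fix \<tau> assume "\<tau> \<in> C"
    then have "\<rho> \<circ> \<tau> permutes X"
      using that by (auto simp: C_def intro: permutes_compose stab_permutes)
    from \<chi>_coset[OF this] show "\<chi> (col \<circ> \<rho> \<circ> \<tau>) = (\<Sum>\<sigma>\<in>C. x (\<sigma> \<circ> (\<rho> \<circ> \<tau>)))"
      by (simp only: o_assoc)
  qed
  ultimately show ?thesis unfolding C_def by simp
qed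

text \<open>One double sum is evaluated twice. Here \<open>x \<sigma>\<close> is the value of \<phi>
  on the eigenvector combination translated by \<sigma>, so
  \<open>casimir_eigenvector_symmetrizer\<close> produces the hook product. On the other hand every
  word of the combination except \<open>col\<close> has larger weight, hence repeats a letter in
  some row and disappears from the signed row sum, while \<open>col\<close> is fixed by the column
  group and leaves \<open>card C\<close> copies of the wanted expression.\<close>

lemma straightening:
  assumes "finite B" "X \<subseteq> B" and pos: "\<And>p. p \<in> B \<Longrightarrow> 1 \<le> col p"
  defines "W \<equiv> {col \<circ> \<sigma> |\<sigma>. \<sigma> permutes B}"
  obtains m :: "(nat \<Rightarrow> nat) \<Rightarrow> rat" where
    "\<And>g. 0 \<le> m g"
    "\<And>g. m g \<noteq> 0 \<Longrightarrow> g \<in> W \<and> weight X col col < weight X col g \<and> (\<forall>s\<in>X. g s \<le> col s)"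
    "\<And>\<phi> :: (nat \<Rightarrow> nat) \<Rightarrow> 'k::field_char_0.
      (\<And>i j g. 1 \<le> i \<Longrightarrow> i < j \<Longrightarrow> lower B i j \<phi> g = 0) \<Longrightarrow>
      (\<Sum>\<rho>\<in>stab row X. of_int (sign \<rho>) * (\<Sum>\<tau>\<in>stab col X. \<phi> (col \<circ> (\<rho> \<circ> \<tau>)))) =
      of_nat (hook_product mu) * \<phi> col + (\<Sum>g\<in>W. of_rat (m g) * \<phi> g)"
proof -
  define C where "C = stab col X"
  define \<alpha> where "\<alpha> = hook_product mu"
  have W_compose: "g \<circ> \<sigma> \<in> W" if "g \<in> W" "\<sigma> permutes B" for g \<sigma>
  proof -
    from that(1) obtain \<pi> where "g = col \<circ> \<pi>" "\<pi> permutes B" unfolding W_def by blast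
    then have "g \<circ> \<sigma> = col \<circ> (\<pi> \<circ> \<sigma>)" "\<pi> \<circ> \<sigma> permutes B"
      using that(2) by (simp_all add: o_assoc permutes_compose)
    then show ?thesis unfolding W_def by blast
  qed
  have W_pos: "1 \<le> g p" if "g \<in> W" "p \<in> B" for g p
    using that pos by (auto simp: W_def permutes_in_image)
  have finW: "finite W"
  proof -
    have "W = (\<lambda>\<sigma>. col \<circ> \<sigma>) ` {\<sigma>. \<sigma> permutes B}" unfolding W_def by blast
    then show ?thesis using finite_permutations[OF \<open>finite B\<close>] by simp
  qed
  have col_W: "col \<in> W" unfolding W_def mem_Collect_eq by (rule exI[of _ id]) (simp add: permutes_id)
  obtain v :: "(nat \<Rightarrow> nat) \<Rightarrow> rat" where v_nonneg: "\<And>g. 0 \<le> v g"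
    and v_supp: "\<And>g. v g \<noteq> 0 \<Longrightarrow> g \<in> W \<and> weight X col col < weight X col g \<and> (\<forall>s\<in>X. g s \<le> col s)"
    and v_eig: "\<And>\<phi> :: (nat \<Rightarrow> nat) \<Rightarrow> 'k.
       (\<And>f. f \<in> W \<Longrightarrow> casimir X \<phi> f = of_int (casimir_eigenvalue X f) * \<phi> f
          - 2 * (\<Sum>s\<in>X. \<Sum>t | t \<in> B - X \<and> f t < f s. \<phi> (f \<circ> transpose s t))) \<Longrightarrow>
       casimir X \<phi> col + (\<Sum>g\<in>W. of_rat (v g) * casimir X \<phi> g) =
       of_int (casimir_eigenvalue X col) * (\<phi> col + (\<Sum>g\<in>W. of_rat (v g) * \<phi> g))"
  proof (rule nonneg_casimir_eigenvector[where 'k = 'k, OF \<open>finite B\<close> \<open>X \<subseteq> B\<close> finW col_W])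
    show "f \<circ> transpose s t \<in> W" if "f \<in> W" "s \<in> B" "t \<in> B" for f s t
      using that by (intro W_compose permutes_swap_id)
    show "1 \<le> f p" if "f \<in> W" "p \<in> B" for f p using that by (rule W_pos)
    show "card {t \<in> X. col t = j} \<le> card {t \<in> X. col t = i}" if "1 \<le> i" "i < j" for i j
      using that by (rule card_column_antimono)
  qed blast
  \<comment> \<open>The first evaluation only sees the sum of \<open>x\<close> over the column group
    \<open>C\<close>. So the coefficients are those of the eigenvector averaged over
    \<open>C\<close> and scaled by the hook product; \<open>col\<close>, being fixed by
    \<open>C\<close>, keeps the hook product itself.\<close>
  define m where "m g = of_nat \<alpha> / of_nat (card C) * (\<Sum>\<sigma>\<in>C. v (g \<circ> \<sigma>))" for g
  have C_perm: "\<sigma> permutes X" "\<sigma> permutes B" if "\<sigma> \<in> C" for \<sigma>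
    using that stab_permutes[of \<sigma> col X] permutes_subset[of \<sigma> X B] \<open>X \<subseteq> B\<close> by (auto simp: C_def)
  have finC: "finite C" unfolding C_def by (rule finite_stab_X)
  have cardC: "card C \<noteq> 0"
    using finC id_in_stab[of col X] unfolding C_def by auto
  show thesis
  proof
    show "0 \<le> m g" for g
      unfolding m_def using v_nonneg by (intro mult_nonneg_nonneg divide_nonneg_nonneg sum_nonneg) auto
    show "g \<in> W \<and> weight X col col < weight X col g \<and> (\<forall>s\<in>X. g s \<le> col s)" if "m g \<noteq> 0" for g
    proof -
      have "(\<Sum>\<sigma>\<in>C. v (g \<circ> \<sigma>)) \<noteq> 0" using that by (auto simp: m_def)
      then obtain \<sigma> where \<sigma>: "\<sigma> \<in> C" "v (g \<circ> \<sigma>) \<noteq> 0"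
        using sum.neutral[of C "\<lambda>\<sigma>. v (g \<circ> \<sigma>)"] by blast
      note supp = v_supp[OF \<sigma>(2)] and inv = permutes_inverses[OF C_perm(1)[OF \<sigma>(1)]]
      have undo: "g \<circ> \<sigma> \<circ> inv' \<sigma> = g" using inv by (auto simp: fun_eq_iff)
      have "g \<circ> \<sigma> \<circ> inv' \<sigma> \<in> W"
        using supp by (rule W_compose[OF conjunct1 permutes_inv[OF C_perm(2)[OF \<sigma>(1)]]])
      then have "g \<in> W" unfolding undo .
      moreover have "weight X col (g \<circ> \<sigma>) = weight X col g"
        by (rule weight_permute[OF C_perm(1)[OF \<sigma>(1)]])
      \<comment> \<open>The letterwise bound survives the averaging because \<sigma> preserves
        columns.\<close>
      moreover have "g s \<le> col s" if "s \<in> X" for s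
      proof -
        have "inv' \<sigma> s \<in> X"
          using that permutes_in_image[OF permutes_inv[OF C_perm(1)[OF \<sigma>(1)]]] by simp
        then have "(g \<circ> \<sigma>) (inv' \<sigma> s) \<le> col (inv' \<sigma> s)" using supp by blast
        moreover have "col (\<sigma> (inv' \<sigma> s)) = col (inv' \<sigma> s)"
          using \<sigma>(1) by (simp add: C_def stab_def)
        ultimately show ?thesis using inv by simp
      qed
      ultimately show ?thesis using supp by simp
    qed
    fix \<phi> :: "(nat \<Rightarrow> nat) \<Rightarrow> 'k"
    assume low: "lower B i j \<phi> g = 0" if "1 \<le> i" "i < j" for i j g
    define x where "x \<sigma> = \<phi> (col \<circ> \<sigma>) + (\<Sum>g\<in>W. of_rat (v g) * \<phi> (g \<circ> \<sigma>))" for \<sigma>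
    define E where "E = (\<Sum>\<rho>\<in>stab row X. of_int (sign \<rho>) * (\<Sum>\<tau>\<in>C. \<phi> (col \<circ> (\<rho> \<circ> \<tau>))))"
    have eig: "(\<Sum>s\<in>X. \<Sum>t\<in>X. x (\<sigma> \<circ> transpose s t)) = of_int (casimir_eigenvalue X col) * x \<sigma>"
      if \<sigma>: "\<sigma> permutes X" for \<sigma>
    proof -
      \<comment> \<open>The eigenvector equation is needed at every \<sigma>. Since \<open>v\<close>
        does not depend on the test function, it may be applied to this translate, which is again
        killed by lowering, and the Casimir operator commutes with the translation.\<close>
      define \<phi>' where "\<phi>' f = \<phi> (f \<circ> \<sigma>)" for f
      have \<sigma>B: "\<sigma> permutes B" using permutes_subset[OF \<sigma> \<open>X \<subseteq> B\<close>] .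
      have low': "lower B i j \<phi>' g = 0" if "1 \<le> i" "i < j" for i j g
        using lower_compose[OF \<sigma>B, of i j \<phi> g] low[OF that] by (simp add: \<phi>'_def[abs_def])
      have cas: "casimir X \<phi>' g = (\<Sum>s\<in>X. \<Sum>t\<in>X. \<phi> (g \<circ> (\<sigma> \<circ> transpose s t)))" for g
        using casimir_compose[OF \<sigma>, of \<phi> g] by (simp add: \<phi>'_def[abs_def] casimir_def o_assoc)
      have "casimir X \<phi>' col + (\<Sum>g\<in>W. of_rat (v g) * casimir X \<phi>' g) =
          of_int (casimir_eigenvalue X col) * (\<phi>' col + (\<Sum>g\<in>W. of_rat (v g) * \<phi>' g))"
      proof (rule v_eig)
        fix f assume "f \<in> W"
        show "casimir X \<phi>' f = of_int (casimir_eigenvalue X f) * \<phi>' f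
          - 2 * (\<Sum>s\<in>X. \<Sum>t | t \<in> B - X \<and> f t < f s. \<phi>' (f \<circ> transpose s t))"
          by (rule casimir_coinvariant[OF \<open>finite B\<close> \<open>X \<subseteq> B\<close> W_pos[OF \<open>f \<in> W\<close>] low'])
      qed
      moreover have "(\<Sum>s\<in>X. \<Sum>t\<in>X. x (\<sigma> \<circ> transpose s t)) =
          casimir X \<phi>' col + (\<Sum>g\<in>W. of_rat (v g) * casimir X \<phi>' g)"
      proof -
        have "(\<Sum>s\<in>X. \<Sum>t\<in>X. \<Sum>g\<in>W. of_rat (v g) * \<phi> (g \<circ> (\<sigma> \<circ> transpose s t))) =
            (\<Sum>s\<in>X. \<Sum>g\<in>W. \<Sum>t\<in>X. of_rat (v g) * \<phi> (g \<circ> (\<sigma> \<circ> transpose s t)))"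
          by (intro sum.cong refl sum.swap)
        also have "\<dots> = (\<Sum>g\<in>W. \<Sum>s\<in>X. \<Sum>t\<in>X. of_rat (v g) * \<phi> (g \<circ> (\<sigma> \<circ> transpose s t)))"
          by (rule sum.swap)
        finally show ?thesis
          unfolding x_def cas by (simp only: sum.distrib sum_distrib_left)
      qed
      ultimately show ?thesis by (simp add: x_def \<phi>'_def)
    qed
    have vanish: "(\<Sum>\<rho>\<in>stab row X. of_int (sign \<rho>) * (\<Sum>\<tau>\<in>C. \<phi> (g \<circ> \<sigma> \<circ> (\<rho> \<circ> \<tau>)))) = 0"
      if "\<sigma> \<in> C" "v g \<noteq> 0" for \<sigma> g
    proof -
      note supp = v_supp[OF that(2)]
      have "weight X col col < weight X col (g \<circ> \<sigma>)"
        using supp weight_permute[OF C_perm(1)[OF that(1)], of col g] by simp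
      moreover have "1 \<le> (g \<circ> \<sigma>) p" if "p \<in> X" for p
        using W_pos[of "g \<circ> \<sigma>" p] W_compose[OF _ C_perm(2)[OF \<open>\<sigma> \<in> C\<close>], of g] supp that \<open>X \<subseteq> B\<close> by blast
      ultimately obtain s t where "s \<in> X" "t \<in> X" "s \<noteq> t" "row s = row t" "(g \<circ> \<sigma>) s = (g \<circ> \<sigma>) t"
        using repeated_letter[of "g \<circ> \<sigma>"] by blast
      from signed_sum_stab_zero[OF finite_X this, where \<psi> = "\<lambda>f. \<Sum>\<tau>\<in>C. \<phi> (f \<circ> \<tau>)"]
      show ?thesis by (simp only: o_assoc)
    qed
    have "(\<Sum>\<rho>\<in>stab row X. of_int (sign \<rho>) * (\<Sum>\<tau>\<in>C. \<Sum>\<sigma>\<in>C. x (\<sigma> \<circ> (\<rho> \<circ> \<tau>)))) =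
        (\<Sum>\<sigma>\<in>C. \<Sum>\<rho>\<in>stab row X. of_int (sign \<rho>) * (\<Sum>\<tau>\<in>C. x (\<sigma> \<circ> (\<rho> \<circ> \<tau>))))"
    proof -
      have "(\<Sum>\<rho>\<in>stab row X. of_int (sign \<rho>) * (\<Sum>\<tau>\<in>C. \<Sum>\<sigma>\<in>C. x (\<sigma> \<circ> (\<rho> \<circ> \<tau>)))) =
          (\<Sum>\<rho>\<in>stab row X. of_int (sign \<rho>) * (\<Sum>\<sigma>\<in>C. \<Sum>\<tau>\<in>C. x (\<sigma> \<circ> (\<rho> \<circ> \<tau>))))"
        by (intro sum.cong refl arg_cong2[of _ _ _ _ "(*)"] sum.swap)
      also have "\<dots> = (\<Sum>\<sigma>\<in>C. \<Sum>\<rho>\<in>stab row X. of_int (sign \<rho>) * (\<Sum>\<tau>\<in>C. x (\<sigma> \<circ> (\<rho> \<circ> \<tau>))))"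
        unfolding sum_distrib_left[of _ "\<lambda>\<sigma>. \<Sum>\<tau>\<in>C. x (\<sigma> \<circ> (_ \<circ> \<tau>))"] by (rule sum.swap)
      finally show ?thesis .
    qed
    also have "\<dots> = (\<Sum>\<sigma>\<in>C. E)"
    proof (rule sum.cong[OF refl])
      fix \<sigma> assume \<sigma>: "\<sigma> \<in> C"
      have col_\<sigma>: "col \<circ> (\<sigma> \<circ> \<pi>) = col \<circ> \<pi>" for \<pi>
        using \<sigma> by (simp add: o_assoc stab_compose_word C_def)
      have "(\<Sum>\<rho>\<in>stab row X. of_int (sign \<rho>) * (\<Sum>\<tau>\<in>C. x (\<sigma> \<circ> (\<rho> \<circ> \<tau>)))) = E +
          (\<Sum>\<rho>\<in>stab row X. of_int (sign \<rho>) *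
            (\<Sum>\<tau>\<in>C. \<Sum>g\<in>W. of_rat (v g) * \<phi> (g \<circ> (\<sigma> \<circ> (\<rho> \<circ> \<tau>)))))"
        unfolding x_def E_def by (simp only: col_\<sigma> sum.distrib ring_distribs)
      also have "(\<Sum>\<rho>\<in>stab row X. of_int (sign \<rho>) *
            (\<Sum>\<tau>\<in>C. \<Sum>g\<in>W. of_rat (v g) * \<phi> (g \<circ> (\<sigma> \<circ> (\<rho> \<circ> \<tau>))))) =
          (\<Sum>\<rho>\<in>stab row X. of_int (sign \<rho>) *
            (\<Sum>g\<in>W. of_rat (v g) * (\<Sum>\<tau>\<in>C. \<phi> (g \<circ> \<sigma> \<circ> (\<rho> \<circ> \<tau>)))))"
        unfolding sum_distrib_left[of "of_rat _"] o_assoc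
        by (intro sum.cong refl arg_cong2[of _ _ _ _ "(*)"] sum.swap)
      also have "\<dots> = (\<Sum>\<rho>\<in>stab row X. \<Sum>g\<in>W. of_rat (v g) *
            (of_int (sign \<rho>) * (\<Sum>\<tau>\<in>C. \<phi> (g \<circ> \<sigma> \<circ> (\<rho> \<circ> \<tau>)))))"
        unfolding sum_distrib_left[of _ "\<lambda>g. of_rat (v g) * _ g"] by (simp only: mult.left_commute)
      also have "\<dots> = (\<Sum>g\<in>W. of_rat (v g) * (\<Sum>\<rho>\<in>stab row X.
            of_int (sign \<rho>) * (\<Sum>\<tau>\<in>C. \<phi> (g \<circ> \<sigma> \<circ> (\<rho> \<circ> \<tau>)))))"
        unfolding sum_distrib_left[of "of_rat _"] by (rule sum.swap)
      also have "\<dots> = 0"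
      proof (rule sum.neutral, rule ballI)
        fix g
        show "of_rat (v g) * (\<Sum>\<rho>\<in>stab row X.
            of_int (sign \<rho>) * (\<Sum>\<tau>\<in>C. \<phi> (g \<circ> \<sigma> \<circ> (\<rho> \<circ> \<tau>)))) = 0"
          using vanish[OF \<sigma>, of g] by (cases "v g = 0") simp_all
      qed
      finally show "(\<Sum>\<rho>\<in>stab row X. of_int (sign \<rho>) * (\<Sum>\<tau>\<in>C. x (\<sigma> \<circ> (\<rho> \<circ> \<tau>)))) = E"
        unfolding add_0_right .
    qed
    finally have "of_nat (card C) * E = of_nat \<alpha> * (\<Sum>\<sigma>\<in>C. x \<sigma>)"
      using casimir_eigenvector_symmetrizer[of x, OF eig] by (simp add: C_def \<alpha>_def)
    also have "(\<Sum>\<sigma>\<in>C. x \<sigma>) = of_nat (card C) * \<phi> col + (\<Sum>g\<in>W. (\<Sum>\<sigma>\<in>C. of_rat (v (g \<circ> \<sigma>))) * \<phi> g)"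
    proof -
      have "(\<Sum>g\<in>W. of_rat (v g) * \<phi> (g \<circ> \<sigma>)) = (\<Sum>g\<in>W. of_rat (v (g \<circ> inv' \<sigma>)) * \<phi> g)" if "\<sigma> \<in> C" for \<sigma>
      proof (rule sum.reindex_bij_witness[where i = "\<lambda>g. g \<circ> inv' \<sigma>" and j = "\<lambda>g. g \<circ> \<sigma>"])
        note inv = permutes_inverses[OF C_perm(1)[OF that]]
        show 1: "g \<circ> \<sigma> \<circ> inv' \<sigma> = g" and "g \<circ> inv' \<sigma> \<circ> \<sigma> = g" for g
          using inv by (auto simp: fun_eq_iff)
        show "of_rat (v (g \<circ> \<sigma> \<circ> inv' \<sigma>)) * \<phi> (g \<circ> \<sigma>) = of_rat (v g) * \<phi> (g \<circ> \<sigma>)" for g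
          by (simp only: 1)
      qed (use W_compose permutes_inv C_perm(2)[OF that] in \<open>blast+\<close>)
      then have "(\<Sum>\<sigma>\<in>C. x \<sigma>) = (\<Sum>\<sigma>\<in>C. \<phi> col + (\<Sum>g\<in>W. of_rat (v (g \<circ> inv' \<sigma>)) * \<phi> g))"
        unfolding x_def by (intro sum.cong refl) (simp add: C_def stab_compose_word)
      also have "\<dots> = of_nat (card C) * \<phi> col + (\<Sum>\<sigma>\<in>C. \<Sum>g\<in>W. of_rat (v (g \<circ> inv' \<sigma>)) * \<phi> g)"
        by (simp add: sum.distrib)
      also have "(\<Sum>\<sigma>\<in>C. \<Sum>g\<in>W. of_rat (v (g \<circ> inv' \<sigma>)) * \<phi> g) =
          (\<Sum>\<sigma>\<in>C. \<Sum>g\<in>W. of_rat (v (g \<circ> \<sigma>)) * \<phi> g)"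
        unfolding C_def by (rule sum_stab_inverse)
      also have "\<dots> = (\<Sum>g\<in>W. (\<Sum>\<sigma>\<in>C. of_rat (v (g \<circ> \<sigma>))) * \<phi> g)"
        unfolding sum_distrib_right by (rule sum.swap)
      finally show ?thesis .
    qed
    also have "of_nat \<alpha> * \<dots> = of_nat (card C) * (of_nat \<alpha> * \<phi> col + (\<Sum>g\<in>W. of_rat (m g) * \<phi> g))"
    proof -
      have "of_nat (card C) * (of_rat (m g) * \<phi> g) =
          of_nat \<alpha> * ((\<Sum>\<sigma>\<in>C. of_rat (v (g \<circ> \<sigma>))) * \<phi> g)" for g
        using cardC by (simp add: m_def of_rat_mult of_rat_divide of_rat_sum)
      then show ?thesis
        by (simp only: distrib_left sum_distrib_left[of "of_nat _"]) (simp only: mult.left_commute)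
    qed
    finally show "(\<Sum>\<rho>\<in>stab row X. of_int (sign \<rho>) * (\<Sum>\<tau>\<in>stab col X. \<phi> (col \<circ> (\<rho> \<circ> \<tau>)))) =
      of_nat (hook_product mu) * \<phi> col + (\<Sum>g\<in>W. of_rat (m g) * \<phi> g)"
      using cardC by (simp add: E_def C_def \<alpha>_def)
  qed
qed

end

section \<open>Young symmetrizers in the group algebra\<close>

lemma alg_mult_eq_0: "\<not> \<pi> permutes {1..n} \<Longrightarrow> alg_mult n f g \<pi> = 0"
proof -
  assume "\<not> \<pi> permutes {1..n}"
  then have "{(\<sigma>, \<tau>). \<sigma> \<in> carrier (sym_group n) \<and> \<tau> \<in> carrier (sym_group n)
      \<and> \<sigma> \<otimes>\<^bsub>sym_group n\<^esub> \<tau> = \<pi>} = {}"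
    using permutes_compose by (auto simp: sym_group_carrier sym_group_mult)
  then show ?thesis unfolding alg_mult_def by (simp only: sum.empty)
qed

lemma alg_mult_right:
  assumes "\<pi> permutes {1..n}"
  shows "alg_mult n f g \<pi> = (\<Sum>\<tau> | \<tau> permutes {1..n}. f (\<pi> \<circ> inv' \<tau>) * g \<tau>)"
  unfolding alg_mult_def sym_group_carrier sym_group_mult
proof (rule sum.reindex_bij_witness[where i = "\<lambda>\<tau>. (\<pi> \<circ> inv' \<tau>, \<tau>)" and j = snd])
  fix a assume "a \<in> {(\<sigma>, \<tau>). \<sigma> permutes {1..n} \<and> \<tau> permutes {1..n} \<and> \<sigma> \<circ> \<tau> = \<pi>}"
  then obtain \<sigma> \<tau> where a: "a = (\<sigma>, \<tau>)" "\<tau> permutes {1..n}" "\<sigma> \<circ> \<tau> = \<pi>" by auto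
  have "\<pi> \<circ> inv' \<tau> = \<sigma>"
    unfolding a(3)[symmetric] using permutes_inverses[OF a(2)] by (auto simp: fun_eq_iff)
  then show "(\<pi> \<circ> inv' (snd a), snd a) = a" "snd a \<in> {\<tau>. \<tau> permutes {1..n}}"
    "f (\<pi> \<circ> inv' (snd a)) * g (snd a) = (case a of (\<sigma>, \<tau>) \<Rightarrow> f \<sigma> * g \<tau>)"
    using a by simp_all
next
  fix \<tau> assume \<tau>: "\<tau> \<in> {\<tau>. \<tau> permutes {1..n}}"
  then have "\<pi> \<circ> inv' \<tau> \<circ> \<tau> = \<pi>" "\<pi> \<circ> inv' \<tau> permutes {1..n}"
    using permutes_inverses[of \<tau>] permutes_compose[OF permutes_inv assms, of \<tau>] by (auto simp: fun_eq_iff)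
  then show "(\<pi> \<circ> inv' \<tau>, \<tau>) \<in> {(\<sigma>, \<tau>). \<sigma> permutes {1..n} \<and> \<tau> permutes {1..n} \<and> \<sigma> \<circ> \<tau> = \<pi>}"
    using \<tau> by simp
qed simp

lemma alg_mult_left:
  assumes "\<pi> permutes {1..n}"
  shows "alg_mult n f g \<pi> = (\<Sum>\<sigma> | \<sigma> permutes {1..n}. f \<sigma> * g (inv' \<sigma> \<circ> \<pi>))"
  unfolding alg_mult_def sym_group_carrier sym_group_mult
proof (rule sum.reindex_bij_witness[where i = "\<lambda>\<sigma>. (\<sigma>, inv' \<sigma> \<circ> \<pi>)" and j = fst])
  fix a assume "a \<in> {(\<sigma>, \<tau>). \<sigma> permutes {1..n} \<and> \<tau> permutes {1..n} \<and> \<sigma> \<circ> \<tau> = \<pi>}"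
  then obtain \<sigma> \<tau> where a: "a = (\<sigma>, \<tau>)" "\<sigma> permutes {1..n}" "\<sigma> \<circ> \<tau> = \<pi>" by auto
  have "inv' \<sigma> \<circ> \<pi> = \<tau>"
    unfolding a(3)[symmetric] using permutes_inverses[OF a(2)] by (auto simp: fun_eq_iff)
  then show "(fst a, inv' (fst a) \<circ> \<pi>) = a" "fst a \<in> {\<sigma>. \<sigma> permutes {1..n}}"
    "f (fst a) * g (inv' (fst a) \<circ> \<pi>) = (case a of (\<sigma>, \<tau>) \<Rightarrow> f \<sigma> * g \<tau>)"
    using a by simp_all
next
  fix \<sigma> assume \<sigma>: "\<sigma> \<in> {\<sigma>. \<sigma> permutes {1..n}}"
  then have "\<sigma> \<circ> (inv' \<sigma> \<circ> \<pi>) = \<pi>" "inv' \<sigma> \<circ> \<pi> permutes {1..n}"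
    using permutes_inverses[of \<sigma>] permutes_compose[OF assms permutes_inv, of \<sigma>] by (auto simp: fun_eq_iff)
  then show "(\<sigma>, inv' \<sigma> \<circ> \<pi>) \<in> {(\<sigma>, \<tau>). \<sigma> permutes {1..n} \<and> \<tau> permutes {1..n} \<and> \<sigma> \<circ> \<tau> = \<pi>}"
    using \<sigma> by simp
qed simp

lemma sum_lin_comb:
  assumes "finite A" "Q \<subseteq> A"
  shows "(\<Sum>\<tau>\<in>A. h \<tau> * lin_comb Q v \<tau>) = (\<Sum>\<tau>\<in>Q. h \<tau> * v \<tau>)"
proof -
  have "(\<Sum>\<tau>\<in>A. h \<tau> * lin_comb Q v \<tau>) = (\<Sum>\<tau>\<in>A. if \<tau> \<in> Q then h \<tau> * v \<tau> else 0)"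
    by (intro sum.cong refl) (simp add: lin_comb_def)
  also have "\<dots> = (\<Sum>\<tau>\<in>Q. h \<tau> * v \<tau>)"
    using assms by (subst sum.inter_restrict[symmetric]) (simp_all add: Int_absorb1)
  finally show ?thesis .
qed

lemma alg_mult_lin_comb_right:
  assumes "\<pi> permutes {1..n}" "Q \<subseteq> {\<tau>. \<tau> permutes {1..n}}"
  shows "alg_mult n f (lin_comb Q v) \<pi> = (\<Sum>\<tau>\<in>Q. f (\<pi> \<circ> inv' \<tau>) * v \<tau>)"
  unfolding alg_mult_right[OF assms(1)] by (rule sum_lin_comb[OF finite_permutations assms(2)]) simp

lemma alg_mult_lin_comb_left:
  assumes "\<pi> permutes {1..n}" "P \<subseteq> {\<tau>. \<tau> permutes {1..n}}"
  shows "alg_mult n (lin_comb P u) g \<pi> = (\<Sum>\<sigma>\<in>P. u \<sigma> * g (inv' \<sigma> \<circ> \<pi>))"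
  unfolding alg_mult_left[OF assms(1)]
  using sum_lin_comb[OF finite_permutations assms(2), of "\<lambda>\<sigma>. g (inv' \<sigma> \<circ> \<pi>)" u] by (simp add: mult.commute)

lemma alg_mult_lin_comb_product:
  assumes \<pi>: "\<pi> permutes {1..n}"
    and P: "P \<subseteq> {\<tau>. \<tau> permutes {1..n}}" and Q: "Q \<subseteq> {\<tau>. \<tau> permutes {1..n}}"
  shows "alg_mult n f (alg_mult n (lin_comb P u) (lin_comb Q v)) \<pi> =
    (\<Sum>\<sigma>\<in>P. \<Sum>\<tau>\<in>Q. u \<sigma> * v \<tau> * f (\<pi> \<circ> inv' (\<sigma> \<circ> \<tau>)))"
proof -
  let ?G = "{\<tau>. \<tau> permutes {1..n}}"
  have "alg_mult n f (alg_mult n (lin_comb P u) (lin_comb Q v)) \<pi> =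
      (\<Sum>\<kappa>\<in>?G. f (\<pi> \<circ> inv' \<kappa>) * (\<Sum>\<sigma>\<in>P. u \<sigma> * lin_comb Q v (inv' \<sigma> \<circ> \<kappa>)))"
    unfolding alg_mult_right[OF \<pi>, of f]
  proof (rule sum.cong[OF refl])
    fix \<kappa> assume "\<kappa> \<in> ?G"
    then have \<kappa>: "\<kappa> permutes {1..n}" by simp
    show "f (\<pi> \<circ> inv' \<kappa>) * alg_mult n (lin_comb P u) (lin_comb Q v) \<kappa> =
        f (\<pi> \<circ> inv' \<kappa>) * (\<Sum>\<sigma>\<in>P. u \<sigma> * lin_comb Q v (inv' \<sigma> \<circ> \<kappa>))"
      unfolding alg_mult_lin_comb_left[OF \<kappa> P] ..
  qed
  also have "\<dots> = (\<Sum>\<sigma>\<in>P. \<Sum>\<kappa>\<in>?G. f (\<pi> \<circ> inv' \<kappa>) * (u \<sigma> * lin_comb Q v (inv' \<sigma> \<circ> \<kappa>)))"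
    unfolding sum_distrib_left by (rule sum.swap)
  also have "\<dots> = (\<Sum>\<sigma>\<in>P. \<Sum>\<tau>\<in>Q. u \<sigma> * v \<tau> * f (\<pi> \<circ> inv' (\<sigma> \<circ> \<tau>)))"
  proof (rule sum.cong[OF refl])
    fix \<sigma> assume "\<sigma> \<in> P"
    then have \<sigma>: "\<sigma> permutes {1..n}" using P by blast
    have cancel: "inv' \<sigma> \<circ> (\<sigma> \<circ> \<tau>) = \<tau>" for \<tau>
      using permutes_inverses[OF \<sigma>] by (auto simp: fun_eq_iff)
    have "(\<Sum>\<kappa>\<in>?G. f (\<pi> \<circ> inv' \<kappa>) * (u \<sigma> * lin_comb Q v (inv' \<sigma> \<circ> \<kappa>))) =
        (\<Sum>\<tau>\<in>?G. f (\<pi> \<circ> inv' (\<sigma> \<circ> \<tau>)) * (u \<sigma> * lin_comb Q v (inv' \<sigma> \<circ> (\<sigma> \<circ> \<tau>))))"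
      by (rule setum_permutations_compose_left[OF \<sigma>])
    also have "\<dots> = (\<Sum>\<tau>\<in>?G. u \<sigma> * f (\<pi> \<circ> inv' (\<sigma> \<circ> \<tau>)) * lin_comb Q v \<tau>)"
      unfolding cancel by (intro sum.cong refl) (simp only: mult_ac)
    also have "\<dots> = (\<Sum>\<tau>\<in>Q. u \<sigma> * f (\<pi> \<circ> inv' (\<sigma> \<circ> \<tau>)) * v \<tau>)"
      by (rule sum_lin_comb[OF finite_permutations Q]) simp
    also have "\<dots> = (\<Sum>\<tau>\<in>Q. u \<sigma> * v \<tau> * f (\<pi> \<circ> inv' (\<sigma> \<circ> \<tau>)))"
      by (intro sum.cong refl) (simp only: mult_ac)
    finally show "(\<Sum>\<kappa>\<in>?G. f (\<pi> \<circ> inv' \<kappa>) * (u \<sigma> * lin_comb Q v (inv' \<sigma> \<circ> \<kappa>))) =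
        (\<Sum>\<tau>\<in>Q. u \<sigma> * v \<tau> * f (\<pi> \<circ> inv' (\<sigma> \<circ> \<tau>)))" .
  qed
  finally show ?thesis .
qed

text \<open>Factorizations of elements of \<open>R\<close> are unique, so each convolution sum has
  at most one nonzero term.\<close>

lemma alg_mult_lin_comb:
  assumes P: "P \<subseteq> {\<tau>. \<tau> permutes {1..n}}" and Q: "Q \<subseteq> {\<tau>. \<tau> permutes {1..n}}"
    and bij: "bij_betw (\<lambda>(\<sigma>, \<tau>). \<sigma> \<circ> \<tau>) (P \<times> Q) R"
    and w: "\<And>\<sigma> \<tau>. \<sigma> \<in> P \<Longrightarrow> \<tau> \<in> Q \<Longrightarrow> w (\<sigma> \<circ> \<tau>) = u \<sigma> * v \<tau>"
  shows "alg_mult n (lin_comb P u) (lin_comb Q v) = lin_comb R w"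
proof
  fix \<pi>
  have fin: "finite {\<tau>. \<tau> permutes {1..n}}" by (rule finite_permutations) simp
  have R: "R = (\<lambda>(\<sigma>, \<tau>). \<sigma> \<circ> \<tau>) ` (P \<times> Q)" using bij_betw_imp_surj_on[OF bij] by simp
  have inj: "\<sigma> = \<sigma>' \<and> \<tau> = \<tau>'"
    if "\<sigma> \<in> P" "\<tau> \<in> Q" "\<sigma>' \<in> P" "\<tau>' \<in> Q" "\<sigma> \<circ> \<tau> = \<sigma>' \<circ> \<tau>'" for \<sigma> \<tau> \<sigma>' \<tau>'
    using inj_onD[OF bij_betw_imp_inj_on[OF bij], of "(\<sigma>, \<tau>)" "(\<sigma>', \<tau>')"] that by simp
  show "alg_mult n (lin_comb P u) (lin_comb Q v) \<pi> = lin_comb R w \<pi>"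
  proof (cases "\<pi> permutes {1..n}")
    case False
    have "\<pi> \<notin> R"
    proof
      assume "\<pi> \<in> R"
      then obtain \<sigma> \<tau> where "\<pi> = \<sigma> \<circ> \<tau>" "\<sigma> \<in> P" "\<tau> \<in> Q" unfolding R by auto
      then show False using False P Q permutes_compose[of \<tau> "{1..n}" \<sigma>] by auto
    qed
    then show ?thesis using False by (simp add: alg_mult_eq_0 lin_comb_def)
  next
    case True
    have sum: "alg_mult n (lin_comb P u) (lin_comb Q v) \<pi> =
        (\<Sum>\<sigma>\<in>P. u \<sigma> * lin_comb Q v (inv' \<sigma> \<circ> \<pi>))"
      by (rule alg_mult_lin_comb_left[OF True P])
    show ?thesis
    proof (cases "\<pi> \<in> R")
      case True
      then obtain \<sigma> \<tau> where \<pi>: "\<pi> = \<sigma> \<circ> \<tau>" "\<sigma> \<in> P" "\<tau> \<in> Q" unfolding R by auto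
      have "inv' \<sigma> \<circ> \<pi> = \<tau>"
        using \<pi> P permutes_inverses[of \<sigma> "{1..n}"] by (auto simp: fun_eq_iff)
      have "(\<Sum>\<sigma>'\<in>P. u \<sigma>' * lin_comb Q v (inv' \<sigma>' \<circ> \<pi>)) =
          (\<Sum>\<sigma>'\<in>{\<sigma>}. u \<sigma>' * lin_comb Q v (inv' \<sigma>' \<circ> \<pi>))"
      proof (rule sum.mono_neutral_right)
        show "finite P" using P fin by (rule finite_subset)
        show "\<forall>\<sigma>'\<in>P - {\<sigma>}. u \<sigma>' * lin_comb Q v (inv' \<sigma>' \<circ> \<pi>) = 0"
        proof
          fix \<sigma>' assume \<sigma>': "\<sigma>' \<in> P - {\<sigma>}"
          have "\<sigma>' \<circ> (inv' \<sigma>' \<circ> \<pi>) = \<pi>"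
            using \<sigma>' P permutes_inverses[of \<sigma>' "{1..n}"] by (auto simp: fun_eq_iff)
          then have "inv' \<sigma>' \<circ> \<pi> \<notin> Q"
            using inj[of \<sigma>' "inv' \<sigma>' \<circ> \<pi>" \<sigma> \<tau>] \<sigma>' \<pi> by auto
          then show "u \<sigma>' * lin_comb Q v (inv' \<sigma>' \<circ> \<pi>) = 0" by (simp add: lin_comb_def)
        qed
      qed (use \<pi> in simp)
      then show ?thesis
        using sum \<open>inv' \<sigma> \<circ> \<pi> = \<tau>\<close> w[OF \<pi>(2,3)] \<pi> True by (simp add: lin_comb_def del: o_apply)
    next
      case False
      have "(\<Sum>\<sigma>\<in>P. u \<sigma> * lin_comb Q v (inv' \<sigma> \<circ> \<pi>)) = 0"
      proof (rule sum.neutral, rule ballI)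
        fix \<sigma> assume \<sigma>: "\<sigma> \<in> P"
        have \<pi>: "\<sigma> \<circ> (inv' \<sigma> \<circ> \<pi>) = \<pi>"
          using \<sigma> P permutes_inverses[of \<sigma> "{1..n}"] by (auto simp: fun_eq_iff)
        have "inv' \<sigma> \<circ> \<pi> \<notin> Q"
        proof
          assume "inv' \<sigma> \<circ> \<pi> \<in> Q"
          with \<sigma> have "(\<lambda>(\<sigma>, \<tau>). \<sigma> \<circ> \<tau>) (\<sigma>, inv' \<sigma> \<circ> \<pi>) \<in> R"
            unfolding R by (intro imageI SigmaI)
          then show False using False unfolding prod.case \<pi> by simp
        qed
        then show "u \<sigma> * lin_comb Q v (inv' \<sigma> \<circ> \<pi>) = 0" by (simp add: lin_comb_def)
      qed
      then show ?thesis using sum False by (simp add: lin_comb_def)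
    qed
  qed
qed

text \<open>A general multiplicative \<open>w\<close> lets one induction serve the rows with
  \<open>w\<close> constantly 1 and the columns with the sign.\<close>

lemma alg_prod_stab:
  fixes w :: "(nat \<Rightarrow> nat) \<Rightarrow> 'k::field_char_0"
  assumes "A \<subseteq> {1..n}" "distinct xs" and w_id: "w id = 1"
    and w: "\<And>\<sigma> \<tau>. \<sigma> permutes {1..n} \<Longrightarrow> \<tau> permutes {1..n} \<Longrightarrow> w (\<sigma> \<circ> \<tau>) = w \<sigma> * w \<tau>"
  shows "alg_prod n (map (\<lambda>i. lin_comb {\<sigma>. \<sigma> permutes {p \<in> A. r p = i}} w) xs) =
    lin_comb (stab r {p \<in> A. r p \<in> set xs}) w"
  using assms(2)
proof (induction xs)
  case Nil
  have "lin_comb {id} (\<lambda>_. 1) \<sigma> = lin_comb {id} w \<sigma>" for \<sigma>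
    using w_id by (cases "\<sigma> = id") (simp_all add: lin_comb_def)
  then show ?case by (simp add: alg_prod_def alg_one_def stab_empty ext)
next
  case (Cons i xs)
  have fin: "finite {p \<in> A. P p}" for P using finite_subset[OF assms(1)] by simp
  have sub: "{\<sigma>. \<sigma> permutes Y} \<subseteq> {\<tau>. \<tau> permutes {1..n}}" if "Y \<subseteq> A" for Y
    using permutes_subset[of _ Y "{1..n}"] that assms(1) by blast
  have "{p \<in> A. r p \<in> set (i # xs)} = {p \<in> A. r p = i} \<union> {p \<in> A. r p \<in> set xs}" by auto
  moreover have "alg_mult n (lin_comb {\<sigma>. \<sigma> permutes {p \<in> A. r p = i}} w)
      (lin_comb (stab r {p \<in> A. r p \<in> set xs}) w) =
      lin_comb (stab r ({p \<in> A. r p = i} \<union> {p \<in> A. r p \<in> set xs})) w"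
  proof (rule alg_mult_lin_comb)
    show P: "{\<sigma>. \<sigma> permutes {p \<in> A. r p = i}} \<subseteq> {\<tau>. \<tau> permutes {1..n}}"
      by (rule sub) simp
    show Q: "stab r {p \<in> A. r p \<in> set xs} \<subseteq> {\<tau>. \<tau> permutes {1..n}}"
      using sub[of "{p \<in> A. r p \<in> set xs}"] by (auto simp: stab_def)
    show "bij_betw (\<lambda>(\<sigma>, \<tau>). \<sigma> \<circ> \<tau>)
        ({\<sigma>. \<sigma> permutes {p \<in> A. r p = i}} \<times> stab r {p \<in> A. r p \<in> set xs})
        (stab r ({p \<in> A. r p = i} \<union> {p \<in> A. r p \<in> set xs}))"
      using Cons.prems by (intro bij_betw_stab_union[OF fin fin, where i = i]) auto
    show "w (\<sigma> \<circ> \<tau>) = w \<sigma> * w \<tau>"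
      if "\<sigma> \<in> {\<sigma>. \<sigma> permutes {p \<in> A. r p = i}}" "\<tau> \<in> stab r {p \<in> A. r p \<in> set xs}" for \<sigma> \<tau>
      using that P Q by (intro w) blast+
  qed
  ultimately show ?case
    using Cons by (simp add: alg_prod_def)
qed

lemma part_antimono: "is_partition lam n \<Longrightarrow> 1 \<le> i \<Longrightarrow> i \<le> j \<Longrightarrow> part lam j \<le> part lam i"
  by (cases "i = j") (auto simp: is_partition_def part_def sorted_wrt_iff_nth_less)

section \<open>Coefficients of the Young symmetrizer as a function of the word\<close>

context young_filling
begin

lemma tab_row_positions:
  assumes "\<And>p. p \<in> X \<Longrightarrow> S (row p, col p) = p"
  shows "tab_row mu S i = {p \<in> X. row p = i}"
proof -
  have D: "young_diagram mu = (\<lambda>p. (row p, col p)) ` X" using bij_betw_imp_surj_on[OF position] by simp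
  show ?thesis
  proof (intro equalityI subsetI)
    fix p assume "p \<in> tab_row mu S i"
    then obtain j q where "p = S (i, j)" "q \<in> X" "(i, j) = (row q, col q)"
      unfolding tab_row_def D by blast
    then show "p \<in> {p \<in> X. row p = i}" using assms[of q] by simp
  next
    fix p assume "p \<in> {p \<in> X. row p = i}"
    then have "(i, col p) \<in> young_diagram mu" "S (i, col p) = p" using assms[of p] by (auto simp: D)
    then show "p \<in> tab_row mu S i" unfolding tab_row_def by force
  qed
qed

lemma tab_column_positions:
  assumes "\<And>p. p \<in> X \<Longrightarrow> S (row p, col p) = p"
  shows "tab_column mu S j = {p \<in> X. col p = j}"
proof -
  have D: "young_diagram mu = (\<lambda>p. (row p, col p)) ` X" using bij_betw_imp_surj_on[OF position] by simp
  show ?thesis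
  proof (intro equalityI subsetI)
    fix p assume "p \<in> tab_column mu S j"
    then obtain i q where "p = S (i, j)" "q \<in> X" "(i, j) = (row q, col q)"
      unfolding tab_column_def D by blast
    then show "p \<in> {p \<in> X. col p = j}" using assms[of q] by simp
  next
    fix p assume "p \<in> {p \<in> X. col p = j}"
    then have "(row p, j) \<in> young_diagram mu" "S (row p, j) = p" using assms[of p] by (auto simp: D)
    then show "p \<in> tab_column mu S j" unfolding tab_column_def by force
  qed
qed

lemma young_symmetrizer_stab:
  assumes S: "\<And>p. p \<in> X \<Longrightarrow> S (row p, col p) = p" and "X \<subseteq> {1..n}" "is_partition mu k"
  shows "young_symmetrizer n mu S =
    alg_mult n (lin_comb (stab row X) (\<lambda>_. 1)) (lin_comb (stab col X) (\<lambda>\<sigma>. of_int (sign \<sigma>) :: 'k::field_char_0))"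
proof -
  have "row p \<in> set [1..<length mu + 1]" if "p \<in> X" for p
    using position_bounds[OF that] by (cases "row p \<le> length mu") (auto simp: part_def)
  then have rows: "{p \<in> X. row p \<in> set [1..<length mu + 1]} = X" by blast
  have "col p \<in> set [1..<part mu 1 + 1]" if "p \<in> X" for p
    using position_bounds[OF that] part_antimono[OF assms(3), of 1 "row p"] by auto
  then have cols: "{p \<in> X. col p \<in> set [1..<part mu 1 + 1]} = X" by blast
  have tab_rows: "tab_row mu S i = {p \<in> X. row p = i}" for i
    using S by (rule tab_row_positions)
  have tab_columns: "tab_column mu S j = {p \<in> X. col p = j}" for j
    using S by (rule tab_column_positions)
  have "row_symmetrizer n mu S = lin_comb (stab row X) (\<lambda>_. 1 :: 'k)"
    unfolding row_symmetrizer_def sym_sum_def tab_rows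
    by (subst alg_prod_stab[OF assms(2)]) (simp_all only: rows distinct_upt mult_1)
  moreover have "column_antisymmetrizer n mu S = lin_comb (stab col X) (\<lambda>\<sigma>. of_int (sign \<sigma>) :: 'k)"
    unfolding column_antisymmetrizer_def alt_sum_def tab_columns
  proof (subst alg_prod_stab[OF assms(2)])
    show "of_int (sign (\<sigma> \<circ> \<tau>)) = (of_int (sign \<sigma>) * of_int (sign \<tau>) :: 'k)"
      if "\<sigma> permutes {1..n}" "\<tau> permutes {1..n}" for \<sigma> \<tau>
      using sign_compose_permutes[OF _ _ that] by simp
  qed (simp_all only: cols distinct_upt sign_id of_int_1)
  ultimately show ?thesis by (simp add: young_symmetrizer_def)
qed

text \<open>The coefficient function of the Young symmetrizer after the sign twist. At most one
  \<rho> contributes: the value is 0 unless each row of \<open>h\<close> is a rearrangement of its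
  column numbers, and otherwise it is the sign of the row permutation that sorts
  \<open>h\<close>.\<close>

definition row_alternant :: "(nat \<Rightarrow> nat) \<Rightarrow> 'k::field_char_0" where
  "row_alternant h = (\<Sum>\<rho>\<in>stab row X. of_int (sign \<rho>) * (if \<forall>p\<in>X. (h \<circ> \<rho>) p = col p then 1 else 0))"

text \<open>These are the Garnir relations. If changing \<open>x\<close> from \<open>i\<close> to
  \<open>j\<close> gives a nonzero value, the row of \<open>x\<close> then contains every column
  number once, in particular \<open>i < j\<close>, say at \<open>y\<close>. So \<open>g\<close> has
  the letter \<open>i\<close> at both \<open>x\<close> and \<open>y\<close>. Changing any third
  place leaves this repetition and gives 0, while the changes at \<open>x\<close> and at
  \<open>y\<close> differ by \<open>transpose x y\<close> and cancel.\<close>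

lemma lower_row_alternant:
  assumes "1 \<le> i" "i < j"
  shows "lower X i j (row_alternant :: _ \<Rightarrow> 'k::field_char_0) g = 0"
proof (cases "\<exists>x\<in>X. g x = i \<and> (row_alternant (g(x := j)) :: 'k) \<noteq> 0")
  case False
  then show ?thesis unfolding lower_def by (intro sum.neutral) auto
next
  case True
  then obtain x where x: "x \<in> X" "g x = i" "(row_alternant (g(x := j)) :: 'k) \<noteq> 0" by blast
  have repeated: "(row_alternant h :: 'k) = 0"
    if "s \<in> X" "t \<in> X" "s \<noteq> t" "row s = row t" "h s = h t" for h s t
    unfolding row_alternant_def
    using signed_sum_stab_zero[OF finite_X that, where \<psi> = "\<lambda>f. if \<forall>p\<in>X. f p = col p then 1 else 0"]
    by simp
  obtain \<rho> where \<rho>: "\<rho> \<in> stab row X" "\<And>p. p \<in> X \<Longrightarrow> (g(x := j)) (\<rho> p) = col p"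
  proof -
    have "\<exists>\<rho>\<in>stab row X. of_int (sign \<rho>) *
        (if \<forall>p\<in>X. (g(x := j) \<circ> \<rho>) p = col p then 1 else 0) \<noteq> (0 :: 'k)"
      using x(3) unfolding row_alternant_def by (rule contrapos_np) (auto intro: sum.neutral)
    then obtain \<rho> where \<rho>: "\<rho> \<in> stab row X" "of_int (sign \<rho>) *
        (if \<forall>p\<in>X. (g(x := j) \<circ> \<rho>) p = col p then 1 else 0) \<noteq> (0 :: 'k)" by blast
    have "\<forall>p\<in>X. (g(x := j) \<circ> \<rho>) p = col p"
      using \<rho>(2) by (rule contrapos_np) (simp only: if_False mult_zero_right)
    then show thesis using that[of \<rho>] \<rho>(1) by simp
  qed
  note perm = stab_permutes[OF \<rho>(1)]
  define q where "q = inv' \<rho> x"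
  have q: "q \<in> X" "\<rho> q = x"
    using x permutes_in_image[OF permutes_inv[OF perm]] permutes_inverses[OF perm] by (auto simp: q_def)
  have "col q = j" using \<rho>(2)[OF q(1)] q by simp
  obtain q' where q': "q' \<in> X" "row q' = row q" "col q' = i"
    using obtain_position[of "row q" i] position_bounds[OF q(1)] \<open>col q = j\<close> assms by auto
  define y where "y = \<rho> q'"
  have y: "y \<in> X" "(g(x := j)) y = i"
    using q' \<rho>(2) permutes_in_image[OF perm] by (auto simp: y_def)
  then have "y \<noteq> x" "g y = i" using assms by auto
  have row_y: "row y = row x"
    using \<rho>(1) q q' unfolding y_def stab_def by auto
  have "lower X i j (row_alternant :: _ \<Rightarrow> 'k) g = (\<Sum>s\<in>{x, y}. row_alternant (g(s := j)))"
    unfolding lower_def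
  proof (rule sum.mono_neutral_right)
    show "finite {s. s \<in> X \<and> g s = i}" using finite_X by simp
    show "{x, y} \<subseteq> {s. s \<in> X \<and> g s = i}" using x y \<open>g y = i\<close> by auto
    show "\<forall>s\<in>{s. s \<in> X \<and> g s = i} - {x, y}. (row_alternant (g(s := j)) :: 'k) = 0"
      using x(1,2) y(1) \<open>y \<noteq> x\<close> \<open>g y = i\<close> row_y by (auto intro!: repeated[of x y])
  qed
  also have "\<dots> = row_alternant (g(x := j)) + row_alternant (g(y := j))"
    using \<open>y \<noteq> x\<close> by simp
  also have "g(y := j) = g(x := j) \<circ> transpose x y"
    using x(2) \<open>g y = i\<close> by (auto simp: fun_eq_iff transpose_def)
  also have "row_alternant (g(x := j) \<circ> transpose x y) = - (row_alternant (g(x := j)) :: 'k)"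
  proof -
    have tr: "transpose x y \<in> stab row X"
      using x(1) y(1) row_y by (intro transpose_in_stab) simp_all
    have sgn: "sign (transpose x y \<circ> \<rho>) = - sign \<rho>" if "\<rho> \<in> stab row X" for \<rho>
      using sign_compose_permutes[OF finite_X finite_X stab_permutes[OF tr] stab_permutes[OF that]]
        \<open>y \<noteq> x\<close> by (simp add: sign_swap_id)
    have "(row_alternant (g(x := j)) :: 'k) = (\<Sum>\<rho>\<in>stab row X. of_int (sign (transpose x y \<circ> \<rho>)) *
        (if \<forall>p\<in>X. (g(x := j) \<circ> (transpose x y \<circ> \<rho>)) p = col p then 1 else 0))"
      unfolding row_alternant_def by (rule sum_stab_compose_left[OF tr, symmetric])
    also have "\<dots> = (\<Sum>\<rho>\<in>stab row X. - (of_int (sign \<rho>) *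
        (if \<forall>p\<in>X. (g(x := j) \<circ> transpose x y \<circ> \<rho>) p = col p then 1 else 0)))"
      by (intro sum.cong refl) (simp only: sgn o_assoc of_int_minus mult_minus_left)
    finally show ?thesis unfolding row_alternant_def sum_negf by simp
  qed
  finally show ?thesis by (simp only: add.right_inverse)
qed

text \<open>A factorization of \<kappa> into \<sigma> from the row group and \<tau> from the column
  group amounts to a \<sigma> for which \<open>col \<circ> inv' \<kappa> \<circ> \<sigma>\<close>
  equals \<open>col\<close>. Its coefficient, the sign of \<tau>, is the product of the signs of
  \<kappa> and \<sigma>; this is why row permutations carry the sign after the twist.\<close>

lemma young_symmetrizer_alternant:
  assumes S: "\<And>p. p \<in> X \<Longrightarrow> S (row p, col p) = p" and X: "X = {1..n}" and "is_partition mu k"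
    and \<kappa>: "\<kappa> permutes {1..n}"
  shows "young_symmetrizer n mu S \<kappa> = of_int (sign \<kappa>) * (row_alternant (col \<circ> inv' \<kappa>) :: 'k::field_char_0)"
proof -
  have perms: "stab r X \<subseteq> {\<tau>. \<tau> permutes {1..n}}" for r
    unfolding X using stab_permutes by blast
  have "young_symmetrizer n mu S \<kappa> =
      (\<Sum>\<sigma>\<in>stab row X. 1 * lin_comb (stab col X) (\<lambda>\<sigma>. of_int (sign \<sigma>) :: 'k) (inv' \<sigma> \<circ> \<kappa>))"
  proof -
    have "young_symmetrizer n mu S = alg_mult n (lin_comb (stab row X) (\<lambda>_. 1))
        (lin_comb (stab col X) (\<lambda>\<sigma>. of_int (sign \<sigma>) :: 'k))"
      using S equalityD1[OF X] assms(3) by (rule young_symmetrizer_stab)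
    then show ?thesis by (simp only: alg_mult_lin_comb_left[OF \<kappa> perms])
  qed
  also have "\<dots> = (\<Sum>\<sigma>\<in>stab row X. of_int (sign \<kappa>) *
      (of_int (sign \<sigma>) * (if \<forall>p\<in>X. (col \<circ> inv' \<kappa> \<circ> \<sigma>) p = col p then 1 else 0)))"
  proof (rule sum.cong[OF refl])
    fix \<sigma> assume "\<sigma> \<in> stab row X"
    then have \<sigma>: "\<sigma> permutes {1..n}" unfolding X by (rule stab_permutes)
    have inv: "inv' (inv' \<sigma> \<circ> \<kappa>) = inv' \<kappa> \<circ> \<sigma>" "inv' (inv' \<kappa> \<circ> \<sigma>) = inv' \<sigma> \<circ> \<kappa>"
      using o_inv_distrib[OF permutes_bij[OF permutes_inv[OF \<sigma>]] permutes_bij[OF \<kappa>]]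
        o_inv_distrib[OF permutes_bij[OF permutes_inv[OF \<kappa>]] permutes_bij[OF \<sigma>]]
        permutes_inv_inv[OF \<sigma>] permutes_inv_inv[OF \<kappa>] by simp_all
    have p: "inv' \<kappa> \<circ> \<sigma> permutes X"
      unfolding X by (rule permutes_compose[OF \<sigma> permutes_inv[OF \<kappa>]])
    have "inv' \<sigma> \<circ> \<kappa> \<in> stab col X \<longleftrightarrow> inv' \<kappa> \<circ> \<sigma> \<in> stab col X"
      using stab_inverse[of "inv' \<sigma> \<circ> \<kappa>" col X] stab_inverse[of "inv' \<kappa> \<circ> \<sigma>" col X]
      unfolding inv by blast
    also have "\<dots> \<longleftrightarrow> (\<forall>p\<in>X. (col \<circ> inv' \<kappa> \<circ> \<sigma>) p = col p)"
      unfolding words_col[symmetric] words_def using p by simp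
    finally have iff: "inv' \<sigma> \<circ> \<kappa> \<in> stab col X \<longleftrightarrow> (\<forall>p\<in>X. (col \<circ> inv' \<kappa> \<circ> \<sigma>) p = col p)" .
    have "permutation \<sigma>" using \<sigma> permutation_permutes by blast
    then have "sign (inv' \<sigma> \<circ> \<kappa>) = sign \<kappa> * sign \<sigma>"
      using sign_compose_permutes[OF _ _ permutes_inv[OF \<sigma>] \<kappa>] by (simp add: sign_inverse mult.commute)
    then show "1 * lin_comb (stab col X) (\<lambda>\<sigma>. of_int (sign \<sigma>) :: 'k) (inv' \<sigma> \<circ> \<kappa>) =
        of_int (sign \<kappa>) * (of_int (sign \<sigma>) * (if \<forall>p\<in>X. (col \<circ> inv' \<kappa> \<circ> \<sigma>) p = col p then 1 else 0))"
      unfolding lin_comb_def iff by (simp del: o_apply)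
  qed
  finally show ?thesis unfolding row_alternant_def sum_distrib_left .
qed

end

text \<open>The words \<open>c \<circ> \<sigma>\<close> and \<open>c\<close> use the same letters on
  \<open>B\<close> with multiplicity, and they agree on \<open>E\<close>, so they also use the same
  letters on \<open>B - E\<close>. A permutation of \<open>B - E\<close> alone therefore realizes
  the word.\<close>

lemma permutation_fixing:
  assumes "finite B" "E \<subseteq> B" "\<sigma> permutes B" and E: "\<And>p. p \<in> E \<Longrightarrow> c (\<sigma> p) = c p"
  obtains \<tau> where "\<tau> permutes B" "c \<circ> \<tau> = c \<circ> \<sigma>" "\<forall>p\<in>E. \<tau> p = p"
proof -
  have fin: "finite E" "finite (B - E)" using assms finite_subset by auto
  have B: "mset_set B = mset_set E + mset_set (B - E)"
    using mset_set_Union[OF fin] \<open>E \<subseteq> B\<close> by (simp add: Un_absorb1)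
  have "image_mset (c \<circ> \<sigma>) (mset_set B) = image_mset c (image_mset \<sigma> (mset_set B))"
    by (simp add: multiset.map_comp)
  also have "image_mset \<sigma> (mset_set B) = mset_set B"
    using image_mset_mset_set[OF permutes_inj_on[OF assms(3)]] permutes_image[OF assms(3)] by simp
  finally have "image_mset (c \<circ> \<sigma>) (mset_set E) + image_mset (c \<circ> \<sigma>) (mset_set (B - E)) =
      image_mset c (mset_set E) + image_mset c (mset_set (B - E))"
    unfolding B image_mset_union .
  moreover have "image_mset (c \<circ> \<sigma>) (mset_set E) = image_mset c (mset_set E)"
    using E fin by (intro image_mset_cong) simp
  ultimately have "image_mset (c \<circ> \<sigma>) (mset_set (B - E)) = image_mset c (mset_set (B - E))"
    by simp
  then obtain \<tau> where \<tau>: "\<tau> permutes (B - E)" "\<forall>p\<in>B - E. (c \<circ> \<sigma>) p = c (\<tau> p)"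
    by (rule image_mset_eq_implies_permutes[OF fin(2)])
  show thesis
  proof
    show "\<tau> permutes B" using \<tau>(1) by (rule permutes_subset) auto
    show "\<forall>p\<in>E. \<tau> p = p" using permutes_not_in[OF \<tau>(1)] by simp
    show "c \<circ> \<tau> = c \<circ> \<sigma>"
    proof
      fix p
      consider "p \<in> B - E" | "p \<in> E" | "p \<notin> B" by blast
      then show "(c \<circ> \<tau>) p = (c \<circ> \<sigma>) p"
        using \<tau>(2) E permutes_not_in[OF \<tau>(1), of p] permutes_not_in[OF assms(3), of p] by cases auto
    qed
  qed
qed

text \<open>Coordinates are read off from the inverse of \<open>T\<close> on the possibly larger
  domain \<open>D\<close>, so that the filling for \<open>S\<close> uses the same \<open>row\<close>
  and \<open>col\<close> as the one for \<open>T\<close>.\<close>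

lemma young_filling_tableau:
  assumes "is_partition mu k" "inj_on T D" "young_diagram mu \<subseteq> D"
  shows "young_filling mu (T ` young_diagram mu) (\<lambda>p. fst (inv_into D T p)) (\<lambda>p. snd (inv_into D T p))"
proof
  show "part mu (Suc i) \<le> part mu i" if "1 \<le> i" for i
    using part_antimono[OF assms(1) that, of "Suc i"] by simp
  have "inj_on T (young_diagram mu)" using assms inj_on_subset by blast
  moreover have "inv_into D T (T d) = d" if "d \<in> young_diagram mu" for d
    using assms that by (intro inv_into_f_f) auto
  ultimately show "bij_betw (\<lambda>p. (fst (inv_into D T p), snd (inv_into D T p)))
      (T ` young_diagram mu) (young_diagram mu)"
    by (intro bij_betwI[where g = T]) auto
qed

theorem theorem1p1:
  fixes n k :: nat
    and lam mu :: "nat list"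
    and T S :: "nat \<times> nat \<Rightarrow> nat"
  assumes "1 \<le> k" and "k \<le> n"
    and "is_partition lam n" and "is_partition mu k"
    and "partition_le mu lam"
    and "young_tableau lam {1..n} T"
    and "S = subtableau mu T"
  shows "\<exists>m :: (nat \<Rightarrow> nat) \<Rightarrow> rat.
           m id = of_nat (hook_product mu) \<and>
           (\<forall>\<sigma> \<in> left_perms n lam T mu S.
              (evenperm \<sigma> \<longrightarrow> m \<sigma> \<ge> 0) \<and> (\<not> evenperm \<sigma> \<longrightarrow> m \<sigma> \<le> 0)) \<and>
           alg_mult n (young_symmetrizer n lam T) (young_symmetrizer n mu S) =
             alg_mult n (young_symmetrizer n lam T)
               (lin_comb (left_perms n lam T mu S) (\<lambda>\<sigma>. of_rat (m \<sigma>)) ::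
                  (nat \<Rightarrow> nat) \<Rightarrow> 'k::field_char_0)"
proof -
  define D where "D = young_diagram lam"
  define B where "B = {1..n}"
  define X where "X = T ` young_diagram mu"
  define row where "row p = fst (inv_into D T p)" for p
  define col where "col p = snd (inv_into D T p)" for p
  have T: "inj_on T D" "T ` D = B"
    using assms(6) by (simp_all add: young_tableau_def bij_betw_def D_def B_def)
  have sub: "young_diagram mu \<subseteq> D"
    using assms(5) by (fastforce simp: D_def young_diagram_def partition_le_def)
  interpret big: young_filling lam B row col
    using young_filling_tableau[OF assms(3) T(1)] T(2) by (simp add: D_def row_def[abs_def] col_def[abs_def])
  interpret small: young_filling mu X row col
    using young_filling_tableau[OF assms(4) T(1) sub] by (simp add: X_def row_def[abs_def] col_def[abs_def])
  have XB: "X \<subseteq> B" using sub T(2) by (auto simp: X_def)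
  have finB: "finite B" by (simp add: B_def)
  have T_pos: "T (row p, col p) = p" if "p \<in> B" for p
    using that T(2) by (simp add: row_def col_def f_inv_into_f)
  have S_pos: "S (row p, col p) = p" if "p \<in> X" for p
  proof -
    have "(row p, col p) \<in> young_diagram mu"
      using bij_betwE[OF small.position] that by blast
    then show ?thesis
      using T_pos that XB by (auto simp: assms(7) subtableau_def)
  qed
  have entries: "tab_entries mu S = X"
    unfolding tab_entries_def X_def assms(7) subtableau_def by (rule image_cong) simp_all
  have tab_col: "tab_column lam T j = {p \<in> B. col p = j}" for j
    using T_pos by (rule big.tab_column_positions)
  have pos: "1 \<le> col p" if "p \<in> B" for p using big.position_bounds(2)[OF that] .
  define W where "W = {col \<circ> \<sigma> |\<sigma>. \<sigma> permutes B}"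
  define L where "L = left_perms n lam T mu S"
  define \<alpha> where "\<alpha> = hook_product mu"
  obtain v :: "(nat \<Rightarrow> nat) \<Rightarrow> rat" where v_nonneg: "\<And>g. 0 \<le> v g"
    and v_supp: "\<And>g. v g \<noteq> 0 \<Longrightarrow> g \<in> W \<and> weight X col col < weight X col g \<and> (\<forall>s\<in>X. g s \<le> col s)"
    and v_eq: "\<And>\<phi> :: (nat \<Rightarrow> nat) \<Rightarrow> 'k.
      (\<And>i j g. 1 \<le> i \<Longrightarrow> i < j \<Longrightarrow> lower B i j \<phi> g = 0) \<Longrightarrow>
      (\<Sum>\<rho>\<in>stab row X. of_int (sign \<rho>) * (\<Sum>\<tau>\<in>stab col X. \<phi> (col \<circ> (\<rho> \<circ> \<tau>)))) =
      of_nat \<alpha> * \<phi> col + (\<Sum>g\<in>W. of_rat (v g) * \<phi> g)"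
  proof (rule small.straightening[where 'k = 'k and B = B, folded W_def \<alpha>_def])
    fix u :: "(nat \<Rightarrow> nat) \<Rightarrow> rat"
    assume "\<And>g. 0 \<le> u g"
      and "\<And>g. u g \<noteq> 0 \<Longrightarrow> g \<in> W \<and> weight X col col < weight X col g \<and> (\<forall>s\<in>X. g s \<le> col s)"
      and "\<And>\<phi> :: (nat \<Rightarrow> nat) \<Rightarrow> 'k.
        (\<And>i j g. 1 \<le> i \<Longrightarrow> i < j \<Longrightarrow> lower B i j \<phi> g = 0) \<Longrightarrow>
        (\<Sum>\<rho>\<in>stab row X. of_int (sign \<rho>) * (\<Sum>\<tau>\<in>stab col X. \<phi> (col \<circ> (\<rho> \<circ> \<tau>)))) =
        of_nat \<alpha> * \<phi> col + (\<Sum>g\<in>W. of_rat (u g) * \<phi> g)"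
    then show thesis by (rule that)
  qed (use finB XB pos in simp_all)
  define W' where "W' = {g \<in> W. v g \<noteq> 0}"
  have finW: "finite W"
  proof -
    have "W = (\<lambda>\<sigma>. col \<circ> \<sigma>) ` {\<sigma>. \<sigma> permutes B}" unfolding W_def by blast
    then show ?thesis using finite_permutations[OF finB] by simp
  qed
  \<comment> \<open>Represent \<open>g\<close> by a permutation fixing every entry of
    \<open>S\<close> whose letter is unchanged. The other entries of \<open>S\<close> receive a
    strictly smaller letter, so they are sent to a column further left. Such entries exist, since
    \<open>g\<close> has larger weight than \<open>col\<close>; hence the representative is not the
    identity and satisfies the last condition on \<open>L(T;S)\<close>.\<close>
  have "\<exists>\<sigma>. \<sigma> \<in> L \<and> \<sigma> \<noteq> id \<and> col \<circ> \<sigma> = g" if "g \<in> W'" for g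
  proof -
    from that have supp: "g \<in> W" "weight X col col < weight X col g" "\<forall>s\<in>X. g s \<le> col s"
      using v_supp by (auto simp: W'_def)
    from supp(1) obtain \<pi> where \<pi>: "g = col \<circ> \<pi>" "\<pi> permutes B" unfolding W_def by blast
    define E where "E = {s \<in> X. g s = col s}"
    have "E \<subseteq> B" using XB by (auto simp: E_def)
    moreover have "col (\<pi> p) = col p" if "p \<in> E" for p
      using that \<pi>(1) by (simp add: E_def)
    ultimately obtain \<sigma> where \<sigma>: "\<sigma> permutes B" "col \<circ> \<sigma> = col \<circ> \<pi>" "\<forall>p\<in>E. \<sigma> p = p"
      by (rule permutation_fixing[OF finB _ \<pi>(2)])
    have "\<not> (\<forall>s\<in>X. g s = col s)"
      using weight_cong[of X g col col] supp(2) by auto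
    then obtain s where s: "s \<in> X" "g s \<noteq> col s" by blast
    have "\<sigma> s \<noteq> s" using s fun_cong[OF \<sigma>(2), of s] \<pi>(1) by auto
    moreover have "\<sigma> s = s \<or> (\<exists>j j'. s \<in> tab_column lam T j \<and> \<sigma> s \<in> tab_column lam T j' \<and> j' < j)"
      if "s \<in> X" for s
    proof (cases "g s = col s")
      case False
      then have "col (\<sigma> s) < col s"
        using supp(3) that fun_cong[OF \<sigma>(2), of s] \<pi>(1) by (auto simp: le_less)
      moreover have "s \<in> B" "\<sigma> s \<in> B" using that XB permutes_in_image[OF \<sigma>(1)] by auto
      ultimately show ?thesis unfolding tab_col by blast
    qed (use \<sigma>(3) that in \<open>simp add: E_def\<close>)
    ultimately have "\<sigma> \<in> L"
      unfolding L_def left_perms_def entries using s(1) \<sigma>(1) by (auto simp: sym_group_carrier B_def)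
    then show ?thesis using \<open>\<sigma> s \<noteq> s\<close> \<sigma>(2) \<pi>(1) by (intro exI[of _ \<sigma>]) auto
  qed
  then obtain pick where pick: "\<And>g. g \<in> W' \<Longrightarrow> pick g \<in> L \<and> pick g \<noteq> id \<and> col \<circ> pick g = g"
    by metis
  have id_L: "id \<in> L"
    unfolding L_def left_perms_def by (simp add: sym_group_carrier permutes_id)
  have L_perm: "L \<subseteq> {\<sigma>. \<sigma> permutes {1..n}}"
    unfolding L_def left_perms_def sym_group_carrier by blast
  \<comment> \<open>The factor \<open>sign \<sigma>\<close> undoes the twist and turns the
    nonnegativity of \<open>v\<close> into the required sign pattern. One representative per word
    suffices; all others get 0.\<close>
  define m where "m \<sigma> = (if \<sigma> = id then of_nat \<alpha> else
      if \<sigma> \<in> pick ` W' then of_int (sign \<sigma>) * v (col \<circ> \<sigma>) else 0)" for \<sigma>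
  show ?thesis
  proof (intro exI[of _ m] conjI ballI impI)
    show "m id = of_nat (hook_product mu)" by (simp add: m_def \<alpha>_def)
    show "0 \<le> m \<sigma>" if "evenperm \<sigma>" for \<sigma>
      using v_nonneg that by (simp add: m_def sign_def)
    show "m \<sigma> \<le> 0" if "\<not> evenperm \<sigma>" for \<sigma>
      using v_nonneg that by (auto simp: m_def sign_def)
    define c :: "(nat \<Rightarrow> nat) \<Rightarrow> 'k" where "c = young_symmetrizer n lam T"
    show "alg_mult n (young_symmetrizer n lam T) (young_symmetrizer n mu S) =
        alg_mult n (young_symmetrizer n lam T)
          (lin_comb (left_perms n lam T mu S) (\<lambda>\<sigma>. of_rat (m \<sigma>)) :: (nat \<Rightarrow> nat) \<Rightarrow> 'k)"
      unfolding c_def[symmetric] L_def[symmetric]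
    proof
      fix \<pi>
      show "alg_mult n c (young_symmetrizer n mu S) \<pi> = alg_mult n c (lin_comb L (\<lambda>\<sigma>. of_rat (m \<sigma>))) \<pi>"
      proof (cases "\<pi> permutes {1..n}")
        case False
        then show ?thesis by (simp add: alg_mult_eq_0)
      next
        case True
        \<comment> \<open>For fixed \<pi> the coefficient at \<pi> of the symmetrizer of
          \<open>T\<close> times \<sigma> is \<open>sign \<sigma>\<close> times the value of this
          function at \<open>col \<circ> \<sigma>\<close>. It inherits the Garnir relations from
          \<open>row_alternant\<close>, so it is an admissible test function, and both sides of the
          claim are compared at \<pi>.\<close>
        define \<phi> :: "(nat \<Rightarrow> nat) \<Rightarrow> 'k" where
          "\<phi> f = of_int (sign \<pi>) * big.row_alternant (f \<circ> inv' \<pi>)" for f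
        have inv_\<pi>: "inv' \<pi> permutes B" unfolding B_def by (rule permutes_inv[OF True])
        have low: "lower B i j \<phi> g = 0" if "1 \<le> i" "i < j" for i j g
        proof -
          have "lower B i j \<phi> g =
              of_int (sign \<pi>) * lower B i j (\<lambda>f. big.row_alternant (f \<circ> inv' \<pi>)) g"
            unfolding \<phi>_def lower_def sum_distrib_left ..
          also have "\<dots> = of_int (sign \<pi>) * lower B i j big.row_alternant (g \<circ> inv' \<pi>)"
            unfolding lower_compose[OF inv_\<pi>] ..
          finally show ?thesis
            unfolding big.lower_row_alternant[OF that] mult_zero_right .
        qed
        have c: "c (\<pi> \<circ> inv' \<sigma>) = of_int (sign \<sigma>) * \<phi> (col \<circ> \<sigma>)" if \<sigma>: "\<sigma> permutes {1..n}" for \<sigma>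
        proof -
          have inv: "inv' (\<pi> \<circ> inv' \<sigma>) = \<sigma> \<circ> inv' \<pi>"
            using o_inv_distrib[OF permutes_bij[OF True] permutes_bij[OF permutes_inv[OF \<sigma>]]]
            by (simp add: permutes_inv_inv[OF \<sigma>])
          have "permutation \<sigma>" using \<sigma> permutation_permutes by blast
          then have "sign (\<pi> \<circ> inv' \<sigma>) = sign \<pi> * sign \<sigma>"
            using sign_compose_permutes[OF _ _ True permutes_inv[OF \<sigma>]] by (simp add: sign_inverse)
          moreover have "c (\<pi> \<circ> inv' \<sigma>) =
              of_int (sign (\<pi> \<circ> inv' \<sigma>)) * big.row_alternant (col \<circ> inv' (\<pi> \<circ> inv' \<sigma>))"
            unfolding c_def
            using T_pos B_def assms(3) permutes_compose[OF permutes_inv[OF \<sigma>] True]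
            by (rule big.young_symmetrizer_alternant)
          ultimately show ?thesis
            unfolding inv \<phi>_def by (simp add: o_assoc mult.left_commute mult.assoc del: o_apply)
        qed
        have stab_perm: "\<tau> permutes {1..n}" if "\<tau> \<in> stab r X" for r \<tau>
          using permutes_subset[OF stab_permutes[OF that] XB] by (simp add: B_def)
        have "alg_mult n c (young_symmetrizer n mu S) \<pi> =
            (\<Sum>\<rho>\<in>stab row X. \<Sum>\<tau>\<in>stab col X. of_int (sign \<tau>) * c (\<pi> \<circ> inv' (\<rho> \<circ> \<tau>)))"
        proof -
          have "young_symmetrizer n mu S = alg_mult n (lin_comb (stab row X) (\<lambda>_. 1))
              (lin_comb (stab col X) (\<lambda>\<sigma>. of_int (sign \<sigma>) :: 'k))"
            using S_pos XB[unfolded B_def] assms(4) by (rule small.young_symmetrizer_stab)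
          moreover have "stab r X \<subseteq> {\<tau>. \<tau> permutes {1..n}}" for r
            using stab_perm by blast
          ultimately show ?thesis
            by (simp only: alg_mult_lin_comb_product[OF True] mult_1)
        qed
        also have "\<dots> = (\<Sum>\<rho>\<in>stab row X. of_int (sign \<rho>) * (\<Sum>\<tau>\<in>stab col X. \<phi> (col \<circ> (\<rho> \<circ> \<tau>))))"
        proof (rule sum.cong[OF refl])
          fix \<rho> assume \<rho>: "\<rho> \<in> stab row X"
          have "of_int (sign \<tau>) * c (\<pi> \<circ> inv' (\<rho> \<circ> \<tau>)) = of_int (sign \<rho>) * \<phi> (col \<circ> (\<rho> \<circ> \<tau>))"
            if \<tau>: "\<tau> \<in> stab col X" for \<tau>
          proof -
            note p = stab_perm[OF \<rho>] stab_perm[OF \<tau>]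
            have "sign (\<rho> \<circ> \<tau>) = sign \<tau> * sign \<rho>"
              using sign_compose_permutes[OF _ _ p] by simp
            then show ?thesis
              unfolding c[OF permutes_compose[OF p(2,1)]]
              by (simp add: mult.assoc of_int_sign_square del: o_apply)
          qed
          then show "(\<Sum>\<tau>\<in>stab col X. of_int (sign \<tau>) * c (\<pi> \<circ> inv' (\<rho> \<circ> \<tau>))) =
              of_int (sign \<rho>) * (\<Sum>\<tau>\<in>stab col X. \<phi> (col \<circ> (\<rho> \<circ> \<tau>)))"
            unfolding sum_distrib_left by (rule sum.cong[OF refl])
        qed
        also have "\<dots> = of_nat \<alpha> * \<phi> col + (\<Sum>g\<in>W. of_rat (v g) * \<phi> g)"
          using low by (rule v_eq)
        also have "(\<Sum>g\<in>W. of_rat (v g) * \<phi> g) = (\<Sum>g\<in>W'. of_rat (v g) * \<phi> g)"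
          using finW by (intro sum.mono_neutral_right) (auto simp: W'_def)
        also have "\<dots> = (\<Sum>\<sigma>\<in>pick ` W'. of_rat (v (col \<circ> \<sigma>)) * \<phi> (col \<circ> \<sigma>))"
        proof -
          have "inj_on pick W'" using pick by (metis inj_onI)
          then show ?thesis using pick by (simp add: sum.reindex)
        qed
        also have "\<dots> = (\<Sum>\<sigma>\<in>pick ` W'. c (\<pi> \<circ> inv' \<sigma>) * of_rat (m \<sigma>))"
        proof (rule sum.cong[OF refl])
          fix \<sigma> assume \<sigma>: "\<sigma> \<in> pick ` W'"
          then have "\<sigma> \<in> L" "\<sigma> \<noteq> id" using pick by auto
          then have c_eq: "c (\<pi> \<circ> inv' \<sigma>) = of_int (sign \<sigma>) * \<phi> (col \<circ> \<sigma>)"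
            using L_perm by (intro c) blast
          have m_eq: "of_rat (m \<sigma>) = (of_int (sign \<sigma>) * of_rat (v (col \<circ> \<sigma>)) :: 'k)"
            using \<sigma> \<open>\<sigma> \<noteq> id\<close> by (simp add: m_def of_rat_mult del: o_apply)
          have "c (\<pi> \<circ> inv' \<sigma>) * of_rat (m \<sigma>) =
              of_int (sign \<sigma>) * (of_int (sign \<sigma>) * (of_rat (v (col \<circ> \<sigma>)) * \<phi> (col \<circ> \<sigma>)))"
            unfolding c_eq m_eq by (simp only: mult_ac)
          then show "of_rat (v (col \<circ> \<sigma>)) * \<phi> (col \<circ> \<sigma>) = c (\<pi> \<circ> inv' \<sigma>) * of_rat (m \<sigma>)"
            unfolding of_int_sign_square by (rule sym)
        qed
        also have "of_nat \<alpha> * \<phi> col = c (\<pi> \<circ> inv' id) * of_rat (m id)"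
          unfolding c[OF permutes_id] by (simp add: m_def sign_id)
        also have "c (\<pi> \<circ> inv' id) * of_rat (m id) + (\<Sum>\<sigma>\<in>pick ` W'. c (\<pi> \<circ> inv' \<sigma>) * of_rat (m \<sigma>)) =
            (\<Sum>\<sigma>\<in>insert id (pick ` W'). c (\<pi> \<circ> inv' \<sigma>) * of_rat (m \<sigma>))"
        proof -
          have "id \<notin> pick ` W'" using pick by (metis imageE)
          moreover have "finite (pick ` W')" using finW by (simp add: W'_def)
          ultimately show ?thesis by simp
        qed
        also have "\<dots> = (\<Sum>\<sigma>\<in>L. c (\<pi> \<circ> inv' \<sigma>) * of_rat (m \<sigma>))"
        proof (rule sum.mono_neutral_left)
          show "finite L" using finite_subset[OF L_perm finite_permutations] by simp
          show "insert id (pick ` W') \<subseteq> L" using id_L pick by blast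
        qed (simp add: m_def)
        also have "\<dots> = alg_mult n c (lin_comb L (\<lambda>\<sigma>. of_rat (m \<sigma>))) \<pi>"
          by (rule alg_mult_lin_comb_right[OF True L_perm, symmetric])
        finally show ?thesis .
      qed
    qed
  qed
qed

end
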